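(* Let $n\ge 2$ and let $\Delta(\mathbf{x},B)$ be a cluster complex of $B_n$ or $C_n$ type. Suppose that, up to relabeling vertices, the valued quiver $Q_B$ has one of the following forms (all arrows not mentioned have value $(1,1)$): (a) $1\to 2\to\cdots\to n-1\to n$, with the arrow $n-1\to n$ of value $(1,2)$; (b) $1\leftarrow 2\leftarrow\cdots\leftarrow n-1\leftarrow n$, with the arrow $n\to n-1$ of value $(2,1)$; (c) $1\to 2\to\cdots\to n-1\to n$, with the arrow $n-1\to n$ of value $(2,1)$; (d) $1\leftarrow 2\leftarrow\cdots\leftarrow n-1\leftarrow n$, with the arrow $n\to n-1$ of value $(1,2)$. Let $I$ be the set of all cluster variables in the initial cluster $\mathbf{x}$. Then $\Delta^+(\mathbf{x},B)$ is isomorphic to $\mathsf{st}_{\Delta(\mathbf{x},B)}(I)$.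
   Context: Seeds and mutation. Let $\mathcal F$ be a field of rational functions in $n$ indeterminates over $\mathbb Q$. A labeled seed is a pair $(\mathbf{x},B)$ where $\mathbf{x}=(x_1,\dots,x_n)$ is a free generating set of $\mathcal F$ (the cluster; its elements are cluster variables) and $B=(b_{ij})$ is a skew-symmetrizable $n\times n$ integer matrix (there is a positive integer diagonal matrix $S$ with $SB$ skew-symmetric). With $[b]_+=\max(b,0)$, the mutation in direction $k$ sends $(\mathbf{x},B)$ to $(\mathbf{x}',B')$ with $b'_{ij}=-b_{ij}$ if $i=k$ or $j=k$, and $b'_{ij}=b_{ij}+[b_{ik}]_+b_{kj}+b_{ik}[-b_{kj}]_+$ otherwise; $x'_j=x_j$ for $j\ne k$ and $x'_k=\big(\prod_i x_i^{[b_{ik}]_+}+\prod_i x_i^{[-b_{ik}]_+}\big)/x_k$. Cluster complexes. The cluster complex $\Delta(\mathbf{x},B)$ is the simplicial complex whose vertices are all cluster variables of seeds obtained from $(\mathbf{x},B)$ by finite sequences of mutations, and whose simplices are all subsets (including $\emptyset$) of the clusters of these seeds. The positive cluster complex $\Delta^+(\mathbf{x},B)$ is the full subcomplex of $\Delta(\mathbf{x},B)$ on the cluster variables not belonging to the initial cluster $\mathbf{x}$. Valued quivers and type. $Q_B$ has vertices $1,\dots,n$ and an arrow $i\to j$ with value $(b_{ij},-b_{ji})$ whenever $b_{ij}>0$. $\Delta(\mathbf{x},B)$ is of $B_n$ (resp. $C_n$) type if $B$ is mutation equivalent (up to relabeling indices) to a matrix $B'$ whose associated matrix $A(B')$ (diagonal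 entries $2$, off-diagonal entries $-|b'_{ij}|$) is the Cartan matrix of type $B_n$ (resp. $C_n$). Stars. For a simplicial complex $L$ and a vertex $v$, $\mathsf{st}_L(v)$ is the subcomplex of all simplices $\sigma$ of $L$ such that $\sigma\cup\{v\}$ is a simplex of $L$. For a set $V$ of vertices, $\mathsf{st}_L(V)=\bigcup_{v\in V}\mathsf{st}_L(v)$. *)

theory Defs
  imports Complex_Main "HOL-Library.Poly_Mapping" "HOL-Combinatorics.Permutations"
begin

text \<open>
  The ambient field is the type \<open>'a\<close>.  Families indexed by $1,\dots,n$ and
  $n \times n$ matrices are functions on \<open>nat\<close>; only their values on the index set
  \<open>{1..n}\<close> are ever used.
\<close>

subsection \<open>Free generating sets\<close>

text \<open>
  Polynomials over the rationals are finitely supported maps from exponent vectors to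
  coefficients.
\<close>

definition mpoly_eval :: "(nat \<Rightarrow> 'a) \<Rightarrow> ((nat \<Rightarrow>\<^sub>0 nat) \<Rightarrow>\<^sub>0 rat) \<Rightarrow> 'a::field_char_0" where
  "mpoly_eval x p =
     (\<Sum>m\<in>Poly_Mapping.keys p.
        of_rat (Poly_Mapping.lookup p m) *
        (\<Prod>i\<in>Poly_Mapping.keys m. x i ^ Poly_Mapping.lookup m i))"

definition algebraically_independent :: "nat \<Rightarrow> (nat \<Rightarrow> 'a::field_char_0) \<Rightarrow> bool" where
  "algebraically_independent n x \<longleftrightarrow>
     (\<forall>p :: (nat \<Rightarrow>\<^sub>0 nat) \<Rightarrow>\<^sub>0 rat.
        (\<forall>m\<in>Poly_Mapping.keys p. Poly_Mapping.keys m \<subseteq> {1..n}) \<longrightarrow>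
        mpoly_eval x p = 0 \<longrightarrow> p = 0)"

definition is_subfield :: "'a::field set \<Rightarrow> bool" where
  "is_subfield K \<longleftrightarrow>
     1 \<in> K \<and> (\<forall>a\<in>K. \<forall>b\<in>K. a - b \<in> K \<and> a * b \<in> K) \<and> (\<forall>a\<in>K. inverse a \<in> K)"

definition cluster :: "nat \<Rightarrow> (nat \<Rightarrow> 'a) \<Rightarrow> 'a set" where
  "cluster n x = x ` {1..n}"

text \<open>
  If such a family exists, the field \<open>'a\<close> is a field of rational functions in $n$
  indeterminates over the rationals.
\<close>

definition free_generating_set :: "nat \<Rightarrow> (nat \<Rightarrow> 'a::field_char_0) \<Rightarrow> bool" where
  "free_generating_set n x \<longleftrightarrow>
     algebraically_independent n x \<and> is_subfield hull (cluster n x) = UNIV"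


subsection \<open>Labeled seeds and mutation\<close>

type_synonym int_matrix = "nat \<Rightarrow> nat \<Rightarrow> int"

type_synonym 'a seed = "(nat \<Rightarrow> 'a) \<times> int_matrix"

definition skew_symmetrizable :: "nat \<Rightarrow> int_matrix \<Rightarrow> bool" where
  "skew_symmetrizable n B \<longleftrightarrow>
     (\<exists>s :: nat \<Rightarrow> int. (\<forall>i\<in>{1..n}. s i > 0) \<and>
        (\<forall>i\<in>{1..n}. \<forall>j\<in>{1..n}. s i * B i j = - (s j * B j i)))"

definition labeled_seed :: "nat \<Rightarrow> (nat \<Rightarrow> 'a::field_char_0) \<Rightarrow> int_matrix \<Rightarrow> bool" where
  "labeled_seed n x B \<longleftrightarrow> free_generating_set n x \<and> skew_symmetrizable n B"

definition pos_part :: "int \<Rightarrow> int" where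
  "pos_part b = max b 0"

definition mutate_matrix :: "nat \<Rightarrow> int_matrix \<Rightarrow> int_matrix" where
  "mutate_matrix k B =
     (\<lambda>i j. if i = k \<or> j = k then - B i j
            else B i j + pos_part (B i k) * B k j + B i k * pos_part (- B k j))"

definition mutate_cluster :: "nat \<Rightarrow> nat \<Rightarrow> 'a::field_char_0 seed \<Rightarrow> (nat \<Rightarrow> 'a)" where
  "mutate_cluster n k = (\<lambda>(x, B). x(k :=
     ((\<Prod>i\<in>{1..n}. x i ^ nat (pos_part (B i k))) +
      (\<Prod>i\<in>{1..n}. x i ^ nat (pos_part (- B i k)))) / x k))"

definition mutate_seed :: "nat \<Rightarrow> nat \<Rightarrow> 'a::field_char_0 seed \<Rightarrow> 'a seed" where
  "mutate_seed n k = (\<lambda>(x, B). (mutate_cluster n k (x, B), mutate_matrix k B))"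

definition seed_step :: "nat \<Rightarrow> 'a::field_char_0 seed \<Rightarrow> 'a seed \<Rightarrow> bool" where
  "seed_step n s s' \<longleftrightarrow> (\<exists>k\<in>{1..n}. s' = mutate_seed n k s)"

definition matrix_step :: "nat \<Rightarrow> int_matrix \<Rightarrow> int_matrix \<Rightarrow> bool" where
  "matrix_step n B B' \<longleftrightarrow> (\<exists>k\<in>{1..n}. B' = mutate_matrix k B)"

definition mutation_equivalent_relabel :: "nat \<Rightarrow> int_matrix \<Rightarrow> int_matrix \<Rightarrow> bool" where
  "mutation_equivalent_relabel n B B' \<longleftrightarrow>
     (\<exists>C \<pi>. (matrix_step n)\<^sup>*\<^sup>* B C \<and> \<pi> permutes {1..n} \<and>
        (\<forall>i\<in>{1..n}. \<forall>j\<in>{1..n}. B' i j = C (\<pi> i) (\<pi> j)))"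


subsection \<open>Simplicial complexes\<close>

text \<open>
  A simplicial complex is given by its set of simplices, the empty simplex included; its
  vertex set is the union of its simplices.
\<close>

definition full_subcomplex :: "'v set set \<Rightarrow> 'v set \<Rightarrow> 'v set set" where
  "full_subcomplex L W = {\<sigma> \<in> L. \<sigma> \<subseteq> W}"

definition vertex_star :: "'v set set \<Rightarrow> 'v \<Rightarrow> 'v set set" where
  "vertex_star L v = {\<sigma> \<in> L. \<sigma> \<union> {v} \<in> L}"

definition star :: "'v set set \<Rightarrow> 'v set \<Rightarrow> 'v set set" where
  "star L V = (\<Union>v\<in>V. vertex_star L v)"

definition complex_isomorphic :: "'v set set \<Rightarrow> 'w set set \<Rightarrow> bool" where
  "complex_isomorphic K L \<longleftrightarrow>
     (\<exists>f. bij_betw f (\<Union>K) (\<Union>L) \<and> (\<forall>\<sigma>. \<sigma> \<subseteq> \<Union>K \<longrightarrow> (\<sigma> \<in> K \<longleftrightarrow> f ` \<sigma> \<in> L)))"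


subsection \<open>Cluster complexes\<close>

definition cluster_complex :: "nat \<Rightarrow> (nat \<Rightarrow> 'a::field_char_0) \<Rightarrow> int_matrix \<Rightarrow> 'a set set" where
  "cluster_complex n x B =
     {\<sigma>. \<exists>x' B'. (seed_step n)\<^sup>*\<^sup>* (x, B) (x', B') \<and> \<sigma> \<subseteq> cluster n x'}"

definition positive_cluster_complex ::
    "nat \<Rightarrow> (nat \<Rightarrow> 'a::field_char_0) \<Rightarrow> int_matrix \<Rightarrow> 'a set set" where
  "positive_cluster_complex n x B =
     full_subcomplex (cluster_complex n x B) (\<Union>(cluster_complex n x B) - cluster n x)"


subsection \<open>Cartan type\<close>

definition cartan_counterpart :: "int_matrix \<Rightarrow> int_matrix" where
  "cartan_counterpart B = (\<lambda>i j. if i = j then 2 else - \<bar>B i j\<bar>)"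

text \<open>
  Convention $a_{ij} = 2(\alpha_i,\alpha_j)/(\alpha_i,\alpha_i)$, with $\alpha_n$ the short
  simple root in type $B_n$ and the long one in type $C_n$.  The opposite convention
  exchanges the two matrices.
\<close>

definition cartan_matrix_B :: "nat \<Rightarrow> int_matrix" where
  "cartan_matrix_B n = (\<lambda>i j.
     if i = j then 2
     else if i = n \<and> j + 1 = n then -2
     else if i + 1 = j \<or> j + 1 = i then -1
     else 0)"

definition cartan_matrix_C :: "nat \<Rightarrow> int_matrix" where
  "cartan_matrix_C n = (\<lambda>i j.
     if i = j then 2
     else if i + 1 = n \<and> j = n then -2
     else if i + 1 = j \<or> j + 1 = i then -1
     else 0)"

definition of_cartan_type :: "nat \<Rightarrow> int_matrix \<Rightarrow> int_matrix \<Rightarrow> bool" where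
  "of_cartan_type n A B \<longleftrightarrow>
     (\<exists>B'. mutation_equivalent_relabel n B B' \<and>
        (\<forall>i\<in>{1..n}. \<forall>j\<in>{1..n}. cartan_counterpart B' i j = A i j))"

definition of_type_B :: "nat \<Rightarrow> int_matrix \<Rightarrow> bool" where
  "of_type_B n B \<longleftrightarrow> of_cartan_type n (cartan_matrix_B n) B"

definition of_type_C :: "nat \<Rightarrow> int_matrix \<Rightarrow> bool" where
  "of_type_C n B \<longleftrightarrow> of_cartan_type n (cartan_matrix_C n) B"


subsection \<open>Valued quivers\<close>

text \<open>\<open>(i, j, v)\<close> is an arrow from \<open>i\<close> to \<open>j\<close> with value \<open>v\<close>.\<close>

type_synonym valued_quiver = "(nat \<times> nat \<times> (int \<times> int)) set"

definition valued_quiver_of :: "nat \<Rightarrow> int_matrix \<Rightarrow> valued_quiver" where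
  "valued_quiver_of n B =
     {(i, j, (B i j, - B j i)) | i j. i \<in> {1..n} \<and> j \<in> {1..n} \<and> B i j > 0}"

text \<open>
  The linearly oriented quivers $1 \to \cdots \to n$ and $1 \leftarrow \cdots \leftarrow n$
  whose arrow between $n-1$ and $n$ has value \<open>v\<close>, all others having value $(1,1)$.
\<close>

definition linear_quiver_up :: "nat \<Rightarrow> int \<times> int \<Rightarrow> valued_quiver" where
  "linear_quiver_up n v = {(i, i + 1, (1, 1)) | i. 1 \<le> i \<and> i + 1 < n} \<union> {(n - 1, n, v)}"

definition linear_quiver_down :: "nat \<Rightarrow> int \<times> int \<Rightarrow> valued_quiver" where
  "linear_quiver_down n v = {(i + 1, i, (1, 1)) | i. 1 \<le> i \<and> i + 1 < n} \<union> {(n, n - 1, v)}"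

definition quiver_relabel_eq :: "nat \<Rightarrow> valued_quiver \<Rightarrow> valued_quiver \<Rightarrow> bool" where
  "quiver_relabel_eq n Q Q' \<longleftrightarrow>
     (\<exists>\<pi>. \<pi> permutes {1..n} \<and> (\<lambda>(i, j, v). (\<pi> i, \<pi> j, v)) ` Q = Q')"

end

theory Submission
  imports Defs
begin

text \<open>
  Put \<open>N = n + 1\<close>.  Cluster variables correspond to the arcs of a once-punctured \<open>N\<close>-gon and seeds
  to its triangulations; mutation is a flip, and the initial seed is the fan of all arcs starting at
  the vertex \<open>0\<close>.  The reflection \<open>i \<mapsto> 1 - i\<close> of the polygon carries this fan to another one, every arc of
  which crosses every arc of the initial fan.  A set of pairwise noncrossing arcs lies in the star
  of the initial fan exactly when it avoids the reflected fan, so the reflection maps the positive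
  complex onto the star.

  The arcs are realized in the field by a frieze: vectors \<open>w\<^sub>i\<close> in the plane with
  \<open>w\<^bsub>i+N\<^esub> = M w\<^sub>i\<close>, \<open>det M = 1\<close>, have determinants \<open>l p q = det (w\<^sub>p, w\<^sub>q)\<close> satisfying the Ptolemy
  relations.  The two types are the cases \<open>tr M = 0\<close> and \<open>tr M = 2\<close>; in the latter \<open>det (w, M w)\<close> is
  the square of a linear form, whose values are the variables of the loops around the puncture.
\<close>

section \<open>Specialization of rational functions\<close>

text \<open>The exchange of two loops dictates the traces. Let \<open>M\<close> have determinant 1
  and trace t, and put a = \<open>l p q\<close>, b = \<open>l q (p + N)\<close>. The Pluecker
  relation for \<open>w_p\<close>, \<open>w_q\<close>, \<open>M w_p\<close>, \<open>M w_q\<close>,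
  together with \<open>det (u, M w) = t * det (u, w) + det (w, M u)\<close>, gives
  \<open>l p (p + N) * l q (q + N) = a^2 + t * a * b + b^2\<close>. A cluster exchange needs a
  binomial: t = 0 leaves \<open>a^2 + b^2\<close>, while t = 2 gives \<open>(a + b)^2\<close>, which
  becomes \<open>a + b\<close> once square roots are taken.

  The complexes consist of field elements, so distinct arcs have to carry distinct elements. Closed
  formulas for all arcs are avoided: by algebraic independence the initial variables may be given
  rational values, and it suffices that some frieze of positive rationals separates the two arcs.
  Positivity keeps every divisor away from 0.

  The fan realizes only one orientation of the linear quiver. The other one belongs to
  \<open>- B\<close>, which has the same clusters.\<close>

definition monomial_eval :: "(nat \<Rightarrow> 'a::field_char_0) \<Rightarrow> (nat \<Rightarrow>\<^sub>0 nat) \<Rightarrow> 'a" where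
  "monomial_eval x m = (\<Prod>i\<in>Poly_Mapping.keys m. x i ^ Poly_Mapping.lookup m i)"

lemma monomial_eval_superset:
  "finite A \<Longrightarrow> Poly_Mapping.keys m \<subseteq> A \<Longrightarrow>
     monomial_eval x m = (\<Prod>i\<in>A. x i ^ Poly_Mapping.lookup m i)"
  unfolding monomial_eval_def by (intro prod.mono_neutral_left) (auto simp: in_keys_iff)

lemma monomial_eval_add: "monomial_eval x (a + b) = monomial_eval x a * monomial_eval x b"
proof -
  let ?A = "Poly_Mapping.keys a \<union> Poly_Mapping.keys b"
  have "monomial_eval x m = (\<Prod>i\<in>?A. x i ^ Poly_Mapping.lookup m i)"
    if "Poly_Mapping.keys m \<subseteq> ?A" for m
    using that by (intro monomial_eval_superset) auto
  from this[of a] this[of b] this[of "a + b"] show ?thesis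
    using Poly_Mapping.keys_add[of a b] by (simp add: lookup_add power_add prod.distrib)
qed

lemma mpoly_eval_superset:
  "finite A \<Longrightarrow> Poly_Mapping.keys p \<subseteq> A \<Longrightarrow>
     mpoly_eval x p = (\<Sum>m\<in>A. of_rat (Poly_Mapping.lookup p m) * monomial_eval x m)"
  unfolding mpoly_eval_def monomial_eval_def[symmetric]
  by (intro sum.mono_neutral_left) (auto simp: in_keys_iff)

lemma mpoly_eval_0 [simp]: "mpoly_eval x 0 = 0"
  by (simp add: mpoly_eval_def)

lemma mpoly_eval_1 [simp]: "mpoly_eval x 1 = 1"
  by (simp add: mpoly_eval_def lookup_one)

lemma mpoly_eval_add: "mpoly_eval x (p + q) = mpoly_eval x p + mpoly_eval x q"
proof -
  let ?A = "Poly_Mapping.keys p \<union> Poly_Mapping.keys q"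
  have "mpoly_eval x r = (\<Sum>m\<in>?A. of_rat (Poly_Mapping.lookup r m) * monomial_eval x m)"
    if "Poly_Mapping.keys r \<subseteq> ?A" for r
    using that by (intro mpoly_eval_superset) auto
  from this[of p] this[of q] this[of "p + q"] show ?thesis
    using Poly_Mapping.keys_add[of p q]
    by (simp add: lookup_add of_rat_add distrib_right sum.distrib)
qed

lemma mpoly_eval_single: "mpoly_eval x (Poly_Mapping.single m c) = of_rat c * monomial_eval x m"
  by (subst mpoly_eval_superset[of "{m}"]) (auto simp: lookup_single_eq)

lemma mpoly_eval_sum: "mpoly_eval x (sum f A) = (\<Sum>a\<in>A. mpoly_eval x (f a))"
  by (induction A rule: infinite_finite_induct) (auto simp: mpoly_eval_add)

lemma mpoly_eval_diff: "mpoly_eval x (p - q) = mpoly_eval x p - mpoly_eval x q"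
  using mpoly_eval_add[of x "p - q" q] by simp

lemma sum_single_lookup:
  "(\<Sum>m\<in>Poly_Mapping.keys p. Poly_Mapping.single m (Poly_Mapping.lookup p m)) = p"
  by (rule poly_mapping_eqI)
    (auto simp: lookup_sum lookup_single when_def in_keys_iff)

lemma mpoly_eval_mult: "mpoly_eval x (p * q) = mpoly_eval x p * mpoly_eval x q"
proof -
  let ?s = "\<lambda>p m. Poly_Mapping.single m (Poly_Mapping.lookup p m)"
  have "p * q = (\<Sum>a\<in>Poly_Mapping.keys p. \<Sum>b\<in>Poly_Mapping.keys q. ?s p a * ?s q b)"
    by (simp only: sum_product[symmetric] sum_single_lookup)
  also have "mpoly_eval x \<dots> = mpoly_eval x (\<Sum>a\<in>Poly_Mapping.keys p. ?s p a) *
      mpoly_eval x (\<Sum>b\<in>Poly_Mapping.keys q. ?s q b)"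
    by (simp add: mpoly_eval_sum mult_single mpoly_eval_single of_rat_mult monomial_eval_add
        sum_product mult_ac)
  finally show ?thesis by (simp only: sum_single_lookup)
qed

definition vars_in :: "nat \<Rightarrow> ((nat \<Rightarrow>\<^sub>0 nat) \<Rightarrow>\<^sub>0 rat) \<Rightarrow> bool" where
  "vars_in n p \<longleftrightarrow> (\<forall>m\<in>Poly_Mapping.keys p. Poly_Mapping.keys m \<subseteq> {1..n})"

lemma vars_in_add: "vars_in n p \<Longrightarrow> vars_in n q \<Longrightarrow> vars_in n (p + q)"
  unfolding vars_in_def using Poly_Mapping.keys_add[of p q] by blast

lemma vars_in_diff: "vars_in n p \<Longrightarrow> vars_in n q \<Longrightarrow> vars_in n (p - q)"
  unfolding vars_in_def using keys_diff[of p q] by blast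

lemma vars_in_mult: "vars_in n p \<Longrightarrow> vars_in n q \<Longrightarrow> vars_in n (p * q)"
  unfolding vars_in_def
proof
  fix m assume h: "\<forall>m\<in>Poly_Mapping.keys p. Poly_Mapping.keys m \<subseteq> {1..n}"
    "\<forall>m\<in>Poly_Mapping.keys q. Poly_Mapping.keys m \<subseteq> {1..n}" "m \<in> Poly_Mapping.keys (p * q)"
  then obtain a b where "m = a + b" "a \<in> Poly_Mapping.keys p" "b \<in> Poly_Mapping.keys q"
    using keys_mult[of p q] by blast
  thus "Poly_Mapping.keys m \<subseteq> {1..n}" using Poly_Mapping.keys_add[of a b] h by blast
qed

lemma vars_in_1: "vars_in n 1"
  by (auto simp: vars_in_def)

text \<open>\<open>specializes n x c z r\<close>: the rational function \<open>z\<close> of \<open>x\<close> is defined at the point \<open>c\<close>,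
  with value \<open>r\<close>.\<close>

definition specializes ::
    "nat \<Rightarrow> (nat \<Rightarrow> 'a::field_char_0) \<Rightarrow> (nat \<Rightarrow> rat) \<Rightarrow> 'a \<Rightarrow> rat \<Rightarrow> bool" where
  "specializes n x c z r \<longleftrightarrow> (\<exists>P Q. vars_in n P \<and> vars_in n Q \<and> mpoly_eval c Q \<noteq> 0 \<and>
     z = mpoly_eval x P / mpoly_eval x Q \<and> r = mpoly_eval c P / mpoly_eval c Q)"

context
  fixes n :: nat and x :: "nat \<Rightarrow> 'a::field_char_0" and c :: "nat \<Rightarrow> rat"
  assumes indep: "algebraically_independent n x"
begin

text \<open>By independence a polynomial relation of \<open>x\<close> is the zero polynomial and
  holds at every point. Hence a denominator that is nonzero at \<open>c\<close> is nonzero at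
  \<open>x\<close> as well.\<close>

lemma mpoly_eval_eq_0D: "vars_in n P \<Longrightarrow> mpoly_eval x P = 0 \<Longrightarrow> mpoly_eval c P = 0"
  using indep unfolding algebraically_independent_def vars_in_def
  by (metis mpoly_eval_0)

lemma specializesE:
  assumes "specializes n x c z r"
  obtains P Q where "vars_in n P" "vars_in n Q" "mpoly_eval c Q \<noteq> 0" "mpoly_eval x Q \<noteq> 0"
    "z * mpoly_eval x Q = mpoly_eval x P" "r * mpoly_eval c Q = mpoly_eval c P"
  using assms mpoly_eval_eq_0D that unfolding specializes_def by (metis nonzero_eq_divide_eq)

lemma specializesI:
  assumes "vars_in n P" "vars_in n Q" "mpoly_eval c Q \<noteq> 0"
    "z * mpoly_eval x Q = mpoly_eval x P" "r * mpoly_eval c Q = mpoly_eval c P"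
  shows "specializes n x c z r"
  using assms mpoly_eval_eq_0D unfolding specializes_def by (metis nonzero_eq_divide_eq)

lemma specializes_nonzero:
  assumes "specializes n x c z r" "r \<noteq> 0"
  shows "z \<noteq> 0"
  using specializesE[OF assms(1)] mpoly_eval_eq_0D assms(2) by (metis mult_eq_0_iff)

text \<open>Cross-multiplying two representations of \<open>z\<close> yields a polynomial that
  vanishes at \<open>x\<close>. It then vanishes at \<open>c\<close>, which equates the two
  values.\<close>

lemma specializes_unique:
  assumes "specializes n x c z r" "specializes n x c z r'"
  shows "r = r'"
proof -
  obtain P Q where 1: "vars_in n P" "vars_in n Q" "mpoly_eval c Q \<noteq> 0" "mpoly_eval x Q \<noteq> 0"
    "z * mpoly_eval x Q = mpoly_eval x P" "r * mpoly_eval c Q = mpoly_eval c P"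
    by (rule specializesE[OF assms(1)])
  obtain P' Q' where 2: "vars_in n P'" "vars_in n Q'" "mpoly_eval c Q' \<noteq> 0" "mpoly_eval x Q' \<noteq> 0"
    "z * mpoly_eval x Q' = mpoly_eval x P'" "r' * mpoly_eval c Q' = mpoly_eval c P'"
    by (rule specializesE[OF assms(2)])
  let ?D = "P * Q' - P' * Q"
  have "mpoly_eval x ?D = 0"
    by (simp add: mpoly_eval_diff mpoly_eval_mult 1(5)[symmetric] 2(5)[symmetric])
  moreover have "vars_in n ?D" using 1 2 by (intro vars_in_diff vars_in_mult)
  ultimately have "mpoly_eval c ?D = 0" by (rule mpoly_eval_eq_0D[rotated])
  hence "(r - r') * (mpoly_eval c Q * mpoly_eval c Q') = 0"
    by (simp add: mpoly_eval_diff mpoly_eval_mult 1(6)[symmetric] 2(6)[symmetric]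
        algebra_simps)
  thus ?thesis using 1(3) 2(3) by simp
qed

lemma specializes_1: "specializes n x c 1 1"
  by (rule specializesI[of 1 1]) (auto simp: vars_in_1)

lemma specializes_var:
  assumes "i \<in> {1..n}"
  shows "specializes n x c (x i) (c i)"
proof (rule specializesI)
  let ?P = "Poly_Mapping.single (Poly_Mapping.single i 1) 1"
  show "vars_in n ?P" using assms by (auto simp: vars_in_def)
  show "x i * mpoly_eval x 1 = mpoly_eval x ?P" "c i * mpoly_eval c 1 = mpoly_eval c ?P"
    by (simp_all add: mpoly_eval_single monomial_eval_def)
qed (auto simp: vars_in_1)

context
  fixes z w :: 'a and r s :: rat
  assumes zr: "specializes n x c z r" and ws: "specializes n x c w s"
begin

lemma specializes_arith:
  shows specializes_add: "specializes n x c (z + w) (r + s)"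
    and specializes_mult: "specializes n x c (z * w) (r * s)"
    and specializes_divide: "s \<noteq> 0 \<Longrightarrow> specializes n x c (z / w) (r / s)"
proof -
  obtain P Q where 1: "vars_in n P" "vars_in n Q" "mpoly_eval c Q \<noteq> 0" "mpoly_eval x Q \<noteq> 0"
    "z * mpoly_eval x Q = mpoly_eval x P" "r * mpoly_eval c Q = mpoly_eval c P"
    by (rule specializesE[OF zr])
  obtain P' Q' where 2: "vars_in n P'" "vars_in n Q'" "mpoly_eval c Q' \<noteq> 0" "mpoly_eval x Q' \<noteq> 0"
    "w * mpoly_eval x Q' = mpoly_eval x P'" "s * mpoly_eval c Q' = mpoly_eval c P'"
    by (rule specializesE[OF ws])
  note [simp] = mpoly_eval_add mpoly_eval_mult 1(3,4) 2(3,4)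
    1(5,6)[symmetric] 2(5,6)[symmetric]
  show "specializes n x c (z + w) (r + s)"
    by (rule specializesI[of "P * Q' + P' * Q" "Q * Q'"])
      (use 1 2 in \<open>auto intro!: vars_in_add vars_in_mult simp: algebra_simps\<close>)
  show "specializes n x c (z * w) (r * s)"
    by (rule specializesI[of "P * P'" "Q * Q'"])
      (use 1 2 in \<open>auto intro!: vars_in_mult simp: algebra_simps\<close>)
  \<comment> \<open>Division moves the numerator \<open>P'\<close> of \<open>w\<close> into the
    denominator; its value at \<open>c\<close> is nonzero because \<open>s\<close> is.\<close>
  show "specializes n x c (z / w) (r / s)" if "s \<noteq> 0"
    using specializes_nonzero[OF ws that] that
    by (intro specializesI[of "P * Q'" "P' * Q"])
      (use 1 2 in \<open>auto intro!: vars_in_mult simp: field_simps\<close>)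
qed

end

end

section \<open>Triangulations of a once-punctured polygon\<close>

locale punctured_polygon =
  fixes N :: int
  assumes N_ge_2: "N \<ge> 2"
begin

text \<open>
  An arc is a pair \<open>p < q \<le> p + N\<close> of integers up to simultaneous translation by \<open>N\<close>, that is, an arc of
  the universal cover of the punctured polygon; \<open>q = p + N\<close> is the loop around the puncture.
  \<open>canon\<close> selects the representative with \<open>0 \<le> p < N\<close>, and \<open>edge\<close> also counts the boundary sides
  \<open>(p, p + 1)\<close>, which cross nothing.
\<close>

definition canon :: "int \<Rightarrow> int \<Rightarrow> int \<times> int" where
  "canon p q = (p mod N, p mod N + (q - p))"

definition arcs :: "(int \<times> int) set" where
  "arcs = {(p, q). 0 \<le> p \<and> p < N \<and> p + 2 \<le> q \<and> q \<le> p + N}"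

definition edge :: "(int \<times> int) set \<Rightarrow> int \<Rightarrow> int \<Rightarrow> bool" where
  "edge T p q \<longleftrightarrow> q = p + 1 \<or> canon p q \<in> T"

text \<open>Since \<open>edge\<close> runs through all lifts, a single order pattern is enough: the
  other one arises by exchanging the two edges. Loops with different base points always
  cross.\<close>

definition noncrossing :: "(int \<times> int) set \<Rightarrow> bool" where
  "noncrossing T \<longleftrightarrow>
     (\<forall>p q r s. edge T p q \<longrightarrow> edge T r s \<longrightarrow> \<not> (p < r \<and> r < q \<and> q < s))"

definition triangulation :: "(int \<times> int) set \<Rightarrow> bool" where
  "triangulation T \<longleftrightarrow> T \<subseteq> arcs \<and> noncrossing T \<and>
     (\<forall>\<alpha>\<in>arcs. noncrossing (insert \<alpha> T) \<longrightarrow> \<alpha> \<in> T)"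

lemma canon_eq_iff: "canon p q = canon r s \<longleftrightarrow> (\<exists>m. p = r + m * N \<and> q = s + m * N)"
proof
  assume "canon p q = canon r s"
  hence "p mod N = r mod N" "q - p = s - r" by (auto simp: canon_def)
  moreover from this(1) have "N dvd p - r" by (simp add: mod_eq_dvd_iff)
  then obtain m where "p - r = N * m" by (elim dvdE)
  ultimately show "\<exists>m. p = r + m * N \<and> q = s + m * N"
    by (intro exI[of _ m]) (auto simp: algebra_simps)
qed (auto simp: canon_def)

lemma canon_shift [simp]: "canon (p + m * N) (q + m * N) = canon p q"
  by (auto simp: canon_eq_iff)

lemma canon_shift1 [simp]: "canon (p + N) (q + N) = canon p q" "canon (p - N) (q - N) = canon p q"
  using canon_shift[of p 1 q] canon_shift[of p "-1" q] by simp_all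

lemma canon_arcs: "(p, q) \<in> arcs \<Longrightarrow> canon p q = (p, q)"
  by (auto simp: canon_def arcs_def)

lemma canon_in_arcs_iff: "canon p q \<in> arcs \<longleftrightarrow> p + 2 \<le> q \<and> q \<le> p + N"
  using N_ge_2 by (auto simp: canon_def arcs_def)

lemma canon_self: "0 \<le> p \<Longrightarrow> p < N \<Longrightarrow> canon p q = (p, q)"
  by (simp add: canon_def)

lemma canon_neq_start: "p < r \<Longrightarrow> r < p + N \<Longrightarrow> canon p q \<noteq> canon r s"
  "p < r \<Longrightarrow> r < p + N \<Longrightarrow> canon r s \<noteq> canon p q"
proof -
  have "\<not> (\<exists>m. p = r + m * N \<and> q = s + m * N)" if "p < r" "r < p + N"
  proof
    assume "\<exists>m. p = r + m * N \<and> q = s + m * N"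
    then obtain m where m: "p = r + m * N" by blast
    have "m < 0" using m that(1) N_ge_2 by (smt (verit) mult_nonneg_nonneg)
    hence "m * N \<le> - 1 * N" using N_ge_2 by (intro mult_right_mono) auto
    thus False using m that by simp
  qed
  thus "p < r \<Longrightarrow> r < p + N \<Longrightarrow> canon p q \<noteq> canon r s"
    "p < r \<Longrightarrow> r < p + N \<Longrightarrow> canon r s \<noteq> canon p q"
    by (metis canon_eq_iff)+
qed

lemma canon_same_start: "canon p q = canon p s \<longleftrightarrow> q = s"
  by (auto simp: canon_def)

lemma canon_length: "canon p q = canon r s \<Longrightarrow> q - p = s - r"
  by (auto simp: canon_def)

lemma edge_shift [simp]: "edge T (p + m * N) (q + m * N) \<longleftrightarrow> edge T p q"
  by (auto simp: edge_def)

lemma edge_shift1 [simp]: "edge T (p + N) (q + N) \<longleftrightarrow> edge T p q"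
  "edge T (p - N) (q - N) \<longleftrightarrow> edge T p q"
  by (auto simp: edge_def)

lemma edge_boundary [simp]: "edge T p (p + 1)"
  by (simp add: edge_def)

lemma edge_bounds: "T \<subseteq> arcs \<Longrightarrow> edge T p q \<Longrightarrow> p < q \<and> q \<le> p + N"
  using N_ge_2 canon_in_arcs_iff[of p q] by (auto simp: edge_def)

lemma edge_mono: "S \<subseteq> T \<Longrightarrow> edge S p q \<Longrightarrow> edge T p q"
  by (auto simp: edge_def)

lemma edge_insert: "edge (insert \<alpha> T) p q \<longleftrightarrow> edge T p q \<or> canon p q = \<alpha>"
  by (auto simp: edge_def)

lemma noncrossing_mono: "S \<subseteq> T \<Longrightarrow> noncrossing T \<Longrightarrow> noncrossing S"
  unfolding noncrossing_def using edge_mono by blast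

lemma noncrossingD: "noncrossing T \<Longrightarrow> edge T p q \<Longrightarrow> edge T r s \<Longrightarrow> \<not> (p < r \<and> r < q \<and> q < s)"
  by (auto simp: noncrossing_def)

text \<open>Edges are invariant under translation, so one lift of the new arc represents all. Two
  lifts of the new arc itself start at least \<open>N\<close> apart and cannot cross, because
  \<open>q \<le> p + N\<close>.\<close>

lemma noncrossing_insert:
  assumes "noncrossing T" "q \<le> p + N"
    "\<And>u v. edge T u v \<Longrightarrow> \<not> (u < p \<and> p < v \<and> v < q) \<and> \<not> (p < u \<and> u < q \<and> q < v)"
  shows "noncrossing (insert (canon p q) T)"
  unfolding noncrossing_def
proof (intro allI impI notI)
  fix a b c d
  assume e: "edge (insert (canon p q) T) a b" "edge (insert (canon p q) T) c d"
    and cr: "a < c \<and> c < b \<and> b < d"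
  have dvd: "\<not> (0 < c - a \<and> c - a < N)" if "\<exists>k. c - a = k * N"
    using that N_ge_2 by (metis dvd_triv_right zdvd_not_zless)
  consider "edge T a b" "edge T c d" | m where "edge T a b" "c = p + m * N" "d = q + m * N"
    | m where "edge T c d" "a = p + m * N" "b = q + m * N"
    | m l where "a = p + m * N" "b = q + m * N" "c = p + l * N" "d = q + l * N"
    using e unfolding edge_insert canon_eq_iff by blast
  thus False
  proof cases
    case 1
    thus ?thesis using noncrossingD[OF assms(1) 1] cr by blast
  next
    case (2 m)
    have "edge T (a + (-m) * N) (b + (-m) * N)" using 2(1) unfolding edge_shift .
    from assms(3)[OF this] show ?thesis using 2 cr by auto
  next
    case (3 m)
    have "edge T (c + (-m) * N) (d + (-m) * N)" using 3(1) unfolding edge_shift .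
    from assms(3)[OF this] show ?thesis using 3 cr by auto
  next
    case (4 m l)
    hence "c - a = (l - m) * N" by (simp add: algebra_simps)
    with dvd have "\<not> (0 < c - a \<and> c - a < N)" by blast
    moreover have "b - a = q - p" using 4 by simp
    ultimately show ?thesis using cr assms(2) by linarith
  qed
qed

lemma noncrossing_insertD:
  assumes "noncrossing (insert (canon p q) T)" "edge T u v"
  shows "\<not> (u < p \<and> p < v \<and> v < q) \<and> \<not> (p < u \<and> u < q \<and> q < v)"
  using noncrossingD[OF assms(1), of u v p q] noncrossingD[OF assms(1), of p q u v] assms(2)
  by (auto simp: edge_insert)

lemma finite_arcs: "finite arcs"
  by (rule finite_subset[of _ "{0..N} \<times> {0..2*N}"]) (auto simp: arcs_def)

lemma noncrossing_extend:
  assumes "S \<subseteq> arcs" "noncrossing S"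
  obtains T where "triangulation T" "S \<subseteq> T"
proof -
  let ?P = "\<lambda>T. S \<subseteq> T \<and> T \<subseteq> arcs \<and> noncrossing T"
  have "finite {T. ?P T}" by (rule finite_subset[of _ "Pow arcs"]) (auto simp: finite_arcs)
  moreover have "{T. ?P T} \<noteq> {}" using assms by auto
  ultimately obtain T where T: "?P T" "\<And>T'. ?P T' \<Longrightarrow> T \<subseteq> T' \<Longrightarrow> T = T'"
    using finite_has_maximal[of "{T. ?P T}"] by auto
  have "triangulation T" unfolding triangulation_def
  proof (intro conjI ballI impI)
    fix \<alpha> assume "\<alpha> \<in> arcs" "noncrossing (insert \<alpha> T)"
    thus "\<alpha> \<in> T" using T(2)[of "insert \<alpha> T"] T(1) by auto
  qed (use T in auto)
  thus thesis using that T(1) by blast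
qed

section \<open>Triangles on both sides of an arc, and the loop of a triangulation\<close>

context
  fixes T assumes tri: "triangulation T"
begin

lemma tri_arcs: "T \<subseteq> arcs" and tri_nc: "noncrossing T"
  using tri by (auto simp: triangulation_def)

lemma tri_edgeI:
  assumes "p < q" "q \<le> p + N"
    "\<And>u v. edge T u v \<Longrightarrow> \<not> (u < p \<and> p < v \<and> v < q) \<and> \<not> (p < u \<and> u < q \<and> q < v)"
  shows "edge T p q"
proof (cases "q = p + 1")
  case False
  hence "canon p q \<in> arcs" using assms by (simp add: canon_in_arcs_iff)
  moreover have "noncrossing (insert (canon p q) T)"
    using noncrossing_insert[OF tri_nc assms(2,3)] by blast
  ultimately show ?thesis using tri by (auto simp: triangulation_def edge_def)
qed simp

lemmas tri_cross = noncrossingD[OF tri_nc]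

text \<open>The triangle on the side away from the puncture. Its apex is the farthest
  \<open>q\<close> below \<open>r\<close> joined to \<open>p\<close>: an edge crossing
  \<open>(q, r)\<close> would cross \<open>(p, r)\<close> or \<open>(p, q)\<close>, or start at
  \<open>p\<close> and contradict the choice of \<open>q\<close>.\<close>

lemma inner_apex:
  assumes "edge T p r" "p + 2 \<le> r"
  obtains q where "p < q" "q < r" "edge T p q" "edge T q r"
proof -
  let ?Q = "{q. p < q \<and> q < r \<and> edge T p q}"
  have "finite ?Q" by (rule finite_subset[of _ "{p..r}"]) auto
  moreover have "p + 1 \<in> ?Q" using assms by auto
  ultimately have m: "Max ?Q \<in> ?Q" "\<And>q. q \<in> ?Q \<Longrightarrow> q \<le> Max ?Q"
    using Max_in[of ?Q] Max_ge[of ?Q] by blast+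
  define q where "q = Max ?Q"
  have q: "p < q" "q < r" "edge T p q" "\<And>q'. p < q' \<Longrightarrow> q' < r \<Longrightarrow> edge T p q' \<Longrightarrow> q' \<le> q"
    using m by (auto simp: q_def)
  have "edge T q r"
  proof (rule tri_edgeI)
    fix u v assume uv: "edge T u v"
    show "\<not> (u < q \<and> q < v \<and> v < r) \<and> \<not> (q < u \<and> u < r \<and> r < v)"
      using tri_cross[OF uv assms(1)] tri_cross[OF assms(1) uv] tri_cross[OF q(3) uv]
        q(4)[of v] q(1,2) uv by (cases "u = p") auto
  qed (use q edge_bounds[OF tri_arcs assms(1)] in auto)
  with q that show ?thesis by blast
qed

text \<open>If no edge passes over \<open>u\<close>, the loop at \<open>u\<close> crosses nothing
  and is present by maximality. Otherwise every point has an edge passing over it, and an edge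
  passing over the end of \<open>(a, b)\<close> must start at or before \<open>a\<close>; so edges
  could be lengthened without bound, against the limit \<open>N\<close>.\<close>

lemma ex_diameter: obtains d where "edge T d (d + N)"
proof (rule ccontr)
  assume "\<not> thesis"
  hence nd: "\<not> edge T d (d + N)" for d using that by blast
  have cover: "\<exists>a b. edge T a b \<and> a < u \<and> u < b" for u
  proof (rule ccontr)
    assume no: "\<not> ?thesis"
    have "edge T u (u + N)"
    proof (rule tri_edgeI)
      fix a b assume ab: "edge T a b"
      hence "edge T (a - N) (b - N)" by simp
      with no ab show "\<not> (a < u \<and> u < b \<and> b < u + N) \<and> \<not> (u < a \<and> a < u + N \<and> u + N < b)"
        by (metis diff_less_eq less_diff_eq)
    qed (use N_ge_2 in auto)
    thus False using nd by blast
  qed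
  have ex: "\<exists>a b. edge T a b \<and> int k < b - a" for k
  proof (induction k)
    case 0
    thus ?case by (intro exI[of _ 0] exI[of _ 1]) (auto simp: edge_def)
  next
    case (Suc k)
    then obtain a b where ab: "edge T a b" "int k < b - a" by blast
    obtain c d where cd: "edge T c d" "c < b" "b < d" using cover by blast
    have "c \<le> a" using tri_cross[OF ab(1) cd(1)] cd by linarith
    thus ?case using ab cd by (intro exI[of _ c] exI[of _ d]) auto
  qed
  from ex[of "nat N"] N_ge_2 edge_bounds[OF tri_arcs] show False by force
qed

text \<open>The triangle on the side of the puncture. Among the edges that properly contain
  \<open>(p, r)\<close>, take a shortest one. Its inner apex cannot lie strictly between
  \<open>p\<close> and \<open>r\<close>, so one of its two lower sides contains
  \<open>(p, r)\<close>, and by minimality equals it. A loop guarantees that such edges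
  exist.\<close>

lemma outer_apex:
  assumes "edge T p r" "r < p + N"
  obtains s where "r < s" "edge T p s" "edge T r s" | s where "s < p" "edge T s r" "edge T s p"
proof -
  obtain d where d: "edge T d (d + N)" using ex_diameter .
  \<comment> \<open>The last lift of the base point that is at most \<open>p\<close>; the lifted
    loop then contains \<open>(p, r)\<close>.\<close>
  define d' where "d' = d + (p - d) div N * N"
  have d': "edge T d' (d' + N)"
    using edge_shift[of T d "(p - d) div N" "d + N"] d by (simp add: d'_def algebra_simps)
  have "d' = p - (p - d) mod N" by (simp add: d'_def minus_mult_div_eq_mod[symmetric] algebra_simps)
  hence bd: "d' \<le> p" "p < d' + N" using N_ge_2 by (auto simp: pos_mod_bound pos_mod_sign)
  have pr: "p < r" using edge_bounds[OF tri_arcs assms(1)] by simp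
  have "r \<le> d' + N" using tri_cross[OF d' assms(1)] bd assms(2) by (cases "d' = p") auto
  hence ex: "\<exists>l. \<exists>u v. edge T u v \<and> u \<le> p \<and> r \<le> v \<and> (u,v) \<noteq> (p,r) \<and> v - u = int l"
    using d' bd assms(2) N_ge_2
    by (intro exI[of _ "nat N"] exI[of _ d'] exI[of _ "d' + N"]) auto
  define L where "L = (LEAST l. \<exists>u v. edge T u v \<and> u \<le> p \<and> r \<le> v \<and> (u,v) \<noteq> (p,r) \<and> v - u = int l)"
  from LeastI_ex[OF ex] obtain u v where uv: "edge T u v" "u \<le> p" "r \<le> v" "(u,v) \<noteq> (p,r)" "v - u = int L"
    unfolding L_def by blast
  have min: "v - u \<le> b - a" if "edge T a b" "a \<le> p" "r \<le> b" "(a,b) \<noteq> (p,r)" for a b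
  proof -
    have "L \<le> nat (b - a)" unfolding L_def by (rule Least_le) (use that pr in auto)
    thus ?thesis using uv(5) that pr by linarith
  qed
  have "u + 2 \<le> v" using uv pr by auto
  then obtain w where w: "u < w" "w < v" "edge T u w" "edge T w v"
    using inner_apex[OF uv(1)] by metis
  have "w \<le> p \<or> r \<le> w"
    using tri_cross[OF w(3) assms(1)] tri_cross[OF assms(1) w(4)] uv(2-4) by auto
  thus thesis
  proof
    assume "w \<le> p"
    hence "(w,v) = (p,r)" using min[OF w(4)] uv w by force
    thus thesis using that(2)[of u] uv w by auto
  next
    assume "r \<le> w"
    hence "(u,w) = (p,r)" using min[OF w(3)] uv w by force
    thus thesis using that(1)[of v] uv w by auto
  qed
qed

end

end

section \<open>Flips\<close>

definition crosses :: "int \<Rightarrow> int \<Rightarrow> int \<Rightarrow> int \<Rightarrow> bool" where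
  "crosses u v a b \<longleftrightarrow> u < a \<and> a < v \<and> v < b \<or> a < u \<and> u < b \<and> b < v"

lemma crosses_sym: "crosses u v a b \<longleftrightarrow> crosses a b u v"
  by (auto simp: crosses_def)

lemma crosses_shift [simp]: "crosses (u + m) (v + m) (a + m) (b + m) \<longleftrightarrow> crosses u v a b"
  by (auto simp: crosses_def)

lemma crosses_quadrilateral:
  assumes "p < q" "q < r" "r < s"
    "\<not> crosses u v p q" "\<not> crosses u v q r" "\<not> crosses u v r s" "\<not> crosses u v p s"
  shows "crosses u v p r \<Longrightarrow> u = q \<and> v = s" "crosses u v q s \<Longrightarrow> u = p \<and> v = r"
  using assms unfolding crosses_def by smt+

context punctured_polygon
begin

definition quad :: "(int \<times> int) set \<Rightarrow> int \<Rightarrow> int \<Rightarrow> int \<Rightarrow> int \<Rightarrow> bool" where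
  "quad S p q r s \<longleftrightarrow> p < q \<and> q < r \<and> r < s \<and> s \<le> p + N \<and>
     edge S p q \<and> edge S q r \<and> edge S r s \<and> edge S p s"

text \<open>The region around the puncture that is left when a loop is removed. It has two corners,
  \<open>p\<close> and \<open>q\<close>, and can be filled by the loop at either of them.\<close>

definition digon :: "(int \<times> int) set \<Rightarrow> int \<Rightarrow> int \<Rightarrow> bool" where
  "digon S p q \<longleftrightarrow> p < q \<and> q < p + N \<and> edge S p q \<and> edge S q (p + N)"

definition flip :: "(int \<times> int) set \<Rightarrow> int \<times> int \<Rightarrow> int \<times> int \<Rightarrow> bool" where
  "flip S \<alpha> \<alpha>' \<longleftrightarrow>
     (\<exists>p q r s. quad S p q r s \<and>
        (\<alpha> = canon p r \<and> \<alpha>' = canon q s \<or> \<alpha> = canon q s \<and> \<alpha>' = canon p r)) \<or>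
     (\<exists>p q. digon S p q \<and> \<alpha> = canon p (p + N) \<and> \<alpha>' = canon q (q + N))"

lemma digon_rotate: "digon S p q \<Longrightarrow> digon S q (p + N)"
  by (auto simp: digon_def)

lemma flip_sym: "flip S \<alpha> \<alpha>' \<Longrightarrow> flip S \<alpha>' \<alpha>"
proof -
  have "\<exists>p' q'. digon S p' q' \<and> \<alpha>' = canon p' (p' + N) \<and> \<alpha> = canon q' (q' + N)"
    if "digon S p q" "\<alpha> = canon p (p + N)" "\<alpha>' = canon q (q + N)" for p q
    using that digon_rotate[OF that(1)] canon_shift1(1)[of p "p + N", symmetric] by blast
  thus "flip S \<alpha> \<alpha>' \<Longrightarrow> flip S \<alpha>' \<alpha>"
    unfolding flip_def by (elim disjE; blast)
qed

lemma edge_not_crosses: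
  "noncrossing T \<Longrightarrow> edge T u v \<Longrightarrow> edge T a b \<Longrightarrow> \<not> crosses u v a b"
  using noncrossingD[of T u v a b] noncrossingD[of T a b u v] by (auto simp: crosses_def)

lemma noncrossing_insertI:
  assumes "noncrossing T" "q \<le> p + N" "\<And>u v. edge T u v \<Longrightarrow> \<not> crosses u v p q"
  shows "noncrossing (insert (canon p q) T)"
  using noncrossing_insert[OF assms(1,2)] assms(3) by (auto simp: crosses_def)

lemma noncrossing_insertE:
  assumes "noncrossing (insert (canon p q) T)" "edge T u v"
  shows "\<not> crosses u v p q"
  using noncrossing_insertD[OF assms] by (auto simp: crosses_def)

lemma noncrossing_insert2_iff:
  assumes "noncrossing (insert (canon a b) S)" "noncrossing (insert (canon c d) S)" "d \<le> c + N"
  shows "noncrossing (insert (canon c d) (insert (canon a b) S)) \<longleftrightarrow>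
    (\<forall>m. \<not> crosses (c + m * N) (d + m * N) a b)"
proof
  assume nc: "noncrossing (insert (canon c d) (insert (canon a b) S))"
  show "\<forall>m. \<not> crosses (c + m * N) (d + m * N) a b"
    using edge_not_crosses[OF nc] by (auto simp: edge_insert)
next
  assume h: "\<forall>m. \<not> crosses (c + m * N) (d + m * N) a b"
  show "noncrossing (insert (canon c d) (insert (canon a b) S))"
  proof (rule noncrossing_insertI[OF assms(1,3)])
    fix u v assume "edge (insert (canon a b) S) u v"
    then consider "edge S u v" | m where "u = a + m * N" "v = b + m * N"
      unfolding edge_insert canon_eq_iff by blast
    thus "\<not> crosses u v c d"
    proof cases
      case 1
      thus ?thesis using noncrossing_insertE[OF assms(2)] by blast
    next
      case (2 m)
      have "crosses u v c d \<longleftrightarrow> crosses (c + (-m) * N) (d + (-m) * N) a b"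
        using crosses_shift[of c "- m * N" d u v] unfolding 2 by (simp add: crosses_sym)
      thus ?thesis using h by blast
    qed
  qed
qed

text \<open>Among the arcs compatible with \<open>S\<close>, only \<open>(a, b)\<close> crosses
  \<open>(c, d)\<close> and conversely. Thus an arc compatible with the new set is either compatible
  with \<open>(a, b)\<close>, hence in the old maximal set, or crosses \<open>(a, b)\<close> and is
  therefore \<open>(c, d)\<close>.\<close>

lemma exchange:
  assumes tri: "triangulation (insert (canon a b) S)"
    and S: "S \<subseteq> arcs" and cd: "c + 2 \<le> d" "d \<le> c + N"
    and cr: "crosses a b c d"
    and h1: "\<And>u v. v \<le> u + N \<Longrightarrow> (\<And>x y. edge S x y \<Longrightarrow> \<not> crosses u v x y) \<Longrightarrow>
               crosses u v c d \<Longrightarrow> canon u v = canon a b"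
    and h2: "\<And>u v. v \<le> u + N \<Longrightarrow> (\<And>x y. edge S x y \<Longrightarrow> \<not> crosses u v x y) \<Longrightarrow>
               crosses u v a b \<Longrightarrow> canon u v = canon c d"
    and nS: "canon a b \<notin> S"
  shows "triangulation (insert (canon c d) S)"
proof -
  have nc: "noncrossing (insert (canon a b) S)" using tri by (auto simp: triangulation_def)
  have ncS: "noncrossing S" using noncrossing_mono[OF _ nc] by auto
  have ab: "a + 2 \<le> b" "b \<le> a + N" using tri by (auto simp: triangulation_def canon_in_arcs_iff)
  have nc': "noncrossing (insert (canon c d) S)"
  proof (rule noncrossing_insertI[OF ncS cd(2)])
    fix u v assume uv: "edge S u v"
    show "\<not> crosses u v c d"
    proof
      assume "crosses u v c d"
      hence "canon u v = canon a b"
        using h1[of v u] edge_not_crosses[OF ncS uv] edge_bounds[OF S uv] by auto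
      with nS uv ab canon_length[of u v a b] show False by (auto simp: edge_def)
    qed
  qed
  show ?thesis unfolding triangulation_def
  proof (intro conjI ballI impI nc')
    show "insert (canon c d) S \<subseteq> arcs" using S cd by (auto simp: canon_in_arcs_iff)
  next
    fix \<beta> assume \<beta>: "\<beta> \<in> arcs" and n: "noncrossing (insert \<beta> (insert (canon c d) S))"
    obtain u v where uv: "\<beta> = canon u v" "v \<le> u + N"
      using \<beta> canon_arcs[of "fst \<beta>" "snd \<beta>"] that[of "fst \<beta>" "snd \<beta>"] by (auto simp: arcs_def)
    have nb: "noncrossing (insert \<beta> S)" using noncrossing_mono[OF _ n] by blast
    show "\<beta> \<in> insert (canon c d) S"
    proof (cases "noncrossing (insert \<beta> (insert (canon a b) S))")
      case True
      hence "\<beta> \<in> insert (canon a b) S" using tri \<beta> by (auto simp: triangulation_def)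
      moreover have "\<beta> \<noteq> canon a b"
      proof
        assume "\<beta> = canon a b"
        hence "edge (insert \<beta> (insert (canon c d) S)) a b" "edge (insert \<beta> (insert (canon c d) S)) c d"
          by (auto simp: edge_def)
        thus False using edge_not_crosses[OF n] cr by blast
      qed
      ultimately show ?thesis by auto
    next
      case False
      then obtain m where m: "crosses (u + m * N) (v + m * N) a b"
        using noncrossing_insert2_iff[OF nc, of u v] nb uv by auto
      have "\<not> crosses (u + m * N) (v + m * N) x y" if "edge S x y" for x y
        using noncrossing_insertE[of "u + m * N" "v + m * N" S, OF _ that] nb uv(1)
        by (auto simp: crosses_sym)
      hence "canon (u + m * N) (v + m * N) = canon c d"
        using h2[of "v + m * N" "u + m * N"] m uv(2) by auto
      thus ?thesis using uv by simp
    qed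
  qed
qed

text \<open>The digon surrounds the puncture, so in the universal cover it continues into its
  translates. This is why adjacent lifts of its sides must be avoided too, and why two lifts of the
  loop at \<open>q\<close> cross the given loop.\<close>

lemma crosses_digon:
  assumes "p < q" "q < p + N" "v \<le> u + N" "crosses u v p (p + N)"
    "\<not> crosses u v p q" "\<not> crosses u v q (p + N)"
    "\<not> crosses u v (p + N) (q + N)" "\<not> crosses u v (q - N) p"
  shows "canon u v = canon q (q + N)"
proof -
  have "u = q \<and> v = q + N \<or> u = q - N \<and> v = q"
    using assms unfolding crosses_def by smt
  thus ?thesis using canon_shift1(2)[of q "q + N"] by auto
qed

lemma digon_edges:
  assumes "digon S p q"
  shows "edge S p q" "edge S q (p + N)" "edge S (p + N) (q + N)" "edge S (q - N) p"
  using assms edge_shift1(2)[of S q "p + N"] by (auto simp: digon_def)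

lemma flip_triangulation:
  assumes fl: "flip S \<alpha> \<alpha>'" and tri: "triangulation (insert \<alpha> S)" and nS: "\<alpha> \<notin> S"
  shows "triangulation (insert \<alpha>' S)"
proof -
  have S: "S \<subseteq> arcs" using tri by (auto simp: triangulation_def)
  from fl consider (quad) p q r s where "quad S p q r s" "\<alpha> = canon p r" "\<alpha>' = canon q s"
    | (quad') p q r s where "quad S p q r s" "\<alpha> = canon q s" "\<alpha>' = canon p r"
    | (digon) p q where "digon S p q" "\<alpha> = canon p (p + N)" "\<alpha>' = canon q (q + N)"
    unfolding flip_def by blast
  thus ?thesis
  proof cases
    case quad
    note Q = quad(1)[unfolded quad_def]
    show ?thesis unfolding quad(3)
    proof (rule exchange[OF tri[unfolded quad(2)] S])
      fix u v assume h: "\<And>x y. edge S x y \<Longrightarrow> \<not> crosses u v x y"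
      show "crosses u v q s \<Longrightarrow> canon u v = canon p r" "crosses u v p r \<Longrightarrow> canon u v = canon q s"
        using crosses_quadrilateral[of p q r s u v] h Q by auto
    qed (use Q nS quad in \<open>auto simp: crosses_def\<close>)
  next
    case quad'
    note Q = quad'(1)[unfolded quad_def]
    show ?thesis unfolding quad'(3)
    proof (rule exchange[OF tri[unfolded quad'(2)] S])
      fix u v assume h: "\<And>x y. edge S x y \<Longrightarrow> \<not> crosses u v x y"
      show "crosses u v q s \<Longrightarrow> canon u v = canon p r" "crosses u v p r \<Longrightarrow> canon u v = canon q s"
        using crosses_quadrilateral[of p q r s u v] h Q by auto
    qed (use Q nS quad' in \<open>auto simp: crosses_def\<close>)
  next
    case digon
    note Q = digon(1)[unfolded digon_def] digon_edges[OF digon(1)]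
    note Q' = digon_edges[OF digon_rotate[OF digon(1)]]
    show ?thesis unfolding digon(3)
    proof (rule exchange[OF tri[unfolded digon(2)] S])
      fix u v assume h: "v \<le> u + N" "\<And>x y. edge S x y \<Longrightarrow> \<not> crosses u v x y"
      show "crosses u v p (p + N) \<Longrightarrow> canon u v = canon q (q + N)"
        using crosses_digon[of p q v u] h Q by auto
      show "crosses u v q (q + N) \<Longrightarrow> canon u v = canon p (p + N)"
        using crosses_digon[of q "p + N" v u, unfolded canon_shift1] h Q Q' by auto
    qed (use Q nS digon N_ge_2 in \<open>auto simp: crosses_def\<close>)
  qed
qed

lemma flip_not_mem:
  assumes fl: "flip S \<alpha> \<alpha>'" and nc: "noncrossing (insert \<alpha> S)"
  shows "\<alpha>' \<notin> S"
proof
  assume "\<alpha>' \<in> S"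
  hence *: "edge (insert \<alpha> S) a b" if "canon a b = \<alpha> \<or> canon a b = \<alpha>'" for a b
    using that by (auto simp: edge_def)
  from fl show False
    unfolding flip_def
  proof (elim disjE exE conjE)
    fix p q r s assume "quad S p q r s" "\<alpha> = canon p r" "\<alpha>' = canon q s"
    thus False using edge_not_crosses[OF nc *[of p r] *[of q s]] by (auto simp: quad_def crosses_def)
  next
    fix p q r s assume "quad S p q r s" "\<alpha> = canon q s" "\<alpha>' = canon p r"
    thus False using edge_not_crosses[OF nc *[of p r] *[of q s]] by (auto simp: quad_def crosses_def)
  next
    fix p q assume "digon S p q" "\<alpha> = canon p (p + N)" "\<alpha>' = canon q (q + N)"
    thus False using edge_not_crosses[OF nc *[of p "p + N"] *[of q "q + N"]]
      by (auto simp: digon_def crosses_def)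
  qed
qed

lemma edge_remove: "edge (T - {\<alpha>}) p q \<longleftrightarrow> q = p + 1 \<or> edge T p q \<and> canon p q \<noteq> \<alpha>"
  by (auto simp: edge_def)

lemma quad_remove:
  assumes "p < q" "q < r" "r < s" "s \<le> p + N" "edge T p q" "edge T q r" "edge T r s" "edge T p s"
  shows "quad (T - {canon p r}) p q r s" "quad (T - {canon q s}) p q r s"
  using assms canon_neq_start[of p r r s] canon_neq_start[of p q q s]
    canon_neq_start[of p q r s] canon_neq_start[of p q s r]
  by (auto simp: quad_def edge_remove dest: canon_length)

lemma digon_remove:
  assumes "p < q" "q < p + N" "edge T p q" "edge T q (p + N)"
  shows "digon (T - {canon p (p + N)}) p q"
  using assms by (auto simp: digon_def edge_remove dest: canon_length)

text \<open>The inner and outer triangles of an arc that is not a loop form a quadrilateral with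
  this arc as a diagonal. A loop has only the inner triangle, whose other two sides bound a
  digon.\<close>

lemma ex_flip:
  assumes tri: "triangulation T" and "\<alpha> \<in> T"
  obtains \<alpha>' where "flip (T - {\<alpha>}) \<alpha> \<alpha>'"
proof -
  obtain p r where \<alpha>: "\<alpha> = (p, r)" by (cases \<alpha>)
  have A: "(p, r) \<in> arcs" using assms \<alpha> by (auto simp: triangulation_def)
  hence c: "canon p r = \<alpha>" "p + 2 \<le> r" "r \<le> p + N" using canon_arcs \<alpha> by (auto simp: arcs_def)
  have e: "edge T p r" using c assms by (auto simp: edge_def)
  obtain q where q: "p < q" "q < r" "edge T p q" "edge T q r"
    using inner_apex[OF tri e c(2)] .
  show thesis
  proof (cases "r = p + N")
    case True
    have "digon (T - {canon p (p + N)}) p q" using q True by (intro digon_remove) auto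
    thus thesis using that[of "canon q (q + N)"] c True unfolding flip_def by blast
  next
    case False
    with c have "r < p + N" by simp
    thus thesis
    proof (rule outer_apex[OF tri e])
      fix s assume s: "r < s" "edge T p s" "edge T r s"
      have "quad (T - {canon p r}) p q r s"
        using q s edge_bounds[OF tri_arcs[OF tri] s(2)] by (intro quad_remove) auto
      thus thesis using that[of "canon q s"] c unfolding flip_def by blast
    next
      fix s assume s: "s < p" "edge T s r" "edge T s p"
      have "quad (T - {canon p r}) s p q r"
        using q s edge_bounds[OF tri_arcs[OF tri] s(2)] by (intro quad_remove(2)) auto
      thus thesis using that[of "canon s q"] c unfolding flip_def by blast
    qed
  qed
qed

section \<open>The fan, and flips leading to it\<close>

lemma neg_mod: "- N < u \<Longrightarrow> u < 0 \<Longrightarrow> u mod N = u + N"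
  using mod_add_self2[of u N] mod_pos_pos_trivial[of "u + N" N] by simp

definition fan :: "(int \<times> int) set" where
  "fan = {(0, k) | k. 2 \<le> k \<and> k \<le> N}"

text \<open>A triangulation other than the fan has a flip that increases its total weight.\<close>

definition weight :: "int \<times> int \<Rightarrow> nat" where
  "weight = (\<lambda>(p, q). if p = 0 then 2 else if q = N then 1 else 0)"

lemma fan_arcs: "fan \<subseteq> arcs"
  using N_ge_2 by (auto simp: fan_def arcs_def)

lemma edge_fan_iff: "0 \<le> p \<Longrightarrow> p < N \<Longrightarrow> edge fan p q \<longleftrightarrow> q = p + 1 \<or> p = 0 \<and> 2 \<le> q \<and> q \<le> N"
  by (auto simp: edge_def fan_def canon_self)

lemma fan_triangulation: "triangulation fan"
proof -
  have nc: "noncrossing fan" unfolding noncrossing_def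
  proof (intro allI impI notI)
    fix p q r s assume e: "edge fan p q" "edge fan r s" and cr: "p < r \<and> r < q \<and> q < s"
    define m where "m = - (p div N)"
    have m: "0 \<le> p + m * N" "p + m * N < N"
      using N_ge_2 by (auto simp: m_def minus_div_mult_eq_mod)
    have e': "edge fan (p + m * N) (q + m * N)" "edge fan (r + m * N) (s + m * N)" using e by simp_all
    have *: "p + m * N = 0" "q + m * N \<le> N"
      using edge_fan_iff[THEN iffD1, OF m e'(1)] cr by auto
    hence r: "0 < r + m * N" "r + m * N < N" using cr by linarith+
    show False using edge_fan_iff[THEN iffD1, OF _ _ e'(2)] r cr * by auto
  qed
  show ?thesis unfolding triangulation_def
  proof (intro conjI nc fan_arcs ballI impI)
    fix \<alpha> assume a: "\<alpha> \<in> arcs" "noncrossing (insert \<alpha> fan)"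
    obtain p q where \<alpha>: "\<alpha> = (p, q)" by (cases \<alpha>)
    with a have pq: "0 \<le> p" "p < N" "p + 2 \<le> q" "q \<le> p + N" "canon p q = \<alpha>"
      using canon_arcs by (auto simp: arcs_def)
    show "\<alpha> \<in> fan"
    proof (rule ccontr)
      assume "\<alpha> \<notin> fan"
      hence "p > 0" using pq \<alpha> by (auto simp: fan_def)
      \<comment> \<open>An arc that starts at \<open>p > 0\<close> passes over \<open>p + 1\<close>
        and so crosses the fan arc \<open>(0, p + 1)\<close>.\<close>
      have "edge fan 0 (min N (p + 1))" using \<open>p > 0\<close> pq N_ge_2 by (simp add: edge_fan_iff)
      hence "\<not> crosses 0 (min N (p + 1)) p q"
        using noncrossing_insertE[of p q fan] a pq by simp
      moreover have "edge fan 0 N" using N_ge_2 by (auto simp: edge_fan_iff)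
      hence "\<not> crosses 0 N p q" using noncrossing_insertE[of p q fan] a pq by simp
      ultimately show False using \<open>p > 0\<close> pq by (auto simp: crosses_def min_def split: if_splits)
    qed
  qed
qed

lemma triangulation_subset_eq: "triangulation S \<Longrightarrow> triangulation T \<Longrightarrow> S \<subseteq> T \<Longrightarrow> S = T"
  unfolding triangulation_def by (metis insert_subset noncrossing_mono subsetI subset_antisym subsetD)

text \<open>If some edge passes over 0, a shortest one has apex 0, since any other apex leaves a
  shorter edge over 0. Its weight is 0, and its flip has 0 as an endpoint: weight 2 if the new arc
  starts there, 1 if it only ends there. If no edge passes over 0, the loop at 0 is present. For a
  missing \<open>(0, k)\<close>, let \<open>i < k < j\<close> be the nearest vertices joined to 0;
  then \<open>(i, j)\<close> is an edge, and it flips to an arc starting at 0. As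
  \<open>j = N\<close> may occur, arcs ending at \<open>N\<close> have to weigh less than arcs
  starting at 0.\<close>

lemma ex_improving_flip:
  assumes tri: "triangulation T" and "T \<noteq> fan"
  obtains \<alpha> \<alpha>' where "\<alpha> \<in> T" "flip (T - {\<alpha>}) \<alpha> \<alpha>'" "weight \<alpha> < weight \<alpha>'"
proof (cases "\<exists>u v. edge T u v \<and> u < 0 \<and> 0 < v")
  case True
  hence ex: "\<exists>l u v. edge T u v \<and> u < 0 \<and> 0 < v \<and> v - u = int l"
    by (metis diff_gt_0_iff_gt less_trans zero_less_imp_eq_int)
  define L where "L = (LEAST l. \<exists>u v. edge T u v \<and> u < 0 \<and> 0 < v \<and> v - u = int l)"
  from LeastI_ex[OF ex] obtain u v where uv: "edge T u v" "u < 0" "0 < v" "v - u = int L"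
    unfolding L_def by blast
  have min: "v - u \<le> b - a" if "edge T a b" "a < 0" "0 < b" for a b
  proof -
    have "L \<le> nat (b - a)" unfolding L_def by (rule Least_le) (use that in auto)
    thus ?thesis using uv(4) that by linarith
  qed
  obtain w where w: "u < w" "w < v" "edge T u w" "edge T w v"
    using inner_apex[OF tri uv(1)] uv by auto
  have "w = 0" using min[OF w(3)] min[OF w(4)] w uv by (cases w "0::int" rule: linorder_cases) auto
  note w = w[unfolded this]
  have b: "v \<le> u + N" using edge_bounds[OF tri_arcs[OF tri] uv(1)] by simp
  have uN: "- N < u" "u mod N = u + N" using b uv neg_mod by auto
  have c: "canon u v \<in> T" "weight (canon u v) = 0"
    using uv uN by (auto simp: edge_def canon_def weight_def)
  show thesis
  proof (cases "v = u + N")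
    case True
    have "digon (T - {canon u (u + N)}) u 0" using w uv True by (intro digon_remove) auto
    hence "flip (T - {canon u v}) (canon u v) (canon 0 (0 + N))" unfolding flip_def True by blast
    moreover have "weight (canon 0 (0 + N)) = 2" using N_ge_2 by (simp add: canon_def weight_def)
    ultimately show thesis using that[OF c(1), of "canon 0 (0 + N)"] c(2) by simp
  next
    case False
    with b have "v < u + N" by simp
    thus thesis
    proof (rule outer_apex[OF tri uv(1)])
      fix s assume s: "v < s" "edge T u s" "edge T v s"
      have "quad (T - {canon u v}) u 0 v s"
        using w s uv edge_bounds[OF tri_arcs[OF tri] s(2)] by (intro quad_remove) auto
      hence "flip (T - {canon u v}) (canon u v) (canon 0 s)" unfolding flip_def by blast
      thus thesis using that c by (force simp: canon_def weight_def)
    next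
      fix s assume s: "s < u" "edge T s v" "edge T s u"
      have sN: "- N < s" using edge_bounds[OF tri_arcs[OF tri] s(2)] uv by simp
      have "quad (T - {canon u v}) s u 0 v"
        using w s uv edge_bounds[OF tri_arcs[OF tri] s(2)] by (intro quad_remove(2)) auto
      hence "flip (T - {canon u v}) (canon u v) (canon s 0)" unfolding flip_def by blast
      moreover have "s mod N = s + N" using s uv sN neg_mod by simp
      hence "weight (canon s 0) = 1" using sN by (auto simp: canon_def weight_def)
      ultimately show thesis using that[OF c(1), of "canon s 0"] c(2) by simp
    qed
  qed
next
  case False
  have N: "edge T 0 N"
  proof (rule tri_edgeI[OF tri])
    fix a b assume ab: "edge T a b"
    hence "edge T (a - N) (b - N)" by simp
    with False ab show "\<not> (a < 0 \<and> 0 < b \<and> b < N) \<and> \<not> (0 < a \<and> a < N \<and> N < b)"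
      by (metis diff_gt_0_iff_gt diff_less_0_iff_less)
  qed (use N_ge_2 in auto)
  have "\<not> fan \<subseteq> T" using triangulation_subset_eq[OF fan_triangulation tri] assms(2) by blast
  then obtain k where k: "2 \<le> k" "k \<le> N" "(0, k) \<notin> T" by (auto simp: fan_def)
  hence nk: "\<not> edge T 0 k" using N_ge_2 by (auto simp: edge_def canon_self)
  let ?Q = "{j. 0 < j \<and> j < k \<and> edge T 0 j}" and ?R = "{j. k < j \<and> j \<le> N \<and> edge T 0 j}"
  have fin: "finite ?Q" "finite ?R"
    by (rule finite_subset[of _ "{0..N}"]; use k in auto)+
  have "1 \<in> ?Q" using k edge_boundary[of T 0] by auto
  hence "Max ?Q \<in> ?Q" "\<forall>j\<in>?Q. j \<le> Max ?Q" using Max_in[of ?Q] Max_ge[of ?Q] fin by blast+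
  then obtain i where i: "0 < i" "i < k" "edge T 0 i" "\<And>j. 0 < j \<Longrightarrow> j < k \<Longrightarrow> edge T 0 j \<Longrightarrow> j \<le> i"
    by blast
  have "N \<in> ?R" using k N nk by (cases "k = N") auto
  hence "Min ?R \<in> ?R" "\<forall>j\<in>?R. Min ?R \<le> j" using Min_in[of ?R] Min_le[of ?R] fin by blast+
  then obtain j where j: "k < j" "j \<le> N" "edge T 0 j" "\<And>j'. k < j' \<Longrightarrow> j' \<le> N \<Longrightarrow> edge T 0 j' \<Longrightarrow> j \<le> j'"
    by blast
  have ij: "edge T i j"
  proof (rule tri_edgeI[OF tri])
    fix u v assume uv: "edge T u v"
    have "\<not> (u < 0 \<and> 0 < v)" using False uv by blast
    moreover have "\<not> (u = 0 \<and> i < v \<and> v < j)"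
      using i(1) i(4)[of v] j(2) j(4)[of v] nk uv by (cases v k rule: linorder_cases) auto
    moreover note tri_cross[OF tri i(3) uv] tri_cross[OF tri j(3) uv]
    ultimately show "\<not> (u < i \<and> i < v \<and> v < j) \<and> \<not> (i < u \<and> u < j \<and> j < v)"
      using i(1) j(1) k by (smt (verit))
  qed (use i j k in auto)
  obtain w where w: "i < w" "w < j" "edge T i w" "edge T w j"
    using inner_apex[OF tri ij] i j by auto
  have "quad (T - {canon i j}) 0 i w j"
    using w i j by (intro quad_remove(2)) auto
  hence "flip (T - {canon i j}) (canon i j) (canon 0 w)" unfolding flip_def by blast
  moreover have "canon i j \<in> T" using ij i j by (auto simp: edge_def)
  moreover have "weight (canon i j) < weight (canon 0 w)"
    using i j by (auto simp: canon_def weight_def)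
  ultimately show thesis using that by blast
qed

end

section \<open>Friezes\<close>

definition det2 :: "'b::comm_ring_1 \<times> 'b \<Rightarrow> 'b \<times> 'b \<Rightarrow> 'b" where
  "det2 v w = fst v * snd w - snd v * fst w"

lemma det2_pluecker: "det2 p r * det2 q s = det2 p q * det2 r s + det2 q r * det2 p s"
  by (simp add: det2_def algebra_simps)

context punctured_polygon
begin

text \<open>
  \<open>d p\<close> is the variable of the loop at \<open>p\<close>; it is \<open>l p (p + N)\<close> or its square root, according to \<open>\<kappa>\<close>.
\<close>

definition frieze :: "nat \<Rightarrow> nat \<Rightarrow> (int \<Rightarrow> int \<Rightarrow> 'b::field) \<Rightarrow> (int \<Rightarrow> 'b) \<Rightarrow> bool" where
  "frieze \<kappa> \<kappa>' l d \<longleftrightarrow>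
     (\<forall>p q. l (p + N) (q + N) = l p q) \<and> (\<forall>p. d (p + N) = d p) \<and>
     (\<forall>p. l p (p + 1) = 1) \<and> (\<forall>p. l p (p + N) = d p ^ \<kappa>) \<and>
     (\<forall>p q r s. p < q \<longrightarrow> q < r \<longrightarrow> r < s \<longrightarrow> s \<le> p + N \<longrightarrow>
        l p r * l q s = l p q * l r s + l q r * l p s) \<and>
     (\<forall>p q. p < q \<longrightarrow> q < p + N \<longrightarrow> d p * d q = l p q ^ \<kappa>' + l q (p + N) ^ \<kappa>')"

definition fval :: "(int \<Rightarrow> int \<Rightarrow> 'b) \<Rightarrow> (int \<Rightarrow> 'b) \<Rightarrow> int \<times> int \<Rightarrow> 'b" where
  "fval l d = (\<lambda>(p, q). if q = p + N then d p else l p q)"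

lemma shift_invariant:
  fixes g :: "int \<Rightarrow> int \<Rightarrow> 'c"
  assumes "\<And>p q. g (p + N) (q + N) = g p q"
  shows "g (p + m * N) (q + m * N) = g p q"
proof (induction m rule: int_induct[where k = 0])
  case (step1 i)
  thus ?case using assms[of "p + i * N" "q + i * N"] by (simp add: algebra_simps)
next
  case (step2 i)
  thus ?case using assms[of "p + (i - 1) * N" "q + (i - 1) * N"] by (simp add: algebra_simps)
qed simp

context
  fixes \<kappa> \<kappa>' :: nat and l :: "int \<Rightarrow> int \<Rightarrow> 'b::field" and d :: "int \<Rightarrow> 'b"
  assumes F: "frieze \<kappa> \<kappa>' l d"
begin

lemma frieze_shift [simp]: "l (p + m * N) (q + m * N) = l p q"
  using F by (intro shift_invariant) (auto simp: frieze_def)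

lemma frieze_shift_diam [simp]: "d (p + m * N) = d p"
  using F shift_invariant[of "\<lambda>p q. d p" p m p] by (auto simp: frieze_def)

lemma frieze_boundary: "l p (p + 1) = 1"
  using F by (auto simp: frieze_def)

lemma frieze_loop: "l p (p + N) = d p ^ \<kappa>"
  using F by (auto simp: frieze_def)

lemma frieze_ptolemy:
  "p < q \<Longrightarrow> q < r \<Longrightarrow> r < s \<Longrightarrow> s \<le> p + N \<Longrightarrow> l p r * l q s = l p q * l r s + l q r * l p s"
  using F by (auto simp: frieze_def)

lemma frieze_diameters: "p < q \<Longrightarrow> q < p + N \<Longrightarrow> d p * d q = l p q ^ \<kappa>' + l q (p + N) ^ \<kappa>'"
  using F by (auto simp: frieze_def)

lemma fval_canon: "fval l d (canon p q) = fval l d (p, q)"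
proof -
  define m where "m = - (p div N)"
  have "canon p q = (p + m * N, q + m * N)"
    by (simp add: canon_def m_def minus_div_mult_eq_mod[symmetric])
  thus ?thesis by (simp add: fval_def)
qed

lemma frieze_rotate: "frieze \<kappa> \<kappa>' (\<lambda>p q. l (p - a) (q - a)) (\<lambda>p. d (p - a))"
proof -
  have "l (p + N - a) (q + N - a) = l (p - a) (q - a)" for p q
    using frieze_shift[of "p - a" 1 "q - a"] by (simp add: algebra_simps)
  moreover have "d (p + N - a) = d (p - a)" for p
    using frieze_shift_diam[of "p - a" 1] by (simp add: algebra_simps)
  moreover have "l (p - a) (p + 1 - a) = 1" for p
    using frieze_boundary[of "p - a"] by (simp add: algebra_simps)
  moreover have "l (p - a) (p + N - a) = d (p - a) ^ \<kappa>" for p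
    using frieze_loop[of "p - a"] by (simp add: algebra_simps)
  moreover have "d (p - a) * d (q - a) = l (p - a) (q - a) ^ \<kappa>' + l (q - a) (p + N - a) ^ \<kappa>'"
    if "p < q" "q < p + N" for p q
    using frieze_diameters[of "p - a" "q - a"] that by (simp add: algebra_simps)
  ultimately show ?thesis using frieze_ptolemy unfolding frieze_def by simp
qed

text \<open>Reversing the cyclic order exchanges starts and ends of arcs, so a fan of arcs with a
  common start can be traded for one with a common end.\<close>

lemma frieze_reflect: "frieze \<kappa> \<kappa>' (\<lambda>p q. l (a - q) (a - p)) (\<lambda>p. d (a - p))"
proof -
  have "l (a - (q + N)) (a - (p + N)) = l (a - q) (a - p)" for p q
    using frieze_shift[of "a - q" "-1" "a - p"] by (simp add: algebra_simps)
  moreover have dN: "d (a - (p + N)) = d (a - p)" for p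
    using frieze_shift_diam[of "a - p" "-1"] by (simp add: algebra_simps)
  moreover have "l (a - (p + 1)) (a - p) = 1" for p
    using frieze_boundary[of "a - (p + 1)"] by (simp add: algebra_simps)
  moreover have "l (a - (p + N)) (a - p) = d (a - p) ^ \<kappa>" for p
    using frieze_loop[of "a - (p + N)"] dN[of p] by (simp add: algebra_simps)
  moreover have "d (a - p) * d (a - q) = l (a - q) (a - p) ^ \<kappa>' + l (a - (p + N)) (a - q) ^ \<kappa>'"
    if "p < q" "q < p + N" for p q
    using frieze_diameters[of "a - (p + N)" "a - q"] dN[of p] that by (simp add: algebra_simps)
  moreover have "l (a - r) (a - p) * l (a - s) (a - q) =
      l (a - q) (a - p) * l (a - s) (a - r) + l (a - r) (a - q) * l (a - s) (a - p)"
    if "p < q" "q < r" "r < s" "s \<le> p + N" for p q r s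
    using frieze_ptolemy[of "a - s" "a - r" "a - q" "a - p"] that by (simp add: algebra_simps)
  ultimately show ?thesis unfolding frieze_def by simp
qed

end

text \<open>All values are obtained from those on the fan at 0 by sums, products and division by
  \<open>l 0 k\<close> or \<open>d 0\<close>. These divisors are nonzero by \<open>init_nz\<close>,
  so a relation compatible with the operations spreads from the fan to every arc. It will be used
  with \<open>R\<close> the specialization relation.\<close>

lemma frieze_transfer:
  fixes R :: "'b::field \<Rightarrow> 'c::field \<Rightarrow> bool"
  assumes F: "frieze \<kappa> \<kappa>' l d" and F': "frieze \<kappa> \<kappa>' l' d'"
    and one: "R 1 1"
    and add: "\<And>a b a' b'. R a a' \<Longrightarrow> R b b' \<Longrightarrow> R (a + b) (a' + b')"
    and mult: "\<And>a b a' b'. R a a' \<Longrightarrow> R b b' \<Longrightarrow> R (a * b) (a' * b')"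
    and div: "\<And>a b a' b'. R a a' \<Longrightarrow> R b b' \<Longrightarrow> b' \<noteq> 0 \<Longrightarrow> R (a / b) (a' / b')"
    and nz: "\<And>a a'. R a a' \<Longrightarrow> a' \<noteq> 0 \<Longrightarrow> a \<noteq> 0"
    and init: "\<And>k. 2 \<le> k \<Longrightarrow> k \<le> N \<Longrightarrow> R (fval l d (0, k)) (fval l' d' (0, k))"
    and init_nz: "\<And>k. 2 \<le> k \<Longrightarrow> k \<le> N \<Longrightarrow> fval l' d' (0, k) \<noteq> 0"
    and \<alpha>: "\<alpha> \<in> arcs"
  shows "R (fval l d \<alpha>) (fval l' d' \<alpha>)"
proof -
  have pow: "R (a ^ k) (a' ^ k)" if "R a a'" for a a' k
    by (induction k) (auto simp: one intro: mult that)
  have eqI: "R y y'" if "b * y = a" "b' * y' = a'" "R a a'" "R b b'" "b' \<noteq> 0" for a b a' b' y y'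
  proof -
    have "y = a / b" "y' = a' / b'" using that nz[of b b'] by (auto simp: field_simps)
    thus ?thesis using div[OF that(3-5)] by simp
  qed
  have d0: "R (d 0) (d' 0)" "d' 0 \<noteq> 0"
    using init[of N] init_nz[of N] N_ge_2 by (auto simp: fval_def)
  have fan: "R (l 0 k) (l' 0 k) \<and> l' 0 k \<noteq> 0" if k: "1 \<le> k" "k \<le> N" for k
  proof -
    consider "k = 1" | "k = N" | "2 \<le> k" "k < N" using k by linarith
    thus ?thesis
    proof cases
      case 1
      thus ?thesis using frieze_boundary[OF F, of 0] frieze_boundary[OF F', of 0] one by simp
    next
      case 2
      thus ?thesis using frieze_loop[OF F, of 0] frieze_loop[OF F', of 0] pow[OF d0(1)] d0(2) by simp
    next
      case 3
      thus ?thesis using init[of k] init_nz[of k] by (auto simp: fval_def)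
    qed
  qed
  have inner: "R (l p (p + 1 + int k)) (l' p (p + 1 + int k))" if "0 < p" "p + 1 + int k \<le> N" for p k
    using that
  proof (induction k arbitrary: p)
    case 0
    thus ?case using frieze_boundary[OF F, of p] frieze_boundary[OF F', of p] one by simp
  next
    case (Suc k)
    let ?q = "p + 1 + int (Suc k)"
    have e: "l 0 (p + 1) * l p ?q = l 0 p * l (p + 1) ?q + l 0 ?q"
      using frieze_ptolemy[OF F, of 0 p "p + 1" ?q] frieze_boundary[OF F, of p] Suc.prems by simp
    have e': "l' 0 (p + 1) * l' p ?q = l' 0 p * l' (p + 1) ?q + l' 0 ?q"
      using frieze_ptolemy[OF F', of 0 p "p + 1" ?q] frieze_boundary[OF F', of p] Suc.prems by simp
    have "R (l (p + 1) ?q) (l' (p + 1) ?q)"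
      using Suc.IH[of "p + 1"] Suc.prems by (simp add: algebra_simps)
    hence "R (l 0 p * l (p + 1) ?q + l 0 ?q) (l' 0 p * l' (p + 1) ?q + l' 0 ?q)"
      using fan[of p] fan[of ?q] Suc.prems by (intro add mult) auto
    from eqI[OF e e' this] fan[of "p + 1"] Suc.prems show ?case by simp
  qed
  have inner': "R (l p q) (l' p q)" if "0 < p" "p < q" "q \<le> N" for p q
    using inner[of p "nat (q - p - 1)"] that by simp
  have diam: "R (d p) (d' p)" if "0 < p" "p < N" for p
  proof (rule eqI)
    show "d 0 * d p = l 0 p ^ \<kappa>' + l p N ^ \<kappa>'" using frieze_diameters[OF F, of 0 p] that by simp
    show "d' 0 * d' p = l' 0 p ^ \<kappa>' + l' p N ^ \<kappa>'" using frieze_diameters[OF F', of 0 p] that by simp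
    show "R (l 0 p ^ \<kappa>' + l p N ^ \<kappa>') (l' 0 p ^ \<kappa>' + l' p N ^ \<kappa>')"
      using fan[of p] inner'[of p N] that by (intro add pow) auto
  qed (use d0 in auto)
  have loop: "R (l p (p + N)) (l' p (p + N))" if "0 < p" "p < N" for p
    using pow[OF diam[OF that]] by (simp add: frieze_loop[OF F] frieze_loop[OF F'])
  \<comment> \<open>Arcs passing over the vertex \<open>N\<close>: Ptolemy for
    \<open>p, N, k + N, p + N\<close>, whose second diagonal is a translate of the fan arc
    \<open>(0, p)\<close>.\<close>
  have outer: "R (l p (k + N)) (l' p (k + N))" if "0 < k" "k < p" "p < N" for p k
  proof (rule eqI)
    show "l 0 p * l p (k + N) = l p N * l k p + l 0 k * l p (p + N)"
      using frieze_ptolemy[OF F, of p N "k + N" "p + N"] that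
        frieze_shift[OF F, of 0 1 p] frieze_shift[OF F, of 0 1 k] frieze_shift[OF F, of k 1 p] by (simp add: algebra_simps)
    show "l' 0 p * l' p (k + N) = l' p N * l' k p + l' 0 k * l' p (p + N)"
      using frieze_ptolemy[OF F', of p N "k + N" "p + N"] that
        frieze_shift[OF F', of 0 1 p] frieze_shift[OF F', of 0 1 k] frieze_shift[OF F', of k 1 p] by (simp add: algebra_simps)
    show "R (l p N * l k p + l 0 k * l p (p + N)) (l' p N * l' k p + l' 0 k * l' p (p + N))"
      using fan[of k] inner'[of p N] inner'[of k p] loop[of p] that by (intro add mult) auto
  qed (use fan[of p] that in auto)
  obtain p q where pq: "\<alpha> = (p, q)" "0 \<le> p" "p < N" "p + 2 \<le> q" "q \<le> p + N"
    using \<alpha> by (auto simp: arcs_def)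
  consider "p = 0" | "0 < p" "q = p + N" | "0 < p" "q \<le> N" | "0 < p" "N < q" "q < p + N"
    using pq by linarith
  thus ?thesis
  proof cases
    case 1
    thus ?thesis using init[of q] pq by simp
  next
    case 2
    thus ?thesis using diam[of p] pq by (simp add: fval_def)
  next
    case 3
    thus ?thesis using inner'[of p q] pq by (simp add: fval_def)
  next
    case 4
    thus ?thesis using outer[of "q - N" p] pq by (simp add: fval_def)
  qed
qed

text \<open>Normalizing \<open>v 0 = (1, 0)\<close> turns the second coordinate of
  \<open>v k\<close> into \<open>l 0 k\<close>, so the prescribed values can simply be written down.
  What remains free is spent on the boundary sides, which fix the first coordinates, and on the
  monodromy \<open>M\<close>.\<close>

lemma ex_frieze:
  fixes z :: "int \<Rightarrow> 'b::field"
  assumes \<kappa>: "\<kappa> = 1 \<and> \<kappa>' = 2 \<or> \<kappa> = 2 \<and> \<kappa>' = 1"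
    and z: "\<And>k. 2 \<le> k \<Longrightarrow> k \<le> N \<Longrightarrow> z k \<noteq> 0"
  obtains l d where "frieze \<kappa> \<kappa>' l d" "\<And>k. 2 \<le> k \<Longrightarrow> k \<le> N \<Longrightarrow> fval l d (0, k) = z k"
proof -
  define K where "K = nat N"
  have K: "int K = N" "K \<ge> 2" "0 < K" using N_ge_2 by (auto simp: K_def)
  define g D where "g = z N" and "D = g ^ \<kappa>"
  have g: "g \<noteq> 0" "D \<noteq> 0" using z[of N] N_ge_2 by (auto simp: g_def D_def)
  \<comment> \<open>The prescribed \<open>l 0 k\<close>: a side has value 1, and at the loop
    \<open>z N\<close> prescribes \<open>d 0\<close>, of which \<open>l 0 N\<close> is the power
    \<open>D\<close>.\<close>
  define X where "X k = (if k = 1 then 1 else if k = K then D else z (int k))" for k :: nat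
  have X: "X k \<noteq> 0" if "1 \<le> k" "k \<le> K" for k
    using that g z[of "int k"] K by (auto simp: X_def)
  \<comment> \<open>For \<open>k \<ge> 1\<close> the determinant of \<open>v k\<close> and
    \<open>v (Suc k)\<close> is \<open>X k * X (Suc k) * (c k - c (Suc k))\<close>; the recursion
    makes it 1.\<close>
  define c where "c = rec_nat 0 (\<lambda>k y. if k = 0 then 0 else y - 1 / (X k * X (Suc k)))"
  have c: "c (Suc k) = c k - 1 / (X k * X (Suc k))" if "1 \<le> k" for k
    using that by (simp add: c_def)
  define v where "v k = (if k = 0 then (1, 0) else (X k * c k, X k))" for k
  have v0: "det2 (v 0) (v k) = X k" if "1 \<le> k" for k
    using that by (simp add: det2_def v_def)
  have v1: "det2 (v k) (v (Suc k)) = 1" if "k < K" for k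
  proof (cases "k = 0")
    case True
    thus ?thesis using v0[of 1] by (simp add: X_def)
  next
    case False
    thus ?thesis using X[of k] X[of "Suc k"] that c[of k]
      by (simp add: det2_def v_def field_simps)
  qed
  define \<tau> where "\<tau> = (if \<kappa> = 1 then 0 else (2::'b))"
  \<comment> \<open>The condition that \<open>M\<close> maps \<open>v 0\<close> to
    \<open>v K\<close> fills its first column with \<open>D * c K\<close> and \<open>D\<close>. Then
    \<open>e\<close> comes from the trace, and \<open>b\<close> from determinant 1.\<close>
  define e where "e = \<tau> - D * c K"
  define b where "b = (D * c K * e - 1) / D"
  have b: "D * b = D * c K * e - 1" using g by (simp add: b_def)
  define M where "M = (\<lambda>(x, y). (D * c K * x + b * y, D * x + e * y))"
  have M_det: "det2 (M u) (M w) = det2 u w" for u w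
  proof -
    obtain x y x' y' where uw: "u = (x, y)" "w = (x', y')" by (cases u, cases w)
    have "det2 (M u) (M w) = (D * c K * e - D * b) * (x * y' - y * x')"
      by (simp add: det2_def M_def uw algebra_simps)
    thus ?thesis by (simp add: b det2_def uw)
  qed
  have Mn_det: "det2 ((M ^^ m) u) ((M ^^ m) w) = det2 u w" for m u w
    by (induction m) (auto simp: M_det)
  \<comment> \<open>Cayley-Hamilton in the form \<open>M + M^-1 = \<tau>\<close>, combined with the
    invariance of determinants under \<open>M\<close>.\<close>
  have M_trace: "det2 u (M w) = \<tau> * det2 u w + det2 w (M u)" for u w
    by (cases u, cases w) (simp add: det2_def M_def e_def algebra_simps)
  define W where "W k = (M ^^ (k div K)) (v (k mod K))" for k
  have W_shift: "W (k + m * K) = (M ^^ m) (W k)" for k m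
  proof -
    have "(k + m * K) div K = m + k div K" "(k + m * K) mod K = k mod K" using K by simp_all
    thus ?thesis by (simp add: W_def funpow_add)
  qed
  have W_K: "W (k + K) = M (W k)" for k using W_shift[of k 1] by simp
  have W_v: "W k = v k" if "k \<le> K" for k
    using that K by (cases "k = K") (auto simp: W_def v_def M_def X_def)
  have W1: "det2 (W k) (W (Suc k)) = 1" for k
  proof -
    have k: "k = k mod K + k div K * K" "Suc k = Suc (k mod K) + k div K * K"
      by (simp_all add: mult.commute)
    have kK: "k mod K < K" using K by simp
    have "det2 (W k) (W (Suc k)) = det2 (W (k mod K)) (W (Suc (k mod K)))"
      by (subst k(1), subst k(2)) (simp only: W_shift Mn_det)
    thus ?thesis using v1[OF kK] W_v[of "k mod K"] W_v[of "Suc (k mod K)"] kK by simp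
  qed
  \<comment> \<open>Reducing the start modulo \<open>N\<close> makes \<open>l\<close> periodic and
    avoids negative powers of \<open>M\<close>. As \<open>M\<close> preserves determinants, the
    plain determinant is recovered whenever \<open>0 \<le> p \<le> q\<close>.\<close>
  define l where "l p q = det2 (W (nat (p mod N))) (W (nat (p mod N + (q - p))))" for p q
  have l: "l p q = det2 (W (nat p)) (W (nat q))" if "0 \<le> p" "p \<le> q" for p q
  proof -
    have pos: "0 \<le> p mod N" "0 \<le> p div N" using N_ge_2 that by (auto simp: pos_imp_zdiv_nonneg_iff)
    have p: "p = p mod N + int (nat (p div N) * K)" using pos K(1) by simp
    hence "nat p = nat (p mod N) + nat (p div N) * K" using pos by (metis nat_int_add int_nat_eq)
    moreover have "q = (p mod N + (q - p)) + int (nat (p div N) * K)" using p by simp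
    hence "nat q = nat (p mod N + (q - p)) + nat (p div N) * K"
      using pos that by (metis add_nonneg_nonneg diff_ge_0_iff_ge nat_int_add int_nat_eq)
    ultimately show ?thesis by (simp only: l_def W_shift Mn_det)
  qed
  have l_shift: "l (p + N) (q + N) = l p q" for p q by (simp add: l_def)
  note l_shifts = shift_invariant[of l, OF l_shift]
  have lN: "l p (q + N) = det2 (W (nat p)) (M (W (nat q)))" if "0 \<le> p" "p \<le> q + N" "0 \<le> q" for p q
  proof -
    have "nat (q + N) = nat q + K" using that K by simp
    thus ?thesis using l[of p "q + N"] that W_K by simp
  qed
  \<comment> \<open>For trace 2, the form \<open>det2 w (M w)\<close>, that is
    \<open>D * x^2 + (e - D * c K) * x * y - b * y^2\<close>, has discriminant
    \<open>\<tau>^2 - 4 = 0\<close> and is the square of this linear form. The coefficient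
    \<open>g\<close> is a root of \<open>D\<close>; the other is read off from the mixed
    term.\<close>
  define d where "d p = (if \<kappa> = 1 then l p (p + N) else
      g * fst (W (nat (p mod N))) + (1 - D * c K) / g * snd (W (nat (p mod N))))" for p
  have d_shift: "d (p + N) = d p" for p
    using l_shift[of p "p + N"] by (simp add: d_def)
  note d_shifts = shift_invariant[of "\<lambda>p q. d p", OF d_shift]
  have diam0: "l p (p + N) = d p ^ \<kappa>
      \<and> (p < q \<longrightarrow> q < p + N \<longrightarrow> d p * d q = l p q ^ \<kappa>' + l q (p + N) ^ \<kappa>')" if p: "0 \<le> p" for p q
  proof (cases "\<kappa> = 1")
    case True
    have "l p (p + N) * l q (q + N) = (l p q)\<^sup>2 + (l q (p + N))\<^sup>2" if q: "p < q" "q < p + N"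
    proof -
      have \<tau>: "det2 u (M w) = det2 w (M u)" for u w using M_trace[of u w] True by (simp add: \<tau>_def)
      define P Q where "P = W (nat p)" and "Q = W (nat q)"
      have "det2 P (M P) * det2 Q (M Q) = (det2 P Q)\<^sup>2 + (det2 Q (M P))\<^sup>2"
        using det2_pluecker[of P "M P" Q "M Q"] \<tau>[of P Q] M_det by (simp add: power2_eq_square)
      thus ?thesis using l[of p q] lN[of p p] lN[of q q] lN[of q p] p q N_ge_2
        by (simp add: P_def Q_def)
    qed
    thus ?thesis using True \<kappa> by (auto simp: d_def)
  next
    case False
    hence \<kappa>2: "\<kappa> = 2" "\<kappa>' = 1" "\<tau> = 2" and Dg: "D = g * g"
      using \<kappa> by (auto simp: \<tau>_def D_def power2_eq_square)
    define h where "h = (1 - D * c K) / g"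
    define f where "f w = g * fst w + h * snd w" for w
    have gh: "g * h = 1 - D * c K" using g by (simp add: h_def)
    have "D * b = D * - (h * h)"
    proof -
      have "D * - (h * h) = - ((g * h) * (g * h))" by (simp add: Dg algebra_simps)
      also have "\<dots> = D * b" unfolding b gh e_def \<kappa>2 by (simp add: algebra_simps)
      finally show ?thesis by simp
    qed
    hence bh: "b = - (h * h)" using g by (metis mult_left_cancel)
    have DcK: "D * c K = 1 - g * h" using gh by simp
    \<comment> \<open>The polarization of \<open>f w * f w = det2 w (M w)\<close>; at two of the
      vectors it is the exchange relation of their loops.\<close>
    have f_mult: "f u * f w = det2 u w + det2 w (M u)" for u w
      by (cases u, cases w) (simp add: f_def det2_def M_def e_def \<kappa>2 bh DcK, simp add: Dg algebra_simps)
    have f_M: "f (M w) = f w" for w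
      by (cases w) (simp add: f_def M_def e_def \<kappa>2 bh DcK, simp add: Dg algebra_simps)
    have f_Mn: "f ((M ^^ m) w) = f w" for m w by (induction m) (auto simp: f_M)
    have d: "d p = f (W (nat p))" if "0 \<le> p" for p
    proof -
      have pos: "0 \<le> p mod N" "0 \<le> p div N" using N_ge_2 that by (auto simp: pos_imp_zdiv_nonneg_iff)
      have p: "p = p mod N + int (nat (p div N) * K)" using pos K(1) by simp
      hence "nat p = nat (p mod N) + nat (p div N) * K" using pos by (metis nat_int_add int_nat_eq)
      hence "f (W (nat p)) = f (W (nat (p mod N)))" by (simp only: W_shift f_Mn)
      thus ?thesis using False by (simp add: d_def f_def h_def)
    qed
    have "det2 u u = 0" for u :: "'b \<times> 'b" by (simp add: det2_def)
    hence "l p (p + N) = d p * d p" using f_mult d[OF p] lN[of p p] p N_ge_2 by simp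
    moreover have "d p * d q = l p q + l q (p + N)" if "p < q" "q < p + N"
      using f_mult d[of p] d[of q] lN[of q p] l[of p q] p that by simp
    ultimately show ?thesis using \<kappa>2 by (simp add: power2_eq_square)
  qed
  have norm: "0 \<le> p + (- (p div N)) * N" for p
    using N_ge_2 by (simp add: minus_div_mult_eq_mod)
  have "frieze \<kappa> \<kappa>' l d"
    unfolding frieze_def
  proof (intro conjI allI impI l_shift d_shift)
    fix p
    define m where "m = - (p div N)"
    have m: "0 \<le> p + m * N" using norm by (simp add: m_def)
    have "nat (p + m * N + 1) = Suc (nat (p + m * N))" using m by simp
    hence "l (p + m * N) (p + m * N + 1) = 1" using l[of "p + m * N" "p + m * N + 1"] m W1 by simp
    thus "l p (p + 1) = 1" using l_shifts[of p m "p + 1"] by (simp add: algebra_simps)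
    have "l (p + m * N) (p + m * N + N) = d (p + m * N) ^ \<kappa>" using diam0[OF m] by blast
    thus "l p (p + N) = d p ^ \<kappa>"
      using l_shifts[of p m "p + N"] d_shifts[of p m] by (simp add: algebra_simps)
  next
    fix p q assume pq: "p < q" "q < p + N"
    define m where "m = - (p div N)"
    have m: "0 \<le> p + m * N" using norm by (simp add: m_def)
    have "d (p + m * N) * d (q + m * N) =
        l (p + m * N) (q + m * N) ^ \<kappa>' + l (q + m * N) (p + m * N + N) ^ \<kappa>'"
      using diam0[OF m, of "q + m * N"] pq by simp
    thus "d p * d q = l p q ^ \<kappa>' + l q (p + N) ^ \<kappa>'"
      using l_shifts[of q m "p + N"] l_shifts[of p m q] d_shifts[of p m] d_shifts[of q m]
      by (simp add: algebra_simps)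
  next
    fix p q r s assume pq: "p < q" "q < r" "r < s" "s \<le> p + N"
    define m where "m = - (p div N)"
    have m: "0 \<le> p + m * N" using norm by (simp add: m_def)
    have "l (p + m * N) (r + m * N) * l (q + m * N) (s + m * N) =
        l (p + m * N) (q + m * N) * l (r + m * N) (s + m * N) +
        l (q + m * N) (r + m * N) * l (p + m * N) (s + m * N)"
      using det2_pluecker[of "W (nat (p + m * N))" "W (nat (r + m * N))"
          "W (nat (q + m * N))" "W (nat (s + m * N))"] m pq by (simp add: l)
    thus "l p r * l q s = l p q * l r s + l q r * l p s" by (simp add: l_shifts)
  qed
  moreover have "fval l d (0, k) = z k" if "2 \<le> k" "k \<le> N" for k
  proof -
    have l0: "l 0 k = X (nat k)"
      using l[of 0 k] W_v[of 0] W_v[of "nat k"] v0[of "nat k"] that K by (simp add: K_def)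
    show ?thesis
    proof (cases "k = N")
      case True
      have "d 0 = g"
      proof (cases "\<kappa> = 1")
        case True
        thus ?thesis using l0 \<open>k = N\<close> K by (simp add: d_def X_def D_def K_def[symmetric])
      next
        case False
        thus ?thesis using W_v[of 0] by (simp add: d_def v_def)
      qed
      thus ?thesis using True by (simp add: fval_def g_def)
    next
      case False
      thus ?thesis using l0 that K by (auto simp: fval_def X_def K_def nat_eq_iff)
    qed
  qed
  ultimately show thesis using that by blast
qed

text \<open>With ones on the fan the relations collapse: \<open>l p q = l (p + 1) q + 1\<close> for
  \<open>q \<le> N\<close> gives the length \<open>q - p\<close>, the loop relation gives
  \<open>d p = 1 + (N - p) ^ \<kappa>'\<close>, and an arc passing over \<open>N\<close> has the
  value of a loop plus a product of lengths.\<close>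

lemma unit_frieze_ge_2:
  fixes l :: "int \<Rightarrow> int \<Rightarrow> 'b::linordered_field"
  assumes F: "frieze \<kappa> \<kappa>' l d" and \<kappa>: "\<kappa> = 1 \<and> \<kappa>' = 2 \<or> \<kappa> = 2 \<and> \<kappa>' = 1"
    and one: "\<And>k. 2 \<le> k \<Longrightarrow> k \<le> N \<Longrightarrow> fval l d (0, k) = 1"
    and pq: "0 < p" "p < N" "p + 2 \<le> q" "q \<le> p + N"
  shows "fval l d (p, q) \<ge> 2"
proof -
  have d0: "d 0 = 1" using one[of N] N_ge_2 by (simp add: fval_def)
  have fan: "l 0 k = 1" if k: "1 \<le> k" "k \<le> N" for k
  proof -
    consider "k = 1" | "k = N" | "2 \<le> k" "k < N" using k by linarith
    thus ?thesis
      using frieze_boundary[OF F, of 0] frieze_loop[OF F, of 0] d0 one[of k] by cases (auto simp: fval_def)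
  qed
  have "l p (p + 1 + int k) = 1 + of_nat k" if "0 < p" "p + 1 + int k \<le> N" for p k
    using that
  proof (induction k arbitrary: p)
    case 0
    thus ?case using frieze_boundary[OF F, of p] by simp
  next
    case (Suc k)
    have "l p (p + 1 + int (Suc k)) = l (p + 1) (p + 1 + int (Suc k)) + 1"
      using frieze_ptolemy[OF F, of 0 p "p + 1" "p + 1 + int (Suc k)"] frieze_boundary[OF F, of p]
        Suc.prems fan by simp
    thus ?case using Suc.IH[of "p + 1"] Suc.prems by (simp add: algebra_simps)
  qed
  from this[of _ "nat (_ - _ - 1)"]
  have inner: "l p q = of_int (q - p)" if "0 < p" "p < q" "q \<le> N" for p q
    using that by (smt (verit, ccfv_threshold) add_diff_cancel_left' diff_add_cancel int_nat_eq of_int_1 of_int_add of_int_of_nat_eq)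
  have inner1: "l p q \<ge> 1" if "0 < p" "p < q" "q \<le> N" for p q
    using inner[OF that] of_int_le_iff[of 1 "q - p", where 'a = 'b] that by simp
  have dge: "d p \<ge> 2" if "0 < p" "p < N" for p
  proof -
    have "d p = 1 + l p N ^ \<kappa>'"
      using frieze_diameters[OF F, of 0 p] that fan[of p] d0 by simp
    thus ?thesis using inner1[of p N] that one_le_power[of "l p N" \<kappa>'] by simp
  qed
  have loop: "l p (p + N) \<ge> 2" if "0 < p" "p < N" for p
  proof -
    have "2 \<le> d p" using dge that by blast
    also have "d p \<le> d p ^ \<kappa>" using \<kappa> calculation by (intro self_le_power) auto
    finally show ?thesis using frieze_loop[OF F, of p] by simp
  qed
  consider "q = p + N" | "q \<le> N" "q \<noteq> p + N" | "N < q" "q < p + N"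
    using pq by linarith
  thus ?thesis
  proof cases
    case 1
    thus ?thesis using dge pq by (simp add: fval_def)
  next
    case 2
    have "(2::'b) = of_int 2" by simp
    also have "\<dots> \<le> of_int (q - p)" using pq by (subst of_int_le_iff) simp
    finally show ?thesis using 2 inner[of p q] pq by (simp add: fval_def)
  next
    case 3
    define k where "k = q - N"
    have k: "q = k + N" "0 < k" "k < p" using 3 by (auto simp: k_def)
    have "l 0 p * l p (k + N) = l p N * l k p + l 0 k * l p (p + N)"
      using frieze_ptolemy[OF F, of p N "k + N" "p + N"] k pq
        frieze_shift[OF F, of 0 1 p] frieze_shift[OF F, of 0 1 k] frieze_shift[OF F, of k 1 p] by (simp add: algebra_simps)
    hence "l p q = l p N * l k p + l p (p + N)" using fan[of p] fan[of k] k pq by simp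
    moreover have "l p N * l k p \<ge> 0" using inner1[of p N] inner1[of k p] k pq by simp
    ultimately show ?thesis using loop[of p] pq 3 by (simp add: fval_def)
  qed
qed

text \<open>
  A frieze with value \<open>1\<close> on a whole fan has larger values on all other arcs.  Two distinct arcs
  do not have both the same start and the same end, so the fan may be chosen to contain the first
  but not the second.
\<close>

lemma ex_separating_frieze:
  assumes \<kappa>: "\<kappa> = 1 \<and> \<kappa>' = 2 \<or> \<kappa> = 2 \<and> \<kappa>' = 1"
    and \<alpha>\<beta>: "\<alpha> \<in> arcs" "\<beta> \<in> arcs" "\<alpha> \<noteq> \<beta>"
  obtains l :: "int \<Rightarrow> int \<Rightarrow> 'b::linordered_field" and d
    where "frieze \<kappa> \<kappa>' l d" "\<And>\<gamma>. \<gamma> \<in> arcs \<Longrightarrow> fval l d \<gamma> > 0" "fval l d \<alpha> \<noteq> fval l d \<beta>"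
proof -
  obtain l :: "int \<Rightarrow> int \<Rightarrow> 'b" and d where F: "frieze \<kappa> \<kappa>' l d"
    and one: "\<And>k. 2 \<le> k \<Longrightarrow> k \<le> N \<Longrightarrow> fval l d (0, k) = 1"
    using ex_frieze[OF \<kappa>, of "\<lambda>_. 1"] by auto
  have val: "fval l d (p, q) = 1 \<or> fval l d (p, q) \<ge> 2 \<and> p mod N \<noteq> 0"
    "p mod N = 0 \<Longrightarrow> fval l d (p, q) = 1" "p mod N \<noteq> 0 \<Longrightarrow> fval l d (p, q) \<ge> 2"
    if "p + 2 \<le> q" "q \<le> p + N" for p q
  proof -
    have "0 \<le> p mod N" "p mod N < N" using N_ge_2 by auto
    moreover from this have "p mod N \<noteq> 0 \<Longrightarrow> 0 < p mod N" by linarith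
    moreover have "fval l d (p, q) = fval l d (p mod N, p mod N + (q - p))"
      using fval_canon[OF F, of p q] by (simp add: canon_def)
    ultimately show "p mod N = 0 \<Longrightarrow> fval l d (p, q) = 1" "p mod N \<noteq> 0 \<Longrightarrow> fval l d (p, q) \<ge> 2"
      using unit_frieze_ge_2[OF F \<kappa> one, of "p mod N" "p mod N + (q - p)"]
        one[of "p mod N + (q - p)"] that by auto
    thus "fval l d (p, q) = 1 \<or> fval l d (p, q) \<ge> 2 \<and> p mod N \<noteq> 0"
      by (cases "p mod N = 0") auto
  qed
  obtain p q p' q' where *: "\<alpha> = (p, q)" "\<beta> = (p', q')" by (cases \<alpha>, cases \<beta>)
  note A = \<alpha>\<beta>[unfolded * arcs_def, simplified]
  \<comment> \<open>To be applied to the difference of two starts, or of two ends when the starts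
    agree; both lie strictly between \<open>- N\<close> and \<open>N\<close>.\<close>
  have nz: "u mod N \<noteq> 0" if "u \<noteq> 0" "- N < u" "u < N" for u
    using that zdvd_not_zless[of u N] zdvd_not_zless[of "- u" N]
    by (cases "u < 0") (auto simp: dvd_eq_mod_eq_0[symmetric])
  show thesis
  proof (cases "p = p'")
    case False
    let ?l = "\<lambda>a b. l (a - p) (b - p)" and ?d = "\<lambda>a. d (a - p)"
    have v: "fval ?l ?d (a, b) = fval l d (a - p, b - p)" for a b by (simp add: fval_def)
    show thesis
    proof (rule that[OF frieze_rotate[OF F]])
      show "0 < fval ?l ?d \<gamma>" if "\<gamma> \<in> arcs" for \<gamma>
        using that val(1)[of "fst \<gamma> - p" "snd \<gamma> - p"] v[of "fst \<gamma>" "snd \<gamma>"] by (auto simp: arcs_def)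
      show "fval ?l ?d \<alpha> \<noteq> fval ?l ?d \<beta>"
        unfolding * v using val(2)[of "p - p" "q - p"] val(3)[of "p' - p" "q' - p"] nz[of "p' - p"] A False
        by auto
    qed
  next
    case True
    let ?l = "\<lambda>a b. l (q - b) (q - a)" and ?d = "\<lambda>a. d (q - a)"
    have v: "fval ?l ?d (a, b) = fval l d (q - b, q - a)" if "b \<le> a + N" for a b
      using frieze_shift_diam[OF F, of "q - a" "-1"] by (auto simp: fval_def algebra_simps)
    show thesis
    proof (rule that[OF frieze_reflect[OF F]])
      show "0 < fval ?l ?d \<gamma>" if "\<gamma> \<in> arcs" for \<gamma>
        using that val(1)[of "q - snd \<gamma>" "q - fst \<gamma>"] v[of "snd \<gamma>" "fst \<gamma>"] by (auto simp: arcs_def)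
      show "fval ?l ?d \<alpha> \<noteq> fval ?l ?d \<beta>"
        using * v[of q p] v[of q' p'] val(2)[of "q - q" "q - p"] val(3)[of "q - q'" "q - p'"]
          nz[of "q - q'"] A True by auto
    qed
  qed
qed

end

section \<open>Exchange matrices and seeds of triangulations\<close>

text \<open>The contribution of one triangle to a signed adjacency matrix: its sides, in cyclic
  order, form an oriented 3-cycle.\<close>

definition turn :: "'l \<Rightarrow> 'l \<Rightarrow> 'l \<Rightarrow> 'l \<Rightarrow> 'l \<Rightarrow> int" where
  "turn x y z \<alpha> \<beta> =
     of_bool (\<alpha> = x \<and> \<beta> = y) + of_bool (\<alpha> = y \<and> \<beta> = z) + of_bool (\<alpha> = z \<and> \<beta> = x) -
     of_bool (\<beta> = x \<and> \<alpha> = y) - of_bool (\<beta> = y \<and> \<alpha> = z) - of_bool (\<beta> = z \<and> \<alpha> = x)"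

lemma turn_rotate: "turn y z x = turn x y z"
  unfolding turn_def by (intro ext) linarith

lemma turn_eq_0: "\<alpha> \<notin> {x, y, z} \<or> \<beta> \<notin> {x, y, z} \<Longrightarrow> turn x y z \<alpha> \<beta> = 0"
  by (elim disjE) (simp_all add: turn_def)

lemma pos_part_mult: "0 < c \<Longrightarrow> pos_part (c * b) = c * pos_part b"
  using max_mult_distrib_left[of c b 0] by (simp only: pos_part_def mult_zero_right if_True less_imp_le)

text \<open>The sides \<open>s1, s2, s3, s4\<close> go around a quadrilateral with diagonals
  \<open>d\<close> and \<open>d'\<close>. Here \<open>u\<close> is the column of \<open>d\<close>,
  positive on one pair of opposite sides and negative on the other; passing to \<open>d'\<close>
  interchanges the pairs.\<close>

lemma turn_quad_col:
  assumes "distinct [s1, s2, s3, s4, d, d']" "\<alpha> \<noteq> d" "\<alpha> \<noteq> d'"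
  defines "u \<equiv> of_bool (\<alpha> = s2) + of_bool (\<alpha> = s4) - of_bool (\<alpha> = s1) - of_bool (\<alpha> = s3)"
  shows "turn s1 s2 d \<alpha> d + turn d s3 s4 \<alpha> d = u"
    "turn s1 s2 d d \<alpha> + turn d s3 s4 d \<alpha> = - u"
    "turn s4 s1 d' \<alpha> d' + turn d' s2 s3 \<alpha> d' = - u"
    "turn s4 s1 d' d' \<alpha> + turn d' s2 s3 d' \<alpha> = u"
  unfolding u_def using assms(1-3) by (simp_all add: turn_def) auto

lemma pos_part_quad:
  assumes "distinct [s1, s2, s3, s4]"
  shows "pos_part (of_bool (\<alpha> = s2) + of_bool (\<alpha> = s4) - of_bool (\<alpha> = s1) - of_bool (\<alpha> = s3)) =
      of_bool (\<alpha> = s2) + of_bool (\<alpha> = s4)"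
    and "pos_part (- (of_bool (\<alpha> = s2) + of_bool (\<alpha> = s4) - of_bool (\<alpha> = s1) - of_bool (\<alpha> = s3))) =
      of_bool (\<alpha> = s1) + of_bool (\<alpha> = s3)"
  using assms by (cases "\<alpha> = s1"; cases "\<alpha> = s2"; cases "\<alpha> = s3"; simp add: pos_part_def)+

text \<open>This is matrix mutation at \<open>d\<close>, where column \<open>d\<close> is
  \<open>u\<close> and row \<open>d\<close> is \<open>- u\<close>.\<close>

lemma turn_quad_mutate:
  assumes s: "distinct [s1, s2, s3, s4]" and "\<alpha> \<noteq> d" "\<alpha> \<noteq> d'" "\<beta> \<noteq> d" "\<beta> \<noteq> d'"
  defines "u \<equiv> \<lambda>\<alpha>. of_bool (\<alpha> = s2) + of_bool (\<alpha> = s4) - of_bool (\<alpha> = s1) - of_bool (\<alpha> = s3)"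
  shows "turn s4 s1 d' \<alpha> \<beta> + turn d' s2 s3 \<alpha> \<beta> =
    turn s1 s2 d \<alpha> \<beta> + turn d s3 s4 \<alpha> \<beta> - pos_part (u \<alpha>) * u \<beta> + u \<alpha> * pos_part (u \<beta>)"
  unfolding u_def pos_part_quad[OF s] using assms(2-5)
  by (simp add: turn_def of_bool_conj algebra_simps)

lemma turn_digon_col:
  assumes "distinct [s1, s2, d, d']" "\<alpha> \<noteq> d" "\<alpha> \<noteq> d'"
  defines "u \<equiv> of_bool (\<alpha> = s2) - of_bool (\<alpha> = s1)"
  shows "turn s1 s2 d \<alpha> d = u" "turn s1 s2 d d \<alpha> = - u"
    "turn s2 s1 d' \<alpha> d' = - u" "turn s2 s1 d' d' \<alpha> = u"
  unfolding u_def using assms(1-3) by (simp_all add: turn_def) auto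

lemma pos_part_digon:
  assumes "s1 \<noteq> s2"
  shows "pos_part (of_bool (\<alpha> = s2) - of_bool (\<alpha> = s1)) = of_bool (\<alpha> = s2)"
    and "pos_part (- (of_bool (\<alpha> = s2) - of_bool (\<alpha> = s1))) = of_bool (\<alpha> = s1)"
  using assms by (cases "\<alpha> = s1"; cases "\<alpha> = s2"; simp add: pos_part_def)+

text \<open>A digon has a single triangle, and the flip turns it over: the entry between
  \<open>s1\<close> and \<open>s2\<close> goes from 1 to -1. This is twice the change that an
  ordinary mutation would make, whence the factor.\<close>

lemma turn_digon_mutate:
  assumes s: "s1 \<noteq> s2" and "\<alpha> \<noteq> d" "\<alpha> \<noteq> d'" "\<beta> \<noteq> d" "\<beta> \<noteq> d'"
  defines "u \<equiv> \<lambda>\<alpha>. of_bool (\<alpha> = s2) - of_bool (\<alpha> = s1)"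
  shows "turn s2 s1 d' \<alpha> \<beta> =
    turn s1 s2 d \<alpha> \<beta> + 2 * (- pos_part (u \<alpha>) * u \<beta> + u \<alpha> * pos_part (u \<beta>))"
  unfolding u_def pos_part_digon[OF s] using assms(2-5)
  by (simp add: turn_def of_bool_conj algebra_simps)

section \<open>Signed adjacency of triangulations\<close>

context punctured_polygon
begin

definition triangle :: "(int \<times> int) set \<Rightarrow> int \<Rightarrow> int \<Rightarrow> int \<Rightarrow> bool" where
  "triangle S p q r \<longleftrightarrow>
     p < q \<and> q < r \<and> r \<le> p + N \<and> edge S p q \<and> edge S q r \<and> edge S p r"

definition triangles :: "(int \<times> int) set \<Rightarrow> (int \<times> int \<times> int) set" where
  "triangles S = {(p, q, r). 0 \<le> p \<and> p < N \<and> triangle S p q r}"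

definition canon3 :: "int \<Rightarrow> int \<Rightarrow> int \<Rightarrow> int \<times> int \<times> int" where
  "canon3 p q r = (p mod N, p mod N + (q - p), p mod N + (r - p))"

definition side_turn :: "int \<times> int \<times> int \<Rightarrow> int \<times> int \<Rightarrow> int \<times> int \<Rightarrow> int" where
  "side_turn = (\<lambda>(p, q, r). turn (canon p q) (canon q r) (canon p r))"

definition signed_adjacency :: "(int \<times> int) set \<Rightarrow> int \<times> int \<Rightarrow> int \<times> int \<Rightarrow> int" where
  "signed_adjacency S \<alpha> \<beta> = (\<Sum>t\<in>triangles S. side_turn t \<alpha> \<beta>)"

lemma canon3_shift: obtains m where "canon3 p q r = (p + m * N, q + m * N, r + m * N)"
proof
  show "canon3 p q r = (p + - (p div N) * N, q + - (p div N) * N, r + - (p div N) * N)"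
    by (simp add: canon3_def minus_div_mult_eq_mod[symmetric])
qed

lemma canon3_self: "0 \<le> p \<Longrightarrow> p < N \<Longrightarrow> canon3 p q r = (p, q, r)"
  by (simp add: canon3_def)

lemma canon3_add [simp]: "canon3 (p + m * N) (q + m * N) (r + m * N) = canon3 p q r"
  by (simp add: canon3_def)

lemma triangle_shift [simp]: "triangle S (p + m * N) (q + m * N) (r + m * N) \<longleftrightarrow> triangle S p q r"
  by (simp add: triangle_def)

lemma canon3_in_triangles_iff: "canon3 p q r \<in> triangles S \<longleftrightarrow> triangle S p q r"
proof -
  obtain m where m: "canon3 p q r = (p + m * N, q + m * N, r + m * N)" by (rule canon3_shift)
  hence "p + m * N = p mod N" by (simp add: canon3_def)
  hence "0 \<le> p + m * N" "p + m * N < N" using N_ge_2 by auto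
  thus ?thesis by (simp add: m triangles_def del: triangle_shift) simp
qed

lemma side_turn_canon3: "side_turn (canon3 p q r) = turn (canon p q) (canon q r) (canon p r)"
  by (rule canon3_shift[of p q r]) (simp add: side_turn_def)

lemma finite_triangles: "finite (triangles S)"
  by (rule finite_subset[of _ "{0..N} \<times> {0..2*N} \<times> {0..2*N}"])
    (auto simp: triangles_def triangle_def)

text \<open>An arc outside \<open>S\<close> is not a side of any triangle of \<open>S\<close>.
  Boundary sides are different: they never belong to \<open>S\<close> but do bound triangles, so
  their entries may be nonzero.\<close>

lemma signed_adjacency_eq_0:
  assumes "\<alpha> \<in> arcs" "\<alpha> \<notin> S"
  shows "signed_adjacency S \<alpha> \<beta> = 0" "signed_adjacency S \<beta> \<alpha> = 0"
proof -
  have no: "canon i j \<noteq> \<alpha>" if "edge S i j" for i j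
    using that assms by (auto simp: edge_def canon_in_arcs_iff)
  have "side_turn t \<alpha> \<beta> = 0 \<and> side_turn t \<beta> \<alpha> = 0" if "t \<in> triangles S" for t
  proof -
    obtain p q r where t: "t = (p, q, r)" by (cases t)
    hence "\<alpha> \<notin> {canon p q, canon q r, canon p r}"
      using that no by (auto simp: triangles_def triangle_def)
    thus ?thesis unfolding t side_turn_def prod.case by (intro conjI turn_eq_0) auto
  qed
  thus "signed_adjacency S \<alpha> \<beta> = 0" "signed_adjacency S \<beta> \<alpha> = 0"
    by (auto simp: signed_adjacency_def)
qed

lemma triangles_insert:
  assumes "\<And>i j k. triangle (insert \<alpha> S) i j k \<longleftrightarrow> triangle S i j k \<or> canon3 i j k \<in> X"
    and X: "X \<subseteq> {(p, q, r). 0 \<le> p \<and> p < N}" "X \<inter> triangles S = {}" "finite X"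
  shows "signed_adjacency (insert \<alpha> S) \<beta> \<gamma> =
    signed_adjacency S \<beta> \<gamma> + (\<Sum>t\<in>X. side_turn t \<beta> \<gamma>)"
proof -
  have "triangles (insert \<alpha> S) = triangles S \<union> X"
    using X(1) by (auto simp: triangles_def assms(1) canon3_self)
  thus ?thesis unfolding signed_adjacency_def using X finite_triangles
    by (simp add: sum.union_disjoint Int_commute)
qed

lemma canon3_range: "canon3 p q r \<in> {(p, q, r). 0 \<le> p \<and> p < N}"
  using N_ge_2 by (auto simp: canon3_def)

lemma triangle_mono: "S \<subseteq> T \<Longrightarrow> triangle S p q r \<Longrightarrow> triangle T p q r"
  using edge_mono by (auto simp: triangle_def)

lemma triangle_insertE:
  assumes "triangle (insert (canon a b) S) i j k"
  obtains "triangle S i j k"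
  | k' where "canon3 i j k = canon3 a b k'" "triangle (insert (canon a b) S) a b k'"
  | i' where "canon3 i j k = canon3 i' a b" "triangle (insert (canon a b) S) i' a b"
  | j' where "canon3 i j k = canon3 a j' b" "triangle (insert (canon a b) S) a j' b"
proof -
  let ?T = "insert (canon a b) S"
  consider "triangle S i j k" | "canon i j = canon a b" | "canon j k = canon a b" | "canon i k = canon a b"
    using assms by (auto simp: triangle_def edge_insert)
  thus thesis
  proof cases
    case 2
    then obtain m where m: "i = a + m * N" "j = b + m * N" by (auto simp: canon_eq_iff)
    have k: "k = (k - m * N) + m * N" by simp
    have "canon3 i j k = canon3 a b (k - m * N)" unfolding m by (subst k) (rule canon3_add)
    moreover have "triangle ?T a b (k - m * N)"
      using assms unfolding m by (subst (asm) k) (simp only: triangle_shift)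
    ultimately show thesis using that(2) by blast
  next
    case 3
    then obtain m where m: "j = a + m * N" "k = b + m * N" by (auto simp: canon_eq_iff)
    have k: "i = (i - m * N) + m * N" by simp
    have "canon3 i j k = canon3 (i - m * N) a b" unfolding m by (subst k) (rule canon3_add)
    moreover have "triangle ?T (i - m * N) a b"
      using assms unfolding m by (subst (asm) k) (simp only: triangle_shift)
    ultimately show thesis using that(3) by blast
  next
    case 4
    then obtain m where m: "i = a + m * N" "k = b + m * N" by (auto simp: canon_eq_iff)
    have k: "j = (j - m * N) + m * N" by simp
    have "canon3 i j k = canon3 a (j - m * N) b" unfolding m by (subst k) (rule canon3_add)
    moreover have "triangle ?T a (j - m * N) b"
      using assms unfolding m by (subst (asm) k) (simp only: triangle_shift)
    ultimately show thesis using that(4) by blast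
  qed (use that in blast)
qed

lemma triangle_canon3_cong: "canon3 i j k = canon3 p q r \<Longrightarrow> triangle S i j k \<longleftrightarrow> triangle S p q r"
  using canon3_in_triangles_iff by metis

text \<open>Each new triangle has the new diagonal as a side, and noncrossing with the sides of the
  quadrilateral forces its third corner to be \<open>q\<close> or \<open>s\<close>. The order of the
  universal cover breaks the cyclic symmetry, so the diagonal \<open>(q, s)\<close> requires its own
  version.\<close>

lemma signed_adjacency_quad:
  assumes Q: "quad S p q r s" and nc: "noncrossing (insert (canon p r) S)" and nS: "canon p r \<notin> S"
  shows "signed_adjacency (insert (canon p r) S) \<beta> \<gamma> = signed_adjacency S \<beta> \<gamma> +
    (turn (canon p q) (canon q r) (canon p r) \<beta> \<gamma> + turn (canon p r) (canon r s) (canon p s) \<beta> \<gamma>)"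
proof -
  let ?T = "insert (canon p r) S"
  let ?X = "{canon3 p q r, canon3 p r s}"
  have q: "p < q" "q < r" "r < s" "s \<le> p + N" and
    e: "edge ?T p q" "edge ?T q r" "edge ?T r s" "edge ?T p s" "edge ?T p r"
    using Q by (auto simp: quad_def edge_insert)
  note nx = noncrossingD[OF nc]
  have "triangle ?T i j k \<longleftrightarrow> triangle S i j k \<or> canon3 i j k \<in> ?X" for i j k
  proof
    assume "triangle ?T i j k"
    thus "triangle S i j k \<or> canon3 i j k \<in> ?X"
    proof (cases rule: triangle_insertE)
      case (2 k')
      hence t: "r < k'" "k' \<le> p + N" "edge ?T r k'" "edge ?T p k'" by (auto simp: triangle_def)
      have "k' = s" using nx[OF e(4) t(3)] nx[OF t(4) e(3)] q t by linarith
      thus ?thesis using 2 by simp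
    next
      case (3 i')
      hence t: "i' < p" "edge ?T i' r" by (auto simp: triangle_def)
      thus ?thesis using nx[OF t(2) e(4)] q by linarith
    next
      case (4 j')
      hence t: "p < j'" "j' < r" "edge ?T p j'" "edge ?T j' r" by (auto simp: triangle_def)
      have "j' = q" using nx[OF e(1) t(4)] nx[OF t(3) e(2)] q t by linarith
      thus ?thesis using 4 by simp
    qed simp
  next
    assume "triangle S i j k \<or> canon3 i j k \<in> ?X"
    moreover have "triangle ?T p q r" "triangle ?T p r s" using q e by (auto simp: triangle_def)
    ultimately show "triangle ?T i j k"
      using triangle_mono[of S ?T i j k] triangle_canon3_cong[of i j k p q r ?T] triangle_canon3_cong[of i j k p r s ?T] by auto
  qed
  moreover have "\<not> edge S p r" using q nS by (auto simp: edge_def)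
  hence "?X \<inter> triangles S = {}" by (auto simp: canon3_in_triangles_iff triangle_def)
  ultimately have "signed_adjacency ?T \<beta> \<gamma> =
      signed_adjacency S \<beta> \<gamma> + (\<Sum>t\<in>?X. side_turn t \<beta> \<gamma>)"
    using canon3_range by (intro triangles_insert) auto
  moreover have "canon3 p q r \<noteq> canon3 p r s" using q by (auto simp: canon3_def)
  ultimately show ?thesis by (simp add: side_turn_canon3)
qed

lemma signed_adjacency_quad':
  assumes Q: "quad S p q r s" and nc: "noncrossing (insert (canon q s) S)" and nS: "canon q s \<notin> S"
  shows "signed_adjacency (insert (canon q s) S) \<beta> \<gamma> = signed_adjacency S \<beta> \<gamma> +
    (turn (canon p q) (canon q s) (canon p s) \<beta> \<gamma> + turn (canon q r) (canon r s) (canon q s) \<beta> \<gamma>)"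
proof -
  let ?T = "insert (canon q s) S"
  let ?X = "{canon3 p q s, canon3 q r s}"
  have q: "p < q" "q < r" "r < s" "s \<le> p + N" and
    e: "edge ?T p q" "edge ?T q r" "edge ?T r s" "edge ?T p s" "edge ?T q s"
    using Q by (auto simp: quad_def edge_insert)
  note nx = noncrossingD[OF nc]
  have "triangle ?T i j k \<longleftrightarrow> triangle S i j k \<or> canon3 i j k \<in> ?X" for i j k
  proof
    assume "triangle ?T i j k"
    thus "triangle S i j k \<or> canon3 i j k \<in> ?X"
    proof (cases rule: triangle_insertE)
      case (2 k')
      hence t: "s < k'" "edge ?T q k'" by (auto simp: triangle_def)
      thus ?thesis using nx[OF e(4) t(2)] q by linarith
    next
      case (3 i')
      hence t: "i' < q" "edge ?T i' q" "edge ?T i' s" by (auto simp: triangle_def)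
      have "i' = p" using nx[OF t(2) e(4)] nx[OF e(1) t(3)] q t by linarith
      thus ?thesis using 3 by simp
    next
      case (4 j')
      hence t: "q < j'" "j' < s" "edge ?T q j'" "edge ?T j' s" by (auto simp: triangle_def)
      have "j' = r" using nx[OF e(2) t(4)] nx[OF t(3) e(3)] q t by linarith
      thus ?thesis using 4 by simp
    qed simp
  next
    assume "triangle S i j k \<or> canon3 i j k \<in> ?X"
    moreover have "triangle ?T p q s" "triangle ?T q r s" using q e by (auto simp: triangle_def)
    ultimately show "triangle ?T i j k"
      using triangle_mono[of S ?T i j k] triangle_canon3_cong[of i j k p q s ?T] triangle_canon3_cong[of i j k q r s ?T] by auto
  qed
  moreover have "\<not> edge S q s" using q nS by (auto simp: edge_def)
  hence "?X \<inter> triangles S = {}" by (auto simp: canon3_in_triangles_iff triangle_def)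
  ultimately have "signed_adjacency ?T \<beta> \<gamma> =
      signed_adjacency S \<beta> \<gamma> + (\<Sum>t\<in>?X. side_turn t \<beta> \<gamma>)"
    using canon3_range by (intro triangles_insert) auto
  moreover have "canon3 p q s \<noteq> canon3 q r s"
    using canon_neq_start(1)[of p q q r] q by (auto simp: canon3_def canon_def)
  ultimately show ?thesis by (simp add: side_turn_canon3)
qed

text \<open>A triangle spans at most \<open>N\<close>, so a loop can only be its long side. Thus
  just one triangle is added, with apex \<open>q\<close>.\<close>

lemma signed_adjacency_digon:
  assumes Q: "digon S p q" and nc: "noncrossing (insert (canon p (p + N)) S)"
    and nS: "canon p (p + N) \<notin> S"
  shows "signed_adjacency (insert (canon p (p + N)) S) \<beta> \<gamma> = signed_adjacency S \<beta> \<gamma> +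
    turn (canon p q) (canon q (p + N)) (canon p (p + N)) \<beta> \<gamma>"
proof -
  let ?T = "insert (canon p (p + N)) S"
  let ?X = "{canon3 p q (p + N)}"
  have q: "p < q" "q < p + N" and
    e: "edge ?T p q" "edge ?T q (p + N)" "edge ?T p (p + N)"
    using Q by (auto simp: digon_def edge_insert)
  note nx = noncrossingD[OF nc]
  have "triangle ?T i j k \<longleftrightarrow> triangle S i j k \<or> canon3 i j k \<in> ?X" for i j k
  proof
    assume "triangle ?T i j k"
    thus "triangle S i j k \<or> canon3 i j k \<in> ?X"
    proof (cases rule: triangle_insertE)
      case (2 k')
      thus ?thesis by (auto simp: triangle_def)
    next
      case (3 i')
      thus ?thesis by (auto simp: triangle_def)
    next
      case (4 j')
      hence t: "p < j'" "j' < p + N" "edge ?T p j'" "edge ?T j' (p + N)" by (auto simp: triangle_def)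
      have "j' = q" using nx[OF e(1) t(4)] nx[OF t(3) e(2)] q t by linarith
      thus ?thesis using 4 by simp
    qed simp
  next
    assume "triangle S i j k \<or> canon3 i j k \<in> ?X"
    moreover have "triangle ?T p q (p + N)" using q e by (auto simp: triangle_def)
    ultimately show "triangle ?T i j k"
      using triangle_mono[of S ?T i j k] triangle_canon3_cong[of i j k p q "p + N" ?T] by auto
  qed
  moreover have "\<not> edge S p (p + N)" using q nS by (auto simp: edge_def)
  hence "?X \<inter> triangles S = {}" by (auto simp: canon3_in_triangles_iff triangle_def)
  ultimately have "signed_adjacency ?T \<beta> \<gamma> =
      signed_adjacency S \<beta> \<gamma> + (\<Sum>t\<in>?X. side_turn t \<beta> \<gamma>)"
    using canon3_range by (intro triangles_insert) auto
  thus ?thesis by (simp add: side_turn_canon3)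
qed

end

section \<open>Seeds attached to triangulations\<close>

locale cluster_frieze = punctured_polygon +
  fixes \<kappa> \<kappa>' :: nat and l :: "int \<Rightarrow> int \<Rightarrow> 'a::field_char_0" and d :: "int \<Rightarrow> 'a"
  assumes frieze: "frieze \<kappa> \<kappa>' l d"
    and \<kappa>_cases: "\<kappa> = 1 \<and> \<kappa>' = 2 \<or> \<kappa> = 2 \<and> \<kappa>' = 1"
    and fval_nonzero: "\<alpha> \<in> arcs \<Longrightarrow> fval l d \<alpha> \<noteq> 0"
    and fval_inj: "inj_on (fval l d) arcs"
begin

abbreviation V :: "int \<times> int \<Rightarrow> 'a" where
  "V \<equiv> fval l d"

definition row_weight :: "int \<times> int \<Rightarrow> nat" where
  "row_weight \<alpha> = (if snd \<alpha> = fst \<alpha> + N then \<kappa> else 1)"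

definition col_weight :: "int \<times> int \<Rightarrow> nat" where
  "col_weight \<alpha> = (if snd \<alpha> = fst \<alpha> + N then \<kappa>' else 1)"

text \<open>The weights mirror the frieze relations. As a side, a loop enters an exchange through
  \<open>l p (p + N) = d p ^ \<kappa>\<close>, which explains the row weight. When a loop is itself
  exchanged, the digon sides carry the exponent \<kappa>', which explains the column weight.\<close>

definition exchange_entry :: "(int \<times> int) set \<Rightarrow> int \<times> int \<Rightarrow> int \<times> int \<Rightarrow> int" where
  "exchange_entry T \<alpha> \<beta> = int (row_weight \<alpha>) * int (col_weight \<beta>) * signed_adjacency T \<alpha> \<beta>"

text \<open>A relation, since the labeling of the arcs by indices is arbitrary and evolves along
  mutations.\<close>

definition seed_of :: "nat \<Rightarrow> (int \<times> int) set \<Rightarrow> 'a seed \<Rightarrow> bool" where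
  "seed_of n T = (\<lambda>(y, B). triangulation T \<and> (\<exists>a. bij_betw a {1..n} T \<and>
     (\<forall>i\<in>{1..n}. y i = V (a i)) \<and>
     (\<forall>i\<in>{1..n}. \<forall>j\<in>{1..n}. B i j = exchange_entry T (a i) (a j))))"

text \<open>On edges of \<open>S\<close> this is just \<open>l p q\<close>. Phrasing it by
  membership lets the monomials of a mutation, which range over \<open>S\<close> only, absorb
  boundary sides as factors 1.\<close>

definition side_value :: "(int \<times> int) set \<Rightarrow> int \<times> int \<Rightarrow> 'a" where
  "side_value S s = (if s \<in> S then V s ^ row_weight s else 1)"

lemma weight_pos: "row_weight \<alpha> > 0" "col_weight \<alpha> > 0"
  using \<kappa>_cases by (auto simp: row_weight_def col_weight_def)

lemma weight_canon:
  "row_weight (canon p q) = (if q = p + N then \<kappa> else 1)"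
  "col_weight (canon p q) = (if q = p + N then \<kappa>' else 1)"
  by (auto simp: row_weight_def col_weight_def canon_def)

lemma side_value_edge:
  assumes "S \<subseteq> arcs" "edge S p q"
  shows "side_value S (canon p q) = l p q"
proof (cases "q = p + 1")
  case True
  have "canon p q \<notin> arcs" unfolding canon_in_arcs_iff using True by simp
  thus ?thesis using assms True frieze_boundary[OF frieze, of p] by (auto simp: side_value_def)
next
  case False
  hence "canon p q \<in> S" using assms by (simp add: edge_def)
  thus ?thesis using fval_canon[OF frieze, of p q] frieze_loop[OF frieze, of p]
    by (simp add: side_value_def weight_canon fval_def)
qed

lemma prod_side_value:
  assumes "finite T"
  shows "(\<Prod>\<alpha>\<in>T. V \<alpha> ^ (c * row_weight \<alpha> * of_bool (\<alpha> = s))) = side_value T s ^ c"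
proof -
  have "(\<Prod>\<alpha>\<in>T. V \<alpha> ^ (c * row_weight \<alpha> * of_bool (\<alpha> = s))) =
      (\<Prod>\<alpha>\<in>T. if \<alpha> = s then V s ^ (c * row_weight s) else 1)"
    by (intro prod.cong) auto
  also have "\<dots> = side_value T s ^ c"
    using assms by (simp add: prod.delta side_value_def power_mult[symmetric] mult.commute)
  finally show ?thesis .
qed

text \<open>Removes the indices from a mutation: for either kind of flip there remain only
  identities between entries at arcs and one relation of the frieze. Injectivity of \<open>V\<close>
  identifies the arc labeled \<open>k\<close>, and this label is handed over to \<delta>'.\<close>

lemma seed_of_exchange:
  assumes seed: "seed_of n (insert \<delta> S) (y, B)" and k: "k \<in> {1..n}" "y k = V \<delta>"
    and tri': "triangulation (insert \<delta>' S)" and nS: "\<delta> \<notin> S" "\<delta>' \<notin> S"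
    and col: "\<And>\<alpha>. \<alpha> \<in> S \<Longrightarrow> exchange_entry (insert \<delta>' S) \<alpha> \<delta>' = - exchange_entry (insert \<delta> S) \<alpha> \<delta>"
    and row: "\<And>\<alpha>. \<alpha> \<in> S \<Longrightarrow> exchange_entry (insert \<delta>' S) \<delta>' \<alpha> = - exchange_entry (insert \<delta> S) \<delta> \<alpha>"
    and diag: "exchange_entry (insert \<delta>' S) \<delta>' \<delta>' = - exchange_entry (insert \<delta> S) \<delta> \<delta>"
    and entry: "\<And>\<alpha> \<beta>. \<alpha> \<in> S \<Longrightarrow> \<beta> \<in> S \<Longrightarrow> exchange_entry (insert \<delta>' S) \<alpha> \<beta> =
        exchange_entry (insert \<delta> S) \<alpha> \<beta> +
        pos_part (exchange_entry (insert \<delta> S) \<alpha> \<delta>) * exchange_entry (insert \<delta> S) \<delta> \<beta> +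
        exchange_entry (insert \<delta> S) \<alpha> \<delta> * pos_part (- exchange_entry (insert \<delta> S) \<delta> \<beta>)"
    and rel: "V \<delta> * V \<delta>' =
        (\<Prod>\<alpha>\<in>insert \<delta> S. V \<alpha> ^ nat (pos_part (exchange_entry (insert \<delta> S) \<alpha> \<delta>))) +
        (\<Prod>\<alpha>\<in>insert \<delta> S. V \<alpha> ^ nat (pos_part (- exchange_entry (insert \<delta> S) \<alpha> \<delta>)))"
  shows "seed_of n (insert \<delta>' S) (mutate_seed n k (y, B))"
proof -
  let ?T = "insert \<delta> S"
  from seed obtain a where a: "bij_betw a {1..n} ?T" "\<And>i. i \<in> {1..n} \<Longrightarrow> y i = V (a i)"
    "\<And>i j. i \<in> {1..n} \<Longrightarrow> j \<in> {1..n} \<Longrightarrow> B i j = exchange_entry ?T (a i) (a j)"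
    and tri: "triangulation ?T"
    unfolding seed_of_def by blast
  have T: "?T \<subseteq> arcs" using tri by (simp add: triangulation_def)
  have ak: "a k = \<delta>"
  proof -
    have "a k \<in> ?T" using bij_betwE[OF a(1)] k(1) by blast
    hence "a k \<in> arcs" "\<delta> \<in> arcs" using T by blast+
    moreover have "V (a k) = V \<delta>" using a(2)[OF k(1)] k(2) by simp
    ultimately show ?thesis using inj_onD[OF fval_inj] by blast
  qed
  have aS: "a i \<in> S" if "i \<in> {1..n}" "i \<noteq> k" for i
  proof -
    have "a i \<in> ?T" using bij_betwE[OF a(1)] that by blast
    moreover have "a i \<noteq> a k" using inj_onD[OF bij_betw_imp_inj_on[OF a(1)]] that k(1) by blast
    ultimately show ?thesis using ak by auto
  qed
  define a' where "a' = a(k := \<delta>')"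
  have bij': "bij_betw a' {1..n} (insert \<delta>' S)"
  proof -
    have "bij_betw a ({1..n} - {k}) (?T - {\<delta>})"
      using k(1) ak by (intro bij_betw_DiffI[OF a(1)]) simp_all
    hence "bij_betw a ({1..n} - {k}) S" using nS(1) by simp
    hence "bij_betw a' ({1..n} - {k}) S" by (rule bij_betw_cong[THEN iffD1, rotated]) (simp add: a'_def)
    hence "bij_betw a' ({1..n} - {k} \<union> {k}) (S \<union> {a' k})"
      using nS(2) notIn_Un_bij_betw3[of k "{1..n} - {k}" a' S] by (simp add: a'_def)
    thus ?thesis using k(1) by (simp add: a'_def insert_absorb)
  qed
  have prod: "(\<Prod>i\<in>{1..n}. y i ^ e (B i k)) = (\<Prod>\<alpha>\<in>?T. V \<alpha> ^ e (exchange_entry ?T \<alpha> \<delta>))" for e :: "int \<Rightarrow> nat"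
  proof -
    have "(\<Prod>\<alpha>\<in>?T. V \<alpha> ^ e (exchange_entry ?T \<alpha> \<delta>)) = (\<Prod>i\<in>{1..n}. V (a i) ^ e (exchange_entry ?T (a i) \<delta>))"
      using prod.reindex_bij_betw[OF a(1), of "\<lambda>\<alpha>. V \<alpha> ^ e (exchange_entry ?T \<alpha> \<delta>)"] by simp
    also have "\<dots> = (\<Prod>i\<in>{1..n}. y i ^ e (B i k))"
      using a(2,3) k(1) ak by (intro prod.cong) auto
    finally show ?thesis ..
  qed
  have "V \<delta> \<noteq> 0" using fval_nonzero T by auto
  hence quot: "((\<Prod>\<alpha>\<in>insert \<delta> S. V \<alpha> ^ nat (pos_part (exchange_entry (insert \<delta> S) \<alpha> \<delta>))) +
        (\<Prod>\<alpha>\<in>insert \<delta> S. V \<alpha> ^ nat (pos_part (- exchange_entry (insert \<delta> S) \<alpha> \<delta>)))) / V \<delta> = V \<delta>'"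
    unfolding rel[symmetric] by simp
  have new: "mutate_cluster n k (y, B) = y(k := V \<delta>')"
    using quot prod[of "\<lambda>b. nat (pos_part b)"] prod[of "\<lambda>b. nat (pos_part (- b))"] k(2)
    by (simp add: mutate_cluster_def)
  have "mutate_matrix k B i j = exchange_entry (insert \<delta>' S) (a' i) (a' j)"
    if i: "i \<in> {1..n}" and j: "j \<in> {1..n}" for i j
  proof -
    consider "i = k" "j = k" | "i = k" "j \<noteq> k" | "i \<noteq> k" "j = k" | "i \<noteq> k" "j \<noteq> k" by blast
    thus ?thesis
    proof cases
      case 4
      thus ?thesis using i j k(1) aS a(3) ak entry[of "a i" "a j"] by (simp add: mutate_matrix_def a'_def)
    qed (use i j aS a(3) ak col row diag in \<open>simp_all add: mutate_matrix_def a'_def\<close>)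
  qed
  moreover have "(y(k := V \<delta>')) i = V (a' i)" if "i \<in> {1..n}" for i
    using that a(2) by (simp add: a'_def)
  ultimately show ?thesis using tri' bij' new
    unfolding seed_of_def mutate_seed_def by auto
qed

lemma seed_of_quad_exchange:
  assumes seed: "seed_of n (insert \<delta> S) (y, B)" and k: "k \<in> {1..n}" "y k = V \<delta>"
    and tri': "triangulation (insert \<delta>' S)" and nS: "\<delta> \<notin> S" "\<delta>' \<notin> S"
    and dist: "distinct [s1, s2, s3, s4, \<delta>, \<delta>']"
    and adj: "\<And>\<alpha> \<beta>. signed_adjacency (insert \<delta> S) \<alpha> \<beta> =
        signed_adjacency S \<alpha> \<beta> + (turn s1 s2 \<delta> \<alpha> \<beta> + turn \<delta> s3 s4 \<alpha> \<beta>)"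
    and adj': "\<And>\<alpha> \<beta>. signed_adjacency (insert \<delta>' S) \<alpha> \<beta> =
        signed_adjacency S \<alpha> \<beta> + (turn s4 s1 \<delta>' \<alpha> \<beta> + turn \<delta>' s2 s3 \<alpha> \<beta>)"
    and wt: "row_weight \<delta> = 1" "col_weight \<delta> = 1" "row_weight \<delta>' = 1" "col_weight \<delta>' = 1"
    and rel: "V \<delta> * V \<delta>' =
        side_value S s2 * side_value S s4 + side_value S s1 * side_value S s3"
  shows "seed_of n (insert \<delta>' S) (mutate_seed n k (y, B))"
proof -
  let ?T = "insert \<delta> S"
  have T: "?T \<subseteq> arcs" "insert \<delta>' S \<subseteq> arcs"
    using seed tri' by (auto simp: seed_of_def triangulation_def)
  define u :: "int \<times> int \<Rightarrow> int" where
    "u \<alpha> = of_bool (\<alpha> = s2) + of_bool (\<alpha> = s4) - of_bool (\<alpha> = s1) - of_bool (\<alpha> = s3)" for \<alpha>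
  have ne: "\<alpha> \<noteq> \<delta>" "\<alpha> \<noteq> \<delta>'" if "\<alpha> \<in> S" for \<alpha> using that nS by auto
  have adj0: "signed_adjacency S \<delta> \<alpha> = 0" "signed_adjacency S \<alpha> \<delta> = 0"
    "signed_adjacency S \<delta>' \<alpha> = 0" "signed_adjacency S \<alpha> \<delta>' = 0" for \<alpha>
    using signed_adjacency_eq_0[of \<delta> S \<alpha>] signed_adjacency_eq_0[of \<delta>' S \<alpha>] T nS by simp_all
  note cols = turn_quad_col[OF dist, folded u_def]
  have dd: "turn s1 s2 \<delta> \<delta> \<delta> + turn \<delta> s3 s4 \<delta> \<delta> = 0" "turn s4 s1 \<delta>' \<delta>' \<delta>' + turn \<delta>' s2 s3 \<delta>' \<delta>' = 0"
    "u \<delta> = 0"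
    using dist by (simp_all add: turn_def u_def) auto
  have c: "exchange_entry ?T \<alpha> \<delta> = int (row_weight \<alpha>) * u \<alpha>" if "\<alpha> \<in> ?T" for \<alpha>
    using that ne[of \<alpha>] cols(1)[of \<alpha>] dd
    by (cases "\<alpha> = \<delta>") (simp_all add: exchange_entry_def wt adj adj0)
  have c': "exchange_entry (insert \<delta>' S) \<alpha> \<delta>' = - int (row_weight \<alpha>) * u \<alpha>" if "\<alpha> \<in> S" for \<alpha>
    using ne[OF that] cols(3)[of \<alpha>] by (simp add: exchange_entry_def wt adj' adj0)
  have r: "exchange_entry ?T \<delta> \<alpha> = - int (col_weight \<alpha>) * u \<alpha>" if "\<alpha> \<in> S" for \<alpha>
    using ne[OF that] cols(2)[of \<alpha>] by (simp add: exchange_entry_def wt adj adj0)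
  have r': "exchange_entry (insert \<delta>' S) \<delta>' \<alpha> = int (col_weight \<alpha>) * u \<alpha>" if "\<alpha> \<in> S" for \<alpha>
    using ne[OF that] cols(4)[of \<alpha>] by (simp add: exchange_entry_def wt adj' adj0)
  have dist4: "distinct [s1, s2, s3, s4]" using dist by simp
  note pp = pos_part_quad[OF dist4, folded u_def]
  have pos: "0 < int (row_weight \<alpha>)" for \<alpha> using weight_pos[of \<alpha>] by simp
  have cpos: "pos_part (exchange_entry ?T \<alpha> \<delta>) = int (row_weight \<alpha>) * (of_bool (\<alpha> = s2) + of_bool (\<alpha> = s4))"
    "pos_part (- exchange_entry ?T \<alpha> \<delta>) = int (row_weight \<alpha>) * (of_bool (\<alpha> = s1) + of_bool (\<alpha> = s3))"
    if "\<alpha> \<in> ?T" for \<alpha>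
    unfolding c[OF that] mult_minus_right[symmetric] pos_part_mult[OF pos] pp by (rule refl)+
  have fin: "finite ?T" by (rule finite_subset[OF T(1) finite_arcs])
  have side: "side_value ?T s = side_value S s" if "s \<noteq> \<delta>" for s using that by (simp add: side_value_def)
  have nat_of: "nat (int w * (of_bool P + of_bool Q)) = 1 * w * of_bool P + 1 * w * of_bool Q" for w P Q
    by (cases P; cases Q) (simp_all add: nat_mult_distrib)
  have prods: "(\<Prod>\<alpha>\<in>?T. V \<alpha> ^ nat (int (row_weight \<alpha>) * (of_bool (\<alpha> = s) + of_bool (\<alpha> = t)))) =
      side_value S s * side_value S t" if "s \<noteq> \<delta>" "t \<noteq> \<delta>" for s t
    unfolding nat_of power_add prod.distrib prod_side_value[OF fin] using side that by simp
  show ?thesis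
  proof (rule seed_of_exchange[OF seed k tri' nS])
    fix \<alpha> \<beta> assume \<alpha>: "\<alpha> \<in> S" and \<beta>: "\<beta> \<in> S"
    have p: "pos_part (- exchange_entry ?T \<delta> \<beta>) = int (col_weight \<beta>) * pos_part (u \<beta>)"
      using pos_part_mult[of "int (col_weight \<beta>)" "u \<beta>"] weight_pos[of \<beta>] r[OF \<beta>] by simp
    have q: "pos_part (exchange_entry ?T \<alpha> \<delta>) = int (row_weight \<alpha>) * pos_part (u \<alpha>)"
      using pos_part_mult[of "int (row_weight \<alpha>)" "u \<alpha>"] weight_pos[of \<alpha>] c[of \<alpha>] \<alpha> by simp
    show "exchange_entry (insert \<delta>' S) \<alpha> \<beta> = exchange_entry ?T \<alpha> \<beta> +
        pos_part (exchange_entry ?T \<alpha> \<delta>) * exchange_entry ?T \<delta> \<beta> +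
        exchange_entry ?T \<alpha> \<delta> * pos_part (- exchange_entry ?T \<delta> \<beta>)"
      unfolding p q unfolding c[OF insertI2[OF \<alpha>]] r[OF \<beta>]
      unfolding exchange_entry_def adj adj' turn_quad_mutate[OF dist4 ne[OF \<alpha>] ne[OF \<beta>], folded u_def]
      by (simp add: algebra_simps)
  next
    show "V \<delta> * V \<delta>' = (\<Prod>\<alpha>\<in>?T. V \<alpha> ^ nat (pos_part (exchange_entry ?T \<alpha> \<delta>))) +
        (\<Prod>\<alpha>\<in>?T. V \<alpha> ^ nat (pos_part (- exchange_entry ?T \<alpha> \<delta>)))"
      using rel prods[of s2 s4] prods[of s1 s3] dist by (simp only: cpos cong: prod.cong) simp
  next
    fix \<alpha> assume \<alpha>: "\<alpha> \<in> S"
    show "exchange_entry (insert \<delta>' S) \<alpha> \<delta>' = - exchange_entry ?T \<alpha> \<delta>"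
      unfolding c'[OF \<alpha>] c[OF insertI2[OF \<alpha>]] by simp
    show "exchange_entry (insert \<delta>' S) \<delta>' \<alpha> = - exchange_entry ?T \<delta> \<alpha>"
      unfolding r'[OF \<alpha>] r[OF \<alpha>] by simp
  qed (use dd adj0 in \<open>simp add: exchange_entry_def adj adj'\<close>)
qed

text \<open>The row weight \<kappa> and the column weight \<kappa>' of the loop meet in each
  correction term of the mutation rule. Their product is 2 in both types, which is exactly the
  factor produced by turning over the triangle of the digon.\<close>

lemma seed_of_digon_exchange:
  assumes seed: "seed_of n (insert \<delta> S) (y, B)" and k: "k \<in> {1..n}" "y k = V \<delta>"
    and tri': "triangulation (insert \<delta>' S)" and nS: "\<delta> \<notin> S" "\<delta>' \<notin> S"
    and dist: "distinct [s1, s2, \<delta>, \<delta>']"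
    and adj: "\<And>\<alpha> \<beta>. signed_adjacency (insert \<delta> S) \<alpha> \<beta> =
        signed_adjacency S \<alpha> \<beta> + turn s1 s2 \<delta> \<alpha> \<beta>"
    and adj': "\<And>\<alpha> \<beta>. signed_adjacency (insert \<delta>' S) \<alpha> \<beta> =
        signed_adjacency S \<alpha> \<beta> + turn s2 s1 \<delta>' \<alpha> \<beta>"
    and wt: "row_weight \<delta> = \<kappa>" "col_weight \<delta> = \<kappa>'" "row_weight \<delta>' = \<kappa>" "col_weight \<delta>' = \<kappa>'"
    and rel: "V \<delta> * V \<delta>' = side_value S s2 ^ \<kappa>' + side_value S s1 ^ \<kappa>'"
  shows "seed_of n (insert \<delta>' S) (mutate_seed n k (y, B))"
proof -
  let ?T = "insert \<delta> S"
  have T: "?T \<subseteq> arcs" "insert \<delta>' S \<subseteq> arcs"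
    using seed tri' by (auto simp: seed_of_def triangulation_def)
  define u :: "int \<times> int \<Rightarrow> int" where "u \<alpha> = of_bool (\<alpha> = s2) - of_bool (\<alpha> = s1)" for \<alpha>
  have ne: "\<alpha> \<noteq> \<delta>" "\<alpha> \<noteq> \<delta>'" if "\<alpha> \<in> S" for \<alpha> using that nS by auto
  have adj0: "signed_adjacency S \<delta> \<alpha> = 0" "signed_adjacency S \<alpha> \<delta> = 0"
    "signed_adjacency S \<delta>' \<alpha> = 0" "signed_adjacency S \<alpha> \<delta>' = 0" for \<alpha>
    using signed_adjacency_eq_0[of \<delta> S \<alpha>] signed_adjacency_eq_0[of \<delta>' S \<alpha>] T nS by simp_all
  have \<kappa>2: "int \<kappa> * int \<kappa>' = 2" "0 < \<kappa>'" "0 < \<kappa>" using \<kappa>_cases by auto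
  note cols = turn_digon_col[OF dist, folded u_def]
  have dd: "turn s1 s2 \<delta> \<delta> \<delta> = 0" "turn s2 s1 \<delta>' \<delta>' \<delta>' = 0" "u \<delta> = 0"
    using dist by (simp_all add: turn_def u_def) auto
  have c: "exchange_entry ?T \<alpha> \<delta> = int (\<kappa>' * row_weight \<alpha>) * u \<alpha>" if "\<alpha> \<in> ?T" for \<alpha>
    using that ne[of \<alpha>] cols(1)[of \<alpha>] dd
    by (cases "\<alpha> = \<delta>") (simp_all add: exchange_entry_def wt adj adj0)
  have c': "exchange_entry (insert \<delta>' S) \<alpha> \<delta>' = - int (\<kappa>' * row_weight \<alpha>) * u \<alpha>" if "\<alpha> \<in> S" for \<alpha>
    using ne[OF that] cols(3)[of \<alpha>] by (simp add: exchange_entry_def wt adj' adj0)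
  have r: "exchange_entry ?T \<delta> \<alpha> = - int (\<kappa> * col_weight \<alpha>) * u \<alpha>" if "\<alpha> \<in> S" for \<alpha>
    using ne[OF that] cols(2)[of \<alpha>] by (simp add: exchange_entry_def wt adj adj0)
  have r': "exchange_entry (insert \<delta>' S) \<delta>' \<alpha> = int (\<kappa> * col_weight \<alpha>) * u \<alpha>" if "\<alpha> \<in> S" for \<alpha>
    using ne[OF that] cols(4)[of \<alpha>] by (simp add: exchange_entry_def wt adj' adj0)
  have s12: "s1 \<noteq> s2" using dist by simp
  note pp = pos_part_digon[OF s12, folded u_def]
  have pos: "int (\<kappa>' * row_weight \<alpha>) > 0" "int (\<kappa> * col_weight \<alpha>) > 0" for \<alpha>
    using \<kappa>2 weight_pos[of \<alpha>] by simp_all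
  have cpos: "pos_part (exchange_entry ?T \<alpha> \<delta>) = int (\<kappa>' * row_weight \<alpha>) * of_bool (\<alpha> = s2)"
    "pos_part (- exchange_entry ?T \<alpha> \<delta>) = int (\<kappa>' * row_weight \<alpha>) * of_bool (\<alpha> = s1)"
    if "\<alpha> \<in> ?T" for \<alpha>
    unfolding c[OF that] mult_minus_right[symmetric] pos_part_mult[OF pos(1)] pp by (rule refl)+
  have fin: "finite ?T" by (rule finite_subset[OF T(1) finite_arcs])
  have side: "side_value ?T s = side_value S s" if "s \<noteq> \<delta>" for s using that by (simp add: side_value_def)
  have nat_of: "nat (int w * of_bool P) = w * of_bool P" for w P by (cases P) simp_all
  have prods: "(\<Prod>\<alpha>\<in>?T. V \<alpha> ^ nat (int (\<kappa>' * row_weight \<alpha>) * of_bool (\<alpha> = s))) = side_value S s ^ \<kappa>'"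
    if "s \<noteq> \<delta>" for s
    unfolding nat_of prod_side_value[OF fin] using side that by simp
  show ?thesis
  proof (rule seed_of_exchange[OF seed k tri' nS])
    fix \<alpha> \<beta> assume \<alpha>: "\<alpha> \<in> S" and \<beta>: "\<beta> \<in> S"
    have p: "pos_part (- exchange_entry ?T \<delta> \<beta>) = int (\<kappa> * col_weight \<beta>) * pos_part (u \<beta>)"
      using pos_part_mult[OF pos(2)[of \<beta>], of "u \<beta>"] r[OF \<beta>] by simp
    have q: "pos_part (exchange_entry ?T \<alpha> \<delta>) = int (\<kappa>' * row_weight \<alpha>) * pos_part (u \<alpha>)"
      using pos_part_mult[OF pos(1)[of \<alpha>], of "u \<alpha>"] c[of \<alpha>] \<alpha> by simp
    have "pos_part (exchange_entry ?T \<alpha> \<delta>) * exchange_entry ?T \<delta> \<beta> +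
        exchange_entry ?T \<alpha> \<delta> * pos_part (- exchange_entry ?T \<delta> \<beta>) =
        (int \<kappa> * int \<kappa>') * (int (row_weight \<alpha>) * int (col_weight \<beta>) *
          (- pos_part (u \<alpha>) * u \<beta> + u \<alpha> * pos_part (u \<beta>)))"
      unfolding p q using c[of \<alpha>] r[OF \<beta>] \<alpha> by (simp add: algebra_simps)
    moreover have "exchange_entry (insert \<delta>' S) \<alpha> \<beta> = exchange_entry ?T \<alpha> \<beta> +
        2 * (int (row_weight \<alpha>) * int (col_weight \<beta>) *
          (- pos_part (u \<alpha>) * u \<beta> + u \<alpha> * pos_part (u \<beta>)))"
      unfolding exchange_entry_def adj adj' turn_digon_mutate[OF s12 ne[OF \<alpha>] ne[OF \<beta>], folded u_def]
      by (simp add: algebra_simps)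
    ultimately show "exchange_entry (insert \<delta>' S) \<alpha> \<beta> = exchange_entry ?T \<alpha> \<beta> +
        pos_part (exchange_entry ?T \<alpha> \<delta>) * exchange_entry ?T \<delta> \<beta> +
        exchange_entry ?T \<alpha> \<delta> * pos_part (- exchange_entry ?T \<delta> \<beta>)"
      unfolding \<kappa>2 by linarith
  next
    show "V \<delta> * V \<delta>' = (\<Prod>\<alpha>\<in>?T. V \<alpha> ^ nat (pos_part (exchange_entry ?T \<alpha> \<delta>))) +
        (\<Prod>\<alpha>\<in>?T. V \<alpha> ^ nat (pos_part (- exchange_entry ?T \<alpha> \<delta>)))"
      using rel prods[of s2] prods[of s1] dist by (simp only: cpos cong: prod.cong) simp
  next
    fix \<alpha> assume \<alpha>: "\<alpha> \<in> S"
    show "exchange_entry (insert \<delta>' S) \<alpha> \<delta>' = - exchange_entry ?T \<alpha> \<delta>"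
      unfolding c'[OF \<alpha>] c[OF insertI2[OF \<alpha>]] by simp
    show "exchange_entry (insert \<delta>' S) \<delta>' \<alpha> = - exchange_entry ?T \<delta> \<alpha>"
      unfolding r'[OF \<alpha>] r[OF \<alpha>] by simp
  qed (use dd adj0 in \<open>simp add: exchange_entry_def adj adj'\<close>)
qed

lemma boundary_or_mem: "edge S p q \<Longrightarrow> canon p q \<in> S \<or> canon p q \<notin> arcs"
  unfolding canon_in_arcs_iff by (auto simp: edge_def)

lemma quad_distinct:
  assumes "quad S p q r s" "canon p r \<notin> S" "canon q s \<notin> S"
  shows "distinct [canon p q, canon q r, canon r s, canon p s, canon p r, canon q s]"
proof -
  note Q = assms(1)[unfolded quad_def]
  have "canon p r \<in> arcs" "canon q s \<in> arcs" using Q by (auto simp: canon_in_arcs_iff)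
  hence ne: "\<delta> \<noteq> canon p r \<and> \<delta> \<noteq> canon q s" if "\<delta> \<in> S \<or> \<delta> \<notin> arcs" for \<delta>
    using that assms(2,3) by metis
  have "canon p q \<in> S \<or> canon p q \<notin> arcs" "canon q r \<in> S \<or> canon q r \<notin> arcs"
    "canon r s \<in> S \<or> canon r s \<notin> arcs" "canon p s \<in> S \<or> canon p s \<notin> arcs"
    using Q by (simp_all only: boundary_or_mem)
  note this[THEN ne]
  moreover have "canon p q \<noteq> canon q r" "canon p q \<noteq> canon r s" "canon p q \<noteq> canon p s"
    "canon q r \<noteq> canon r s" "canon p s \<noteq> canon q r" "canon p s \<noteq> canon r s" "canon p r \<noteq> canon q s"
    using Q by (simp_all add: canon_neq_start canon_same_start)
  ultimately show ?thesis by (simp add: eq_commute)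
qed

lemma seed_of_flip:
  assumes seed: "seed_of n (insert \<delta> S) (y, B)" and k: "k \<in> {1..n}" "y k = V \<delta>"
    and fl: "flip S \<delta> \<delta>'" and nS: "\<delta> \<notin> S"
  shows "seed_of n (insert \<delta>' S) (mutate_seed n k (y, B))"
proof -
  have tri: "triangulation (insert \<delta> S)" using seed by (simp add: seed_of_def)
  have tri': "triangulation (insert \<delta>' S)" using flip_triangulation[OF fl tri nS] .
  have nc: "noncrossing (insert \<delta> S)" "noncrossing (insert \<delta>' S)"
    using tri tri' by (auto simp: triangulation_def)
  have nS': "\<delta>' \<notin> S" using flip_not_mem[OF fl nc(1)] .
  have S: "S \<subseteq> arcs" using tri by (simp add: triangulation_def)
  note sv = side_value_edge[OF S]
  note ex = fval_canon[OF frieze]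
  from fl consider (quad) p q r s where "quad S p q r s" "\<delta> = canon p r" "\<delta>' = canon q s"
    | (quad') p q r s where "quad S p q r s" "\<delta> = canon q s" "\<delta>' = canon p r"
    | (digon) p q where "digon S p q" "\<delta> = canon p (p + N)" "\<delta>' = canon q (q + N)"
    unfolding flip_def by blast
  thus ?thesis
  proof cases
    case quad
    note Q = quad(1)[unfolded quad_def]
    show ?thesis
    proof (rule seed_of_quad_exchange[OF seed k tri' nS nS',
          where ?s1.0 = "canon p q" and ?s2.0 = "canon q r" and ?s3.0 = "canon r s" and ?s4.0 = "canon p s"])
      show "distinct [canon p q, canon q r, canon r s, canon p s, \<delta>, \<delta>']"
        using quad_distinct[OF quad(1)] nS nS' quad by simp
      show "V \<delta> * V \<delta>' = side_value S (canon q r) * side_value S (canon p s) +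
          side_value S (canon p q) * side_value S (canon r s)"
        using Q frieze_ptolemy[OF frieze, of p q r s] by (simp add: quad ex sv) (simp add: fval_def)
      fix \<alpha> \<beta>
      show "signed_adjacency (insert \<delta> S) \<alpha> \<beta> = signed_adjacency S \<alpha> \<beta> +
          (turn (canon p q) (canon q r) \<delta> \<alpha> \<beta> + turn \<delta> (canon r s) (canon p s) \<alpha> \<beta>)"
        using signed_adjacency_quad[OF quad(1)] nc nS quad by simp
      show "signed_adjacency (insert \<delta>' S) \<alpha> \<beta> = signed_adjacency S \<alpha> \<beta> +
          (turn (canon p s) (canon p q) \<delta>' \<alpha> \<beta> + turn \<delta>' (canon q r) (canon r s) \<alpha> \<beta>)"
        using signed_adjacency_quad'[OF quad(1)] nc nS' quad
          turn_rotate[of "canon p q" \<delta>' "canon p s"] turn_rotate[of "canon q r" "canon r s" \<delta>'] by simp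
    qed (use Q quad in \<open>simp_all add: weight_canon\<close>)
  next
    case quad'
    note Q = quad'(1)[unfolded quad_def]
    \<comment> \<open>For the other diagonal the cyclic list of sides starts one place
      earlier.\<close>
    show ?thesis
    proof (rule seed_of_quad_exchange[OF seed k tri' nS nS',
          where ?s1.0 = "canon p s" and ?s2.0 = "canon p q" and ?s3.0 = "canon q r" and ?s4.0 = "canon r s"])
      show "distinct [canon p s, canon p q, canon q r, canon r s, \<delta>, \<delta>']"
        using quad_distinct[OF quad'(1)] nS nS' quad' by auto
      show "V \<delta> * V \<delta>' = side_value S (canon p q) * side_value S (canon r s) +
          side_value S (canon p s) * side_value S (canon q r)"
        using Q frieze_ptolemy[OF frieze, of p q r s]
        by (simp add: quad' ex sv) (simp add: fval_def mult.commute)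
      fix \<alpha> \<beta>
      show "signed_adjacency (insert \<delta> S) \<alpha> \<beta> = signed_adjacency S \<alpha> \<beta> +
          (turn (canon p s) (canon p q) \<delta> \<alpha> \<beta> + turn \<delta> (canon q r) (canon r s) \<alpha> \<beta>)"
        using signed_adjacency_quad'[OF quad'(1)] nc nS quad'
          turn_rotate[of "canon p q" \<delta> "canon p s"] turn_rotate[of "canon q r" "canon r s" \<delta>] by simp
      show "signed_adjacency (insert \<delta>' S) \<alpha> \<beta> = signed_adjacency S \<alpha> \<beta> +
          (turn (canon r s) (canon p s) \<delta>' \<alpha> \<beta> + turn \<delta>' (canon p q) (canon q r) \<alpha> \<beta>)"
        using signed_adjacency_quad[OF quad'(1)] nc nS' quad'
          turn_rotate[of "canon r s" "canon p s" \<delta>'] turn_rotate[of "canon p q" "canon q r" \<delta>'] by simp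
    qed (use Q quad' in \<open>simp_all add: weight_canon\<close>)
  next
    case digon
    note Q = digon(1)[unfolded digon_def] digon_edges[OF digon(1)]
    \<comment> \<open>The new loop is based at \<open>q\<close>, so its triangle is that of the
      digon read from \<open>q\<close>.\<close>
    note D = digon_rotate[OF digon(1)]
    show ?thesis
    proof (rule seed_of_digon_exchange[OF seed k tri' nS nS',
          where ?s1.0 = "canon p q" and ?s2.0 = "canon q (p + N)"])
      have "canon p (p + N) \<noteq> canon q (q + N)" "canon p q \<noteq> canon q (p + N)"
        using Q canon_neq_start(1)[of p q "p + N" "q + N"] canon_neq_start(1)[of p q q "p + N"] by simp_all
      moreover have "canon p q \<noteq> canon p (p + N)" "canon p q \<noteq> canon q (q + N)"
        "canon q (p + N) \<noteq> canon p (p + N)" "canon q (p + N) \<noteq> canon q (q + N)"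
        using Q by (auto dest: canon_length)
      ultimately show "distinct [canon p q, canon q (p + N), \<delta>, \<delta>']" using digon by simp
      show "V \<delta> * V \<delta>' = side_value S (canon q (p + N)) ^ \<kappa>' + side_value S (canon p q) ^ \<kappa>'"
        using Q frieze_diameters[OF frieze, of p q] by (simp add: digon ex sv) (simp add: fval_def)
      fix \<alpha> \<beta>
      show "signed_adjacency (insert \<delta> S) \<alpha> \<beta> = signed_adjacency S \<alpha> \<beta> +
          turn (canon p q) (canon q (p + N)) \<delta> \<alpha> \<beta>"
        using signed_adjacency_digon[OF digon(1)] nc nS digon by simp
      show "signed_adjacency (insert \<delta>' S) \<alpha> \<beta> = signed_adjacency S \<alpha> \<beta> +
          turn (canon q (p + N)) (canon p q) \<delta>' \<alpha> \<beta>"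
        using signed_adjacency_digon[OF D, unfolded canon_shift1, of \<alpha> \<beta>] nc nS' unfolding digon(2,3) by blast
    qed (use digon in \<open>simp_all add: weight_canon\<close>)
  qed
qed

end

section \<open>The reflection and the star of the fan\<close>

context punctured_polygon
begin

lemma noncrossing_singleton: "\<alpha> \<in> arcs \<Longrightarrow> noncrossing {\<alpha>}"
proof -
  assume \<alpha>: "\<alpha> \<in> arcs"
  obtain p q where pq: "\<alpha> = canon p q" "q \<le> p + N"
    using \<alpha> canon_arcs[of "fst \<alpha>" "snd \<alpha>"] that[of "fst \<alpha>" "snd \<alpha>"] by (auto simp: arcs_def)
  have e: "edge {} u v \<longleftrightarrow> v = u + 1" for u v by (simp add: edge_def)
  show ?thesis unfolding pq(1)
    by (rule noncrossing_insertI) (use pq(2) in \<open>auto simp: e noncrossing_def crosses_def\<close>)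
qed

text \<open>The offset 1 sends the fan at 0 to the arcs \<open>(1 - k, 1)\<close> ending at the
  neighboring vertex 1. From \<open>1 - k < 0 < 1 < j\<close> it follows that they cross every
  \<open>(0, j)\<close>.\<close>

definition reflect :: "int \<times> int \<Rightarrow> int \<times> int" where
  "reflect = (\<lambda>(p, q). canon (1 - q) (1 - p))"

lemma reflect_canon: "reflect (canon p q) = canon (1 - q) (1 - p)"
proof -
  define m where "m = - (p div N)"
  have "canon p q = (p + m * N, q + m * N)"
    by (simp add: canon_def m_def minus_div_mult_eq_mod[symmetric])
  hence "reflect (canon p q) = canon (1 - q + (- m) * N) (1 - p + (- m) * N)"
    by (simp add: reflect_def algebra_simps)
  thus ?thesis by (simp only: canon_shift)
qed

lemma reflect_reflect: "\<alpha> \<in> arcs \<Longrightarrow> reflect (reflect \<alpha>) = \<alpha>"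
proof -
  assume "\<alpha> \<in> arcs"
  hence "\<alpha> = canon (fst \<alpha>) (snd \<alpha>)" using canon_arcs[of "fst \<alpha>" "snd \<alpha>"] by simp
  thus ?thesis by (metis reflect_canon diff_diff_eq2 add_diff_cancel_left' add.commute)
qed

lemma reflect_arcs: "\<alpha> \<in> arcs \<Longrightarrow> reflect \<alpha> \<in> arcs"
  by (cases \<alpha>) (auto simp: reflect_def canon_in_arcs_iff, auto simp: arcs_def)

lemma edge_reflect:
  assumes "S \<subseteq> arcs"
  shows "edge (reflect ` S) p q \<longleftrightarrow> edge S (1 - q) (1 - p)"
proof -
  have "canon p q \<in> reflect ` S \<longleftrightarrow> canon (1 - q) (1 - p) \<in> S"
  proof
    assume "canon p q \<in> reflect ` S"
    then obtain \<alpha> where "canon p q = reflect \<alpha>" "\<alpha> \<in> S" by blast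
    thus "canon (1 - q) (1 - p) \<in> S" using reflect_reflect[of \<alpha>] assms reflect_canon[of p q] by auto
  next
    assume "canon (1 - q) (1 - p) \<in> S"
    hence "reflect (canon (1 - q) (1 - p)) \<in> reflect ` S" by (rule imageI)
    thus "canon p q \<in> reflect ` S" by (simp add: reflect_canon)
  qed
  thus ?thesis by (auto simp: edge_def)
qed

lemma noncrossing_reflect:
  assumes "S \<subseteq> arcs" "noncrossing S"
  shows "noncrossing (reflect ` S)"
  unfolding noncrossing_def edge_reflect[OF assms(1)]
proof (intro allI impI notI)
  fix p q r s assume "edge S (1 - q) (1 - p)" "edge S (1 - s) (1 - r)" "p < r \<and> r < q \<and> q < s"
  thus False using noncrossingD[OF assms(2), of "1 - s" "1 - r" "1 - q" "1 - p"] by auto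
qed

lemma fan_crosses_reflected_fan:
  assumes "noncrossing S" "\<alpha> \<in> fan" "\<beta> \<in> fan" "\<alpha> \<in> S"
  shows "reflect \<beta> \<notin> S"
proof
  assume r: "reflect \<beta> \<in> S"
  obtain k j where k: "\<alpha> = (0, k)" "2 \<le> k" "k \<le> N" and j: "\<beta> = (0, j)" "2 \<le> j" "j \<le> N"
    using assms(2,3) by (auto simp: fan_def)
  have "canon 0 k = \<alpha>" using k N_ge_2 by (simp add: canon_self)
  hence "edge S 0 k" "edge S (1 - j) 1" using assms(4) r j by (auto simp: edge_def reflect_def)
  thus False using edge_not_crosses[OF assms(1), of 0 k "1 - j" 1] k j by (auto simp: crosses_def)
qed

text \<open>A simplex without an arc of the reflected fan leaves room for an arc \<open>(0, k)\<close>: take for \<open>k\<close>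
  the nearest endpoint of an arc passing over \<open>0\<close>, or \<open>N\<close> if there is none.\<close>

lemma star_fan_iff:
  assumes S: "S \<subseteq> arcs" "noncrossing S"
  shows "(\<exists>\<alpha>\<in>fan. noncrossing (insert \<alpha> S)) \<longleftrightarrow> S \<inter> reflect ` fan = {}"
proof
  assume "\<exists>\<alpha>\<in>fan. noncrossing (insert \<alpha> S)"
  thus "S \<inter> reflect ` fan = {}" using fan_crosses_reflected_fan[of "insert _ S"] by blast
next
  assume disj: "S \<inter> reflect ` fan = {}"
  let ?Q = "{v. \<exists>u. edge S u v \<and> u < 0 \<and> 0 < v}"
  have Q: "2 \<le> v \<and> v < N" if v: "v \<in> ?Q" for v
  proof -
    obtain u where u: "edge S u v" "u < 0" "0 < v" using v by blast
    have b: "v \<le> u + N" using edge_bounds[OF S(1) u(1)] by simp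
    \<comment> \<open>An edge \<open>(u, 1)\<close> with \<open>u < 0\<close> is the reflection of
      the fan arc \<open>(0, 1 - u)\<close>. This makes \<open>(0, k)\<close> a genuine arc for the
      \<open>k\<close> chosen below.\<close>
    have "v \<noteq> 1"
    proof
      assume "v = 1"
      hence "canon u v = reflect (0, 1 - u)" "(0, 1 - u) \<in> fan"
        using u b by (auto simp: reflect_def fan_def)
      moreover have "canon u v \<in> S" using u by (auto simp: edge_def)
      ultimately show False using disj by auto
    qed
    thus ?thesis using u b by linarith
  qed
  show "\<exists>\<alpha>\<in>fan. noncrossing (insert \<alpha> S)"
  proof (cases "?Q = {}")
    case True
    have "noncrossing (insert (canon 0 N) S)"
    proof (rule noncrossing_insertI[OF S(2)])
      fix u v assume uv: "edge S u v"
      hence "edge S (u - N) (v - N)" by simp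
      hence "\<not> (u - N < 0 \<and> 0 < v - N)" "\<not> (u < 0 \<and> 0 < v)" using True uv by blast+
      thus "\<not> crosses u v 0 N" unfolding crosses_def by linarith
    qed simp
    moreover have "canon 0 N \<in> fan" using N_ge_2 by (simp add: canon_self fan_def)
    ultimately show ?thesis by blast
  next
    case False
    have "finite ?Q" by (rule finite_subset[of _ "{0..N}"]) (use Q in force)+
    hence "Min ?Q \<in> ?Q" "\<forall>v\<in>?Q. Min ?Q \<le> v" using False Min_in[of ?Q] Min_le[of ?Q] by blast+
    then obtain u0 k where k: "edge S u0 k" "u0 < 0" "0 < k" "\<And>u v. edge S u v \<Longrightarrow> u < 0 \<Longrightarrow> 0 < v \<Longrightarrow> k \<le> v"
      by blast
    have k2: "2 \<le> k" "k < N" using Q k by blast+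
    have "noncrossing (insert (canon 0 k) S)"
    proof (rule noncrossing_insertI[OF S(2)])
      fix u v assume uv: "edge S u v"
      \<comment> \<open>A crossing edge either passes over 0 and ends before \<open>k\<close>,
        against minimality, or starts between 0 and \<open>k\<close> and crosses
        \<open>(u0, k)\<close>.\<close>
      show "\<not> crosses u v 0 k"
        using k(2,3) k(4)[OF uv] noncrossingD[OF S(2) k(1) uv] unfolding crosses_def by linarith
    qed (use k2 in simp)
    moreover have "canon 0 k \<in> fan" using k2 by (simp add: canon_self fan_def)
    ultimately show ?thesis by blast
  qed
qed

section \<open>The quiver of the fan and the distinctness of frieze values\<close>

lemma triangles_fan: "triangles fan = (\<lambda>k. (0, k, k + 1)) ` {1..<N}"
proof (rule set_eqI)
  fix t :: "int \<times> int \<times> int"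
  obtain p q r where t: "t = (p, q, r)" by (cases t)
  show "t \<in> triangles fan \<longleftrightarrow> t \<in> (\<lambda>k. (0, k, k + 1)) ` {1..<N}"
  proof
    assume "t \<in> triangles fan"
    hence T: "0 \<le> p" "p < N" "p < q" "q < r" "r \<le> p + N" "edge fan p q" "edge fan q r" "edge fan p r"
      by (auto simp: t triangles_def triangle_def)
    have "p = 0" "r \<le> N" using T edge_fan_iff[of p r] by auto
    moreover have "r = q + 1" using T calculation edge_fan_iff[of q r] by auto
    ultimately show "t \<in> (\<lambda>k. (0, k, k + 1)) ` {1..<N}" using T t by auto
  next
    assume "t \<in> (\<lambda>k. (0, k, k + 1)) ` {1..<N}"
    then obtain k where "t = (0, k, k + 1)" "1 \<le> k" "k < N" by auto
    thus "t \<in> triangles fan"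
      using N_ge_2 by (auto simp: triangles_def triangle_def edge_fan_iff)
  qed
qed

text \<open>Only the consecutive arcs \<open>(0, k)\<close> and \<open>(0, k + 1)\<close> share a
  triangle, with the arrow pointing from the longer to the shorter one. The fan thus has the
  downward linear quiver, with the loop as its source.\<close>

lemma signed_adjacency_fan:
  assumes "2 \<le> p" "p \<le> N" "2 \<le> q" "q \<le> N"
  shows "signed_adjacency fan (0, p) (0, q) = of_bool (p = q + 1) - of_bool (q = p + 1)"
proof -
  have "signed_adjacency fan (0, p) (0, q) = (\<Sum>k\<in>{1..<N}. side_turn (0, k, k + 1) (0, p) (0, q))"
    unfolding signed_adjacency_def triangles_fan by (subst sum.reindex) (auto simp: inj_on_def)
  also have "\<dots> = (\<Sum>k\<in>{1..<N}. (if k = q then of_bool (p = q + 1) else 0) -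
      (if k = p then of_bool (q = p + 1) else 0))"
  proof (rule sum.cong)
    fix k assume "k \<in> {1..<N}"
    hence c: "canon 0 k = (0, k)" "canon k (k + 1) = (k, k + 1)" "canon 0 (k + 1) = (0, k + 1)" "k \<noteq> 0"
      by (auto simp: canon_self)
    show "side_turn (0, k, k + 1) (0, p) (0, q) =
        (if k = q then of_bool (p = q + 1) else 0) - (if k = p then of_bool (q = p + 1) else 0)"
      using c(4) by (simp add: side_turn_def c(1-3) turn_def)
  qed simp
  also have "\<dots> = of_bool (p = q + 1) - of_bool (q = p + 1)"
    using assms by (simp add: sum_subtractf)
  finally show ?thesis .
qed

text \<open>Both friezes arise from their fans by the same rational operations. Specializing the one
  in the field therefore gives the rational one, where the two arcs are separated and all values are
  positive.\<close>

lemma frieze_values_distinct: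
  fixes x :: "nat \<Rightarrow> 'a::field_char_0"
  assumes indep: "algebraically_independent n x" and F: "frieze \<kappa> \<kappa>' l d"
    and \<kappa>: "\<kappa> = 1 \<and> \<kappa>' = 2 \<or> \<kappa> = 2 \<and> \<kappa>' = 1"
    and init: "\<And>k. 2 \<le> k \<Longrightarrow> k \<le> N \<Longrightarrow> \<exists>i\<in>{1..n}. fval l d (0, k) = x i \<and> k = int (\<pi> i) + 1"
    and \<alpha>\<beta>: "\<alpha> \<in> arcs" "\<beta> \<in> arcs" "\<alpha> \<noteq> \<beta>"
  shows "fval l d \<alpha> \<noteq> fval l d \<beta>" "fval l d \<alpha> \<noteq> 0"
proof -
  obtain l' :: "int \<Rightarrow> int \<Rightarrow> rat" and d' where F': "frieze \<kappa> \<kappa>' l' d'"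
    and pos: "\<And>\<gamma>. \<gamma> \<in> arcs \<Longrightarrow> fval l' d' \<gamma> > 0" and ne: "fval l' d' \<alpha> \<noteq> fval l' d' \<beta>"
    using ex_separating_frieze[OF \<kappa> \<alpha>\<beta>] by metis
  \<comment> \<open>Each \<open>x i\<close> is specialized to the rational value of the fan arc that
    it labels.\<close>
  define c where "c i = fval l' d' (0, int (\<pi> i) + 1)" for i
  have sp: "specializes n x c (fval l d \<gamma>) (fval l' d' \<gamma>)" if "\<gamma> \<in> arcs" for \<gamma>
  proof (rule frieze_transfer[where R = "specializes n x c", OF F F' specializes_1[OF indep]
        specializes_add[OF indep] specializes_mult[OF indep] specializes_divide[OF indep]
        specializes_nonzero[OF indep] _ _ that])
    fix k assume k: "2 \<le> k" "k \<le> N"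
    then obtain i where i: "i \<in> {1..n}" "fval l d (0, k) = x i" "k = int (\<pi> i) + 1" using init by blast
    show "specializes n x c (fval l d (0, k)) (fval l' d' (0, k))"
      using specializes_var[OF indep i(1), of c] i by (simp add: c_def)
    have "(0, k) \<in> arcs" using k N_ge_2 by (auto simp: arcs_def)
    thus "fval l' d' (0, k) \<noteq> 0" using pos by fastforce
  qed
  show "fval l d \<alpha> \<noteq> fval l d \<beta>"
    using specializes_unique[OF indep sp[OF \<alpha>\<beta>(1)]] sp[OF \<alpha>\<beta>(2)] ne by auto
  show "fval l d \<alpha> \<noteq> 0"
    using specializes_nonzero[OF indep sp[OF \<alpha>\<beta>(1)]] pos[OF \<alpha>\<beta>(1)] by simp
qed

end

section \<open>The cluster complex as a complex of noncrossing arcs\<close>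

context cluster_frieze
begin

lemma cluster_seed_of: "seed_of n T (y, B) \<Longrightarrow> cluster n y = V ` T"
proof -
  assume "seed_of n T (y, B)"
  then obtain a where "bij_betw a {1..n} T" "\<forall>i\<in>{1..n}. y i = V (a i)"
    unfolding seed_of_def by blast
  thus ?thesis unfolding cluster_def by (auto simp: bij_betw_def image_iff)
qed

lemma seed_of_mem: "seed_of n T (y, B) \<Longrightarrow> \<delta> \<in> T \<Longrightarrow> \<exists>k\<in>{1..n}. y k = V \<delta>"
  using cluster_seed_of[of n T y B] unfolding cluster_def by (metis imageE imageI)

lemma seed_of_reachable:
  assumes "(seed_step n)\<^sup>*\<^sup>* s s'" "seed_of n T s"
  shows "\<exists>T'. seed_of n T' s'"
  using assms(1)
proof (induction rule: rtranclp_induct)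
  case base
  thus ?case using assms(2) by blast
next
  case (step s1 s2)
  obtain y B where s1: "s1 = (y, B)" by (cases s1)
  obtain T1 where T1: "seed_of n T1 (y, B)" using step.IH s1 by blast
  obtain k where k: "k \<in> {1..n}" "s2 = mutate_seed n k (y, B)"
    using step.hyps(2) s1 by (auto simp: seed_step_def)
  obtain \<delta> where \<delta>: "\<delta> \<in> T1" "y k = V \<delta>"
    using cluster_seed_of[OF T1] k(1) unfolding cluster_def by (metis imageE imageI)
  have "triangulation T1" using T1 by (simp add: seed_of_def)
  then obtain \<delta>' where fl: "flip (T1 - {\<delta>}) \<delta> \<delta>'" using ex_flip \<delta>(1) by blast
  have "insert \<delta> (T1 - {\<delta>}) = T1" using \<delta>(1) by blast
  hence "seed_of n (insert \<delta>' (T1 - {\<delta>})) s2"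
    using seed_of_flip[of n \<delta> "T1 - {\<delta>}" y B k \<delta>'] T1 k \<delta>(2) fl by simp
  thus ?case by blast
qed

text \<open>Improving flips lead from \<open>T\<close> up to the fan; flips being symmetric, the
  path can be followed backwards by mutations. A single weight is at most 2, so
  \<open>2 * card arcs\<close> bounds the total and the difference serves as a measure.\<close>

lemma triangulation_reachable:
  assumes s: "seed_of n fan s"
  shows "triangulation T \<Longrightarrow> \<exists>s'. (seed_step n)\<^sup>*\<^sup>* s s' \<and> seed_of n T s'"
proof (induction "2 * card arcs - (\<Sum>\<alpha>\<in>T. weight \<alpha>)" arbitrary: T rule: less_induct)
  case less
  show ?case
  proof (cases "T = fan")
    case False
    obtain \<alpha> \<alpha>' where \<alpha>: "\<alpha> \<in> T" "flip (T - {\<alpha>}) \<alpha> \<alpha>'" "weight \<alpha> < weight \<alpha>'"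
      using ex_improving_flip[OF less.prems False] .
    define S where "S = T - {\<alpha>}"
    have T: "T = insert \<alpha> S" "\<alpha> \<notin> S" using \<alpha>(1) by (auto simp: S_def)
    note fl = \<alpha>(2)[folded S_def]
    note tri = less.prems[unfolded T(1)]
    have tri': "triangulation (insert \<alpha>' S)" using flip_triangulation[OF fl tri T(2)] .
    have n: "\<alpha>' \<notin> S" using flip_not_mem[OF fl] tri by (simp add: triangulation_def)
    have A: "insert \<alpha> S \<subseteq> arcs" "insert \<alpha>' S \<subseteq> arcs" using tri tri' by (auto simp: triangulation_def)
    have fin: "finite S" using finite_subset[OF A(1) finite_arcs] by simp
    have "(\<Sum>\<gamma>\<in>insert \<alpha>' S. weight \<gamma>) \<le> (\<Sum>\<gamma>\<in>arcs. weight \<gamma>)"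
      using A finite_arcs by (intro sum_mono2) auto
    also have "\<dots> \<le> (\<Sum>\<gamma>\<in>arcs. 2)" by (intro sum_mono) (auto simp: weight_def)
    finally have "(\<Sum>\<gamma>\<in>insert \<alpha>' S. weight \<gamma>) \<le> 2 * card arcs" by simp
    hence "2 * card arcs - (\<Sum>\<gamma>\<in>insert \<alpha>' S. weight \<gamma>) < 2 * card arcs - (\<Sum>\<gamma>\<in>T. weight \<gamma>)"
      using \<alpha>(3) fin n T by simp
    from less.hyps[OF this tri'] obtain y B
      where yB: "(seed_step n)\<^sup>*\<^sup>* s (y, B)" "seed_of n (insert \<alpha>' S) (y, B)" by fast
    obtain k where k: "k \<in> {1..n}" "y k = V \<alpha>'" using seed_of_mem[OF yB(2)] by blast
    have "seed_of n T (mutate_seed n k (y, B))"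
      using seed_of_flip[OF yB(2) k flip_sym[OF fl] n] T by simp
    moreover have "seed_step n (y, B) (mutate_seed n k (y, B))"
      using k(1) by (auto simp: seed_step_def)
    from rtranclp.rtrancl_into_rtrancl[OF yB(1) this]
    have "(seed_step n)\<^sup>*\<^sup>* s (mutate_seed n k (y, B))" .
    ultimately show ?thesis by blast
  qed (use s in blast)
qed

text \<open>Reachable seeds come from triangulations, all triangulations are reachable, and every
  noncrossing set extends to a triangulation.\<close>

lemma cluster_complex_eq:
  assumes "seed_of n fan (x, B)"
  shows "cluster_complex n x B = (\<lambda>S. V ` S) ` {S. S \<subseteq> arcs \<and> noncrossing S}"
proof (intro subset_antisym subsetI)
  fix \<sigma> assume "\<sigma> \<in> cluster_complex n x B"
  then obtain x' B' where x': "(seed_step n)\<^sup>*\<^sup>* (x, B) (x', B')" "\<sigma> \<subseteq> cluster n x'"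
    by (auto simp: cluster_complex_def)
  then obtain T where T: "seed_of n T (x', B')" using seed_of_reachable assms by blast
  obtain S where S: "S \<subseteq> T" "\<sigma> = V ` S"
    using x'(2) cluster_seed_of[OF T] subset_image_iff[of \<sigma> V T] by auto
  have "triangulation T" using T by (simp add: seed_of_def)
  hence "T \<subseteq> arcs" "noncrossing T" by (auto simp: triangulation_def)
  thus "\<sigma> \<in> (\<lambda>S. V ` S) ` {S. S \<subseteq> arcs \<and> noncrossing S}"
    using S noncrossing_mono by blast
next
  fix \<sigma> assume "\<sigma> \<in> (\<lambda>S. V ` S) ` {S. S \<subseteq> arcs \<and> noncrossing S}"
  then obtain S where S: "S \<subseteq> arcs" "noncrossing S" "\<sigma> = V ` S" by blast
  obtain T where T: "triangulation T" "S \<subseteq> T" using noncrossing_extend[OF S(1,2)] .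
  obtain x' B' where "(seed_step n)\<^sup>*\<^sup>* (x, B) (x', B')" "seed_of n T (x', B')"
    using triangulation_reachable[OF assms T(1)] by fast
  thus "\<sigma> \<in> cluster_complex n x B"
    using S(3) T(2) cluster_seed_of unfolding cluster_complex_def by blast
qed

lemma positive_complex_isomorphic_star:
  assumes seed: "seed_of n fan (x, B)"
  shows "complex_isomorphic (positive_cluster_complex n x B)
    (star (cluster_complex n x B) (cluster n x))"
proof -
  let ?NC = "{S. S \<subseteq> arcs \<and> noncrossing S}" and ?J = "reflect ` fan"
  \<comment> \<open>Simplices are sets of field elements; injectivity of \<open>V\<close> allows
    every comparison to be made on sets of arcs.\<close>
  have V_eq: "V ` S = V ` S' \<longleftrightarrow> S = S'" if "S \<subseteq> arcs" "S' \<subseteq> arcs" for S S'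
    using inj_on_image_eq_iff[OF fval_inj that] .
  have V_mem: "V \<alpha> \<in> V ` S \<longleftrightarrow> \<alpha> \<in> S" if "\<alpha> \<in> arcs" "S \<subseteq> arcs" for \<alpha> S
    using inj_on_image_mem_iff[OF fval_inj that] .
  have V_im: "V ` S \<in> (\<lambda>S. V ` S) ` X \<longleftrightarrow> S \<in> X" if S: "S \<subseteq> arcs" "X \<subseteq> Pow arcs" for S X
  proof
    assume "V ` S \<in> (\<lambda>S. V ` S) ` X"
    then obtain S' where "V ` S = V ` S'" "S' \<in> X" by blast
    thus "S \<in> X" using V_eq[of S S'] S by blast
  qed (rule imageI)
  note C = cluster_complex_eq[OF seed] and X = cluster_seed_of[OF seed]
  have UC: "\<Union>(cluster_complex n x B) = V ` arcs"
    unfolding C using noncrossing_singleton by blast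
  have P: "positive_cluster_complex n x B = (\<lambda>S. V ` S) ` {S. S \<subseteq> arcs - fan \<and> noncrossing S}"
    unfolding positive_cluster_complex_def full_subcomplex_def UC X
  proof (intro subset_antisym subsetI)
    fix \<sigma> assume "\<sigma> \<in> {\<sigma> \<in> cluster_complex n x B. \<sigma> \<subseteq> V ` arcs - V ` fan}"
    then obtain S where "S \<subseteq> arcs" "noncrossing S" "\<sigma> = V ` S" "V ` S \<subseteq> V ` arcs - V ` fan"
      unfolding C by auto
    thus "\<sigma> \<in> (\<lambda>S. V ` S) ` {S. S \<subseteq> arcs - fan \<and> noncrossing S}" by blast
  next
    fix \<sigma> assume "\<sigma> \<in> (\<lambda>S. V ` S) ` {S. S \<subseteq> arcs - fan \<and> noncrossing S}"
    then obtain S where S: "S \<subseteq> arcs - fan" "noncrossing S" "\<sigma> = V ` S" by blast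
    have "V \<alpha> \<in> V ` arcs - V ` fan" if "\<alpha> \<in> S" for \<alpha>
      using that V_mem[of \<alpha> fan] fan_arcs S(1) by auto
    hence "\<sigma> \<subseteq> V ` arcs - V ` fan" unfolding S(3) by (rule image_subsetI)
    moreover have "S \<in> ?NC" using S by auto
    hence "\<sigma> \<in> cluster_complex n x B" unfolding C S(3) by (rule imageI)
    ultimately show "\<sigma> \<in> {\<sigma> \<in> cluster_complex n x B. \<sigma> \<subseteq> V ` arcs - V ` fan}" by simp
  qed
  have P_iff: "V ` S \<in> positive_cluster_complex n x B \<longleftrightarrow> S \<subseteq> arcs - fan \<and> noncrossing S"
    if "S \<subseteq> arcs" for S
    unfolding P by (subst V_im[OF that]) auto
  have UP: "\<Union>(positive_cluster_complex n x B) = V ` (arcs - fan)"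
  proof
    show "V ` (arcs - fan) \<subseteq> \<Union>(positive_cluster_complex n x B)"
    proof
      fix z assume "z \<in> V ` (arcs - fan)"
      then obtain \<alpha> where \<alpha>: "\<alpha> \<in> arcs - fan" "z = V \<alpha>" by blast
      hence "V ` {\<alpha>} \<in> positive_cluster_complex n x B"
        using P_iff[of "{\<alpha>}"] noncrossing_singleton by auto
      thus "z \<in> \<Union>(positive_cluster_complex n x B)" using \<alpha>(2) by auto
    qed
  qed (unfold P, blast)
  have St: "star (cluster_complex n x B) (cluster n x) =
      (\<lambda>S. V ` S) ` {S. S \<subseteq> arcs - ?J \<and> noncrossing S}"
  proof (intro subset_antisym subsetI)
    fix \<sigma> assume "\<sigma> \<in> star (cluster_complex n x B) (cluster n x)"
    then obtain \<alpha> S S' where S: "\<alpha> \<in> fan" "S \<subseteq> arcs" "noncrossing S" "\<sigma> = V ` S"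
      "V ` S \<union> {V \<alpha>} = V ` S'" "S' \<subseteq> arcs" "noncrossing S'"
      unfolding star_def vertex_star_def X C by auto
    have "V ` (insert \<alpha> S) = V ` S'" using S(5) by simp
    hence "insert \<alpha> S = S'" using V_eq[of "insert \<alpha> S" S'] S fan_arcs by blast
    hence "S \<inter> ?J = {}" using star_fan_iff[OF S(2,3)] S(1,7) by blast
    thus "\<sigma> \<in> (\<lambda>S. V ` S) ` {S. S \<subseteq> arcs - ?J \<and> noncrossing S}" using S by blast
  next
    fix \<sigma> assume "\<sigma> \<in> (\<lambda>S. V ` S) ` {S. S \<subseteq> arcs - ?J \<and> noncrossing S}"
    then obtain S where S: "S \<subseteq> arcs" "S \<inter> ?J = {}" "noncrossing S" "\<sigma> = V ` S" by blast
    obtain \<alpha> where \<alpha>: "\<alpha> \<in> fan" "noncrossing (insert \<alpha> S)"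
      using star_fan_iff[OF S(1,3)] S(2) by blast
    have "V ` (insert \<alpha> S) \<in> cluster_complex n x B" "V ` S \<in> cluster_complex n x B"
      unfolding C using \<alpha> S fan_arcs by blast+
    thus "\<sigma> \<in> star (cluster_complex n x B) (cluster n x)"
      unfolding star_def vertex_star_def X S(4) using \<alpha>(1) by auto
  qed
  have S_iff: "V ` S \<in> star (cluster_complex n x B) (cluster n x) \<longleftrightarrow> S \<subseteq> arcs - ?J \<and> noncrossing S"
    if "S \<subseteq> arcs" for S
    unfolding St by (subst V_im[OF that]) auto
  have US: "\<Union>(star (cluster_complex n x B) (cluster n x)) = V ` (arcs - ?J)"
  proof
    show "V ` (arcs - ?J) \<subseteq> \<Union>(star (cluster_complex n x B) (cluster n x))"
    proof
      fix z assume "z \<in> V ` (arcs - ?J)"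
      then obtain \<alpha> where \<alpha>: "\<alpha> \<in> arcs - ?J" "z = V \<alpha>" by blast
      hence "V ` {\<alpha>} \<in> star (cluster_complex n x B) (cluster n x)"
        using S_iff[of "{\<alpha>}"] noncrossing_singleton by auto
      thus "z \<in> \<Union>(star (cluster_complex n x B) (cluster n x))" using \<alpha>(2) by auto
    qed
  qed (unfold St, blast)
  have rA: "reflect ` (arcs - fan) = arcs - ?J"
  proof (intro subset_antisym subsetI)
    fix \<beta> assume "\<beta> \<in> reflect ` (arcs - fan)"
    then obtain \<alpha> where "\<alpha> \<in> arcs" "\<alpha> \<notin> fan" "\<beta> = reflect \<alpha>" by blast
    thus "\<beta> \<in> arcs - ?J" using reflect_reflect reflect_arcs fan_arcs by (metis DiffI imageE subsetD)
  next
    fix \<beta> assume "\<beta> \<in> arcs - ?J"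
    hence "reflect \<beta> \<in> arcs - fan" "\<beta> = reflect (reflect \<beta>)"
      using reflect_reflect[of \<beta>] reflect_arcs[of \<beta>] by (auto, metis imageI)
    thus "\<beta> \<in> reflect ` (arcs - fan)" by blast
  qed
  have r_inj: "inj_on reflect arcs" by (rule inj_on_inverseI[of _ reflect]) (rule reflect_reflect)
  define f where "f = V \<circ> reflect \<circ> inv_into arcs V"
  have f: "f (V \<alpha>) = V (reflect \<alpha>)" if "\<alpha> \<in> arcs" for \<alpha>
    using that by (simp add: f_def inv_into_f_f[OF fval_inj])
  have fS: "f ` (V ` S) = V ` (reflect ` S)" if "S \<subseteq> arcs" for S
    using that f by (force simp: image_image)
  have "inj_on f (V ` (arcs - fan))"
  proof (rule inj_onI)
    fix z w assume "z \<in> V ` (arcs - fan)" "w \<in> V ` (arcs - fan)" and eq: "f z = f w"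
    then obtain \<alpha> \<beta> where \<alpha>: "\<alpha> \<in> arcs" "z = V \<alpha>" and \<beta>: "\<beta> \<in> arcs" "w = V \<beta>" by blast
    hence "V (reflect \<alpha>) = V (reflect \<beta>)" using eq f by simp
    hence "reflect \<alpha> = reflect \<beta>" using inj_onD[OF fval_inj] reflect_arcs \<alpha>(1) \<beta>(1) by blast
    thus "z = w" using inj_onD[OF r_inj] \<alpha> \<beta> by blast
  qed
  moreover have "f ` (V ` (arcs - fan)) = V ` (arcs - ?J)" using fS[of "arcs - fan"] rA by auto
  ultimately have bij: "bij_betw f (V ` (arcs - fan)) (V ` (arcs - ?J))" by (simp add: bij_betw_def)
  have "\<sigma> \<in> positive_cluster_complex n x B \<longleftrightarrow> f ` \<sigma> \<in> star (cluster_complex n x B) (cluster n x)"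
    if \<sigma>: "\<sigma> \<subseteq> V ` (arcs - fan)" for \<sigma>
  proof -
    obtain S where S: "S \<subseteq> arcs - fan" "\<sigma> = V ` S" using \<sigma> subset_image_iff[of \<sigma> V "arcs - fan"] by auto
    hence A: "S \<subseteq> arcs" "reflect ` S \<subseteq> arcs - ?J" using rA by blast+
    \<comment> \<open>Since the reflection is an involution, preservation of noncrossing sets in one
      direction gives the equivalence.\<close>
    have "reflect ` (reflect ` S) = S" using reflect_reflect A(1) by (force simp: image_image)
    hence "noncrossing (reflect ` S) \<longleftrightarrow> noncrossing S"
      using noncrossing_reflect[OF A(1)] noncrossing_reflect[of "reflect ` S"] A(2) by auto
    thus ?thesis using P_iff[OF A(1)] S_iff[of "reflect ` S"] fS[OF A(1)] A(2) S by auto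
  qed
  with bij show ?thesis unfolding complex_isomorphic_def UP US by blast
qed

end

section \<open>Reversal of all arrows\<close>

lemma mutate_matrix_uminus: "mutate_matrix k (\<lambda>i j. - B i j) = (\<lambda>i j. - mutate_matrix k B i j)"
proof (intro ext)
  fix i j
  have p: "pos_part (- b) = pos_part b - b" for b by (simp add: pos_part_def)
  show "mutate_matrix k (\<lambda>i j. - B i j) i j = - mutate_matrix k B i j"
    by (simp add: mutate_matrix_def p algebra_simps)
qed

text \<open>Negating the matrix merely swaps the two monomials of the exchange relation, and matrix
  mutation commutes with the sign.\<close>

lemma seed_step_uminus:
  "seed_step n (x, B) (x', B') \<Longrightarrow> seed_step n (x, \<lambda>i j. - B i j) (x', \<lambda>i j. - B' i j)"
  by (auto simp: seed_step_def mutate_seed_def mutate_cluster_def mutate_matrix_uminus add.commute)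

lemma cluster_complex_uminus_subset:
  "cluster_complex n x B \<subseteq> cluster_complex n x (\<lambda>i j. - B i j)"
proof
  fix \<sigma> assume "\<sigma> \<in> cluster_complex n x B"
  then obtain x' B' where s: "(seed_step n)\<^sup>*\<^sup>* (x, B) (x', B')" "\<sigma> \<subseteq> cluster n x'"
    by (auto simp: cluster_complex_def)
  let ?neg = "\<lambda>s. (fst s, \<lambda>i j. - snd s i j)"
  from s(1) have "(seed_step n)\<^sup>*\<^sup>* (?neg (x, B)) (?neg (x', B'))"
  proof (induction rule: rtranclp_induct)
    case (step s1 s2)
    have "seed_step n (?neg s1) (?neg s2)"
      using seed_step_uminus[of n "fst s1" "snd s1" "fst s2" "snd s2"] step.hyps(2) by simp
    with step.IH show ?case by (rule rtranclp.rtrancl_into_rtrancl)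
  qed simp
  thus "\<sigma> \<in> cluster_complex n x (\<lambda>i j. - B i j)"
    using s(2) unfolding cluster_complex_def by auto
qed

lemma cluster_complex_uminus: "cluster_complex n x (\<lambda>i j. - B i j) = cluster_complex n x B"
  using cluster_complex_uminus_subset[of n x B] cluster_complex_uminus_subset[of n x "\<lambda>i j. - B i j"]
  by auto

lemma skew_symmetrizable_sign:
  assumes "skew_symmetrizable n B" "i \<in> {1..n}" "j \<in> {1..n}"
  shows "B i j > 0 \<longleftrightarrow> B j i < 0"
proof -
  obtain s :: "nat \<Rightarrow> int" where s: "s i > 0" "s j > 0" "s i * B i j = - (s j * B j i)"
    using assms unfolding skew_symmetrizable_def by blast
  have "B i j > 0 \<longleftrightarrow> s i * B i j > 0" using s(1) by (simp add: zero_less_mult_iff)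
  also have "\<dots> \<longleftrightarrow> s j * B j i < 0" unfolding s(3) by simp
  also have "\<dots> \<longleftrightarrow> B j i < 0" using s(2) by (simp add: mult_less_0_iff)
  finally show ?thesis .
qed

lemma valued_quiver_of_uminus:
  assumes "skew_symmetrizable n B"
  shows "valued_quiver_of n (\<lambda>i j. - B i j) = (\<lambda>(i, j, u, v). (j, i, v, u)) ` valued_quiver_of n B"
proof (intro subset_antisym subsetI)
  let ?r = "\<lambda>(i, j, u, v). (j, i, v, u)"
  fix t assume "t \<in> valued_quiver_of n (\<lambda>i j. - B i j)"
  then obtain i j where t: "t = (i, j, - B i j, B j i)" and ij: "i \<in> {1..n}" "j \<in> {1..n}" "B i j < 0"
    by (auto simp: valued_quiver_of_def)
  hence "(j, i, B j i, - B i j) \<in> valued_quiver_of n B"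
    using skew_symmetrizable_sign[OF assms, of j i] by (auto simp: valued_quiver_of_def)
  thus "t \<in> ?r ` valued_quiver_of n B" by (rule rev_image_eqI) (simp add: t)
next
  let ?r = "\<lambda>(i, j, u, v). (j, i, v, u)"
  fix t assume "t \<in> ?r ` valued_quiver_of n B"
  then obtain i j where t: "t = (j, i, - B j i, B i j)" and ij: "i \<in> {1..n}" "j \<in> {1..n}" "B i j > 0"
    by (auto simp: valued_quiver_of_def)
  thus "t \<in> valued_quiver_of n (\<lambda>i j. - B i j)"
    using skew_symmetrizable_sign[OF assms, of i j] by (auto simp: valued_quiver_of_def)
qed

lemma linear_quiver_reverse:
  "(\<lambda>(i, j, u, v). (j, i, v, u)) ` linear_quiver_up n (u, v) = linear_quiver_down n (v, u)"
  by (simp add: linear_quiver_up_def linear_quiver_down_def image_Un setcompr_eq_image image_image)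

lemma quiver_relabel_eq_reverse:
  assumes "quiver_relabel_eq n Q Q'"
  shows "quiver_relabel_eq n ((\<lambda>(i, j, u, v). (j, i, v, u)) ` Q) ((\<lambda>(i, j, u, v). (j, i, v, u)) ` Q')"
proof -
  let ?r = "\<lambda>(i, j, u, v). (j, i, v, u)"
  obtain \<pi> where \<pi>: "\<pi> permutes {1..n}" "(\<lambda>(i, j, v). (\<pi> i, \<pi> j, v)) ` Q = Q'"
    using assms by (auto simp: quiver_relabel_eq_def)
  have "(\<lambda>(i, j, v). (\<pi> i, \<pi> j, v)) ` ?r ` Q = ?r ` Q'"
    unfolding \<pi>(2)[symmetric] image_image by (intro image_cong) auto
  thus ?thesis using \<pi>(1) unfolding quiver_relabel_eq_def by blast
qed

text \<open>The right-hand side has the shape of \<open>exchange_entry\<close> on the fan: row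
  weight, column weight, signed adjacency, with \<open>n\<close> in the role of the loop. Entries
  without an arrow either way vanish because \<open>B i j\<close> and \<open>B j i\<close> have
  opposite signs.\<close>

lemma linear_quiver_entries:
  assumes n: "n \<ge> 2" and B: "skew_symmetrizable n B" and \<pi>: "\<pi> permutes {1..n}"
    and Q: "(\<lambda>(i, j, v). (\<pi> i, \<pi> j, v)) ` valued_quiver_of n B = linear_quiver_down n (u, v)"
    and ij: "i \<in> {1..n}" "j \<in> {1..n}"
  shows "B i j = (if \<pi> i = n then u else 1) * (if \<pi> j = n then v else 1) *
    (of_bool (\<pi> i = \<pi> j + 1) - of_bool (\<pi> j = \<pi> i + 1))"
proof -
  have inj: "\<pi> i = \<pi> j \<longleftrightarrow> i = j" for i j using permutes_inj[OF \<pi>] by (auto dest: injD)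
  have range: "\<pi> i \<in> {1..n}" if "i \<in> {1..n}" for i using permutes_in_image[OF \<pi>] that by blast
  have pos: "\<pi> i = \<pi> j + 1 \<and> B i j = (if \<pi> i = n then u else 1) \<and> - B j i = (if \<pi> i = n then v else 1)"
    if "i \<in> {1..n}" "j \<in> {1..n}" "B i j > 0" for i j
  proof -
    have "(i, j, B i j, - B j i) \<in> valued_quiver_of n B" using that by (auto simp: valued_quiver_of_def)
    hence "(\<pi> i, \<pi> j, B i j, - B j i) \<in> linear_quiver_down n (u, v)" using Q by force
    thus ?thesis using n by (auto simp: linear_quiver_down_def)
  qed
  have conv: "B i j > 0" if "i \<in> {1..n}" "j \<in> {1..n}" "\<pi> i = \<pi> j + 1" for i j
  proof -
    have "\<exists>w. (\<pi> i, \<pi> j, w) \<in> linear_quiver_down n (u, v)"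
    proof (cases "\<pi> i = n")
      case True
      thus ?thesis using that(3) by (auto simp: linear_quiver_down_def)
    next
      case False
      hence "1 \<le> \<pi> j \<and> \<pi> j + 1 < n" using range that by fastforce
      thus ?thesis using that(3) by (auto simp: linear_quiver_down_def)
    qed
    then obtain w where "(\<pi> i, \<pi> j, w) \<in> (\<lambda>(i, j, v). (\<pi> i, \<pi> j, v)) ` valued_quiver_of n B"
      using Q by auto
    thus ?thesis using inj by (auto simp: valued_quiver_of_def)
  qed
  consider "B i j > 0" | "B j i > 0" | "\<not> B i j > 0" "\<not> B j i > 0" by blast
  thus ?thesis
  proof cases
    case 1
    thus ?thesis using pos[OF ij] range[OF ij(1)] by auto
  next
    case 2
    thus ?thesis using pos[OF ij(2,1)] range[OF ij(2)] by auto
  next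
    case 3
    hence "B i j = 0" using skew_symmetrizable_sign[OF B ij] skew_symmetrizable_sign[OF B ij(2,1)] by linarith
    thus ?thesis using conv[OF ij] conv[OF ij(2,1)] 3 by auto
  qed
qed

text \<open>Index \<open>i\<close> labels the arc \<open>(0, \<pi> i + 1)\<close>, so the source of
  the quiver labels the loop. The choice \<open>N = n + 1\<close> gives the fan exactly
  \<open>n\<close> arcs.\<close>

lemma isomorphic_if_linear_quiver_down:
  fixes x :: "nat \<Rightarrow> 'a::field_char_0"
  assumes n: "n \<ge> 2" and seed: "labeled_seed n x B"
    and \<kappa>: "\<kappa> = 1 \<and> \<kappa>' = 2 \<or> \<kappa> = 2 \<and> \<kappa>' = 1"
    and Q: "quiver_relabel_eq n (valued_quiver_of n B) (linear_quiver_down n (int \<kappa>, int \<kappa>'))"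
  shows "complex_isomorphic (positive_cluster_complex n x B) (star (cluster_complex n x B) (cluster n x))"
proof -
  have indep: "algebraically_independent n x" and skew: "skew_symmetrizable n B"
    using seed by (auto simp: labeled_seed_def free_generating_set_def)
  obtain \<pi> where \<pi>: "\<pi> permutes {1..n}"
    and Q': "(\<lambda>(i, j, v). (\<pi> i, \<pi> j, v)) ` valued_quiver_of n B = linear_quiver_down n (int \<kappa>, int \<kappa>')"
    using Q by (auto simp: quiver_relabel_eq_def)
  define N where "N = int n + 1"
  interpret punctured_polygon N by unfold_locales (use n in \<open>simp add: N_def\<close>)
  define z where "z k = x (inv \<pi> (nat (k - 1)))" for k
  \<comment> \<open>Specialized at the point with all coordinates 1, \<open>x i\<close> has the
    nonzero value 1.\<close>
  have x_nz: "x i \<noteq> 0" if "i \<in> {1..n}" for i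
    using specializes_nonzero[OF indep specializes_var[OF indep that, of "\<lambda>_. 1"]] by simp
  have inv: "\<exists>i\<in>{1..n}. z k = x i \<and> k = int (\<pi> i) + 1" if "2 \<le> k" "k \<le> N" for k
  proof -
    have "nat (k - 1) \<in> {1..n}" using that by (auto simp: N_def)
    hence "inv \<pi> (nat (k - 1)) \<in> {1..n}" using permutes_in_image[OF permutes_inv[OF \<pi>]] by blast
    moreover have "\<pi> (inv \<pi> (nat (k - 1))) = nat (k - 1)" using permutes_inverses(1)[OF \<pi>] .
    ultimately show ?thesis using that by (intro bexI[of _ "inv \<pi> (nat (k - 1))"]) (auto simp: z_def)
  qed
  have z_nz: "z k \<noteq> 0" if "2 \<le> k" "k \<le> N" for k using inv[OF that] x_nz by auto
  obtain l :: "int \<Rightarrow> int \<Rightarrow> 'a" and d where F: "frieze \<kappa> \<kappa>' l d"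
    and init: "\<And>k. 2 \<le> k \<Longrightarrow> k \<le> N \<Longrightarrow> fval l d (0, k) = z k"
    using ex_frieze[OF \<kappa>, of z] z_nz by blast
  have init': "\<exists>i\<in>{1..n}. fval l d (0, k) = x i \<and> k = int (\<pi> i) + 1" if "2 \<le> k" "k \<le> N" for k
    using inv[OF that] init[OF that] by simp
  note distinct = frieze_values_distinct[OF indep F \<kappa> init']
  \<comment> \<open>\<open>frieze_values_distinct\<close> speaks of two different arcs; one of the
    loops at 0 and 1 is a partner for any given arc.\<close>
  have "(0, N) \<in> arcs" "(1, N + 1) \<in> arcs" using N_ge_2 by (auto simp: arcs_def)
  hence "\<exists>\<beta>\<in>arcs. \<alpha> \<noteq> \<beta>" for \<alpha> by (metis prod.inject zero_neq_one)
  hence nz: "fval l d \<alpha> \<noteq> 0" if "\<alpha> \<in> arcs" for \<alpha> using distinct(2)[OF _ _ that] by blast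
  have "inj_on (fval l d) arcs" using distinct(1) by (intro inj_onI) blast
  then interpret cluster_frieze N \<kappa> \<kappa>' l d by unfold_locales (use F \<kappa> nz in auto)
  define a where "a i = (0 :: int, int (\<pi> i) + 1)" for i
  have range: "\<pi> i \<in> {1..n}" if "i \<in> {1..n}" for i using permutes_in_image[OF \<pi>] that by blast
  have "seed_of n fan (x, B)"
    unfolding seed_of_def prod.case
  proof (intro conjI exI ballI fan_triangulation)
    show "bij_betw a {1..n} fan"
    proof (rule bij_betw_imageI)
      show "inj_on a {1..n}" using permutes_inj[OF \<pi>] by (auto simp: a_def inj_on_def dest: injD)
      show "a ` {1..n} = fan"
      proof (intro subset_antisym subsetI)
        fix \<alpha> assume "\<alpha> \<in> a ` {1..n}"
        then obtain i where "\<alpha> = (0, int (\<pi> i) + 1)" "i \<in> {1..n}" by (auto simp: a_def)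
        moreover from this have "2 \<le> int (\<pi> i) + 1" "int (\<pi> i) + 1 \<le> N"
          using range[of i] by (auto simp: N_def)
        ultimately show "\<alpha> \<in> fan" by (auto simp: fan_def)
      next
        fix \<alpha> assume "\<alpha> \<in> fan"
        then obtain k where "\<alpha> = (0, k)" "2 \<le> k" "k \<le> N" by (auto simp: fan_def)
        thus "\<alpha> \<in> a ` {1..n}" using inv[of k] by (auto simp: a_def)
      qed
    qed
  next
    fix i assume i: "i \<in> {1..n}"
    have "2 \<le> int (\<pi> i) + 1" "int (\<pi> i) + 1 \<le> N" using range[OF i] by (auto simp: N_def)
    thus "x i = V (a i)" using init[of "int (\<pi> i) + 1"] permutes_inverses(2)[OF \<pi>]
      by (simp add: a_def z_def)
  next
    fix i j assume ij: "i \<in> {1..n}" "j \<in> {1..n}"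
    have r: "2 \<le> int (\<pi> i) + 1" "int (\<pi> i) + 1 \<le> N" "2 \<le> int (\<pi> j) + 1" "int (\<pi> j) + 1 \<le> N"
      using range ij by (auto simp: N_def)
    have adj: "signed_adjacency fan (a i) (a j) = of_bool (\<pi> i = \<pi> j + 1) - of_bool (\<pi> j = \<pi> i + 1)"
      unfolding a_def signed_adjacency_fan[OF r] by (intro arg_cong2[where f = "(-)"] arg_cong[where f = of_bool]) auto
    have "int (row_weight (a i)) = (if \<pi> i = n then int \<kappa> else 1)"
      "int (col_weight (a j)) = (if \<pi> j = n then int \<kappa>' else 1)"
      unfolding row_weight_def col_weight_def a_def by (simp_all add: N_def)
    thus "B i j = exchange_entry fan (a i) (a j)"
      unfolding exchange_entry_def adj linear_quiver_entries[OF n skew \<pi> Q' ij] by simp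
  qed
  thus ?thesis by (rule positive_complex_isomorphic_star)
qed

theorem theorem4p14:
  fixes n :: nat and x :: "nat \<Rightarrow> 'a::field_char_0" and B :: int_matrix
  assumes "n \<ge> 2"
    and "labeled_seed n x B"
    and "of_type_B n B \<or> of_type_C n B"
    and "quiver_relabel_eq n (valued_quiver_of n B) (linear_quiver_up n (1, 2)) \<or>
         quiver_relabel_eq n (valued_quiver_of n B) (linear_quiver_down n (2, 1)) \<or>
         quiver_relabel_eq n (valued_quiver_of n B) (linear_quiver_up n (2, 1)) \<or>
         quiver_relabel_eq n (valued_quiver_of n B) (linear_quiver_down n (1, 2))"
    and "I = cluster n x"
  shows "complex_isomorphic (positive_cluster_complex n x B) (star (cluster_complex n x B) I)"
proof -
  \<comment> \<open>Negation reverses the quiver, swaps the components of every value and keeps all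
    clusters, so the upward forms reduce to the downward ones.\<close>
  let ?B = "\<lambda>i j. - B i j"
  have down: "complex_isomorphic (positive_cluster_complex n x C) (star (cluster_complex n x C) I)"
    if "labeled_seed n x C" "quiver_relabel_eq n (valued_quiver_of n C) (linear_quiver_down n (1, 2)) \<or>
      quiver_relabel_eq n (valued_quiver_of n C) (linear_quiver_down n (2, 1))" for C
    using isomorphic_if_linear_quiver_down[OF assms(1) that(1), of 1 2]
      isomorphic_if_linear_quiver_down[OF assms(1) that(1), of 2 1] that(2) assms(5) by auto
  have skew: "skew_symmetrizable n B" using assms(2) by (simp add: labeled_seed_def)
  have up: "quiver_relabel_eq n (valued_quiver_of n ?B) (linear_quiver_down n (v, u))"
    if "quiver_relabel_eq n (valued_quiver_of n B) (linear_quiver_up n (u, v))" for u v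
    using quiver_relabel_eq_reverse[OF that]
    unfolding valued_quiver_of_uminus[OF skew] linear_quiver_reverse .
  obtain s :: "nat \<Rightarrow> int" where s: "\<forall>i\<in>{1..n}. s i > 0"
    "\<And>i j. i \<in> {1..n} \<Longrightarrow> j \<in> {1..n} \<Longrightarrow> s i * B i j = - (s j * B j i)"
    using skew unfolding skew_symmetrizable_def by blast
  have "s i * - B i j = - (s j * - B j i)" if "i \<in> {1..n}" "j \<in> {1..n}" for i j
    unfolding mult_minus_right s(2)[OF that] by (rule refl)
  hence "skew_symmetrizable n ?B" using s(1) unfolding skew_symmetrizable_def by blast
  hence seed: "labeled_seed n x ?B" using assms(2) by (simp add: labeled_seed_def)
  have eq: "positive_cluster_complex n x ?B = positive_cluster_complex n x B"
    by (simp add: positive_cluster_complex_def cluster_complex_uminus)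
  from assms(4) show ?thesis
    using down[OF assms(2)] down[OF seed] up[of 1 2] up[of 2 1]
    unfolding eq cluster_complex_uminus by blast
qed

end
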